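(* Let $X\in\{A,B,C,D\}$ and $w\in W(X)$. Let $c=(c_1,c_2,\dots)$ be a further sequence of variables. Then $$\mathcal G^X_w(a,b;x)=\sum_{\substack{u\le w\\ v=u^{-1}w}}\mathcal H^X_{u,w}(\bar c,b;0)\,\mathcal G^X_v(a,c;x),$$ where $\mathcal H^X_{u,w}(\bar c,b;0)$ denotes $\mathcal H^X_{u,w}(a,b;x)$ with $a_i$ replaced by $\bar c_i$ for all $i$ and all $x_i$ set to $0$.
   Context: Let $\beta$ be an indeterminate; $x\oplus y=x+y+\beta xy$, $x\ominus y=(x-y)/(1+\beta y)$, $\bar x=-x/(1+\beta x)$. $W(A_{n-1})=S_n=\langle s_1,\dots,s_{n-1}\rangle$; $W(B_n)=W(C_n)$ the signed permutations of $\{\pm1,\dots,\pm n\}$ generated by $s_0$ (sign change of the first entry) and $s_i=(i,i+1)$; $W(D_n)=\langle s_{\hat1}=s_0s_1s_0,s_1,\dots,s_{n-1}\rangle$; $W(X)=\bigcup_nW(X_n)$; $\ell$ is length, $\le$ Bruhat order. $\mathrm{Id}_\beta(W)$: $\mathbb Z[\beta]$-algebra with generators $u_i$, $u_i^2=\beta u_i$, braid relations; basis $u_w$. Variables commute with the $u_i$; $h_i(x)=1+xu_i$; $A^{(n)}_i(x)=h_{n-1}(x)\cdots h_i(x)$; $G_{A_{n-1}}(a_1,\dots,a_{n-1})=A^{(n)}_1(a_1)\cdots A^{(n)}_{n-1}(a_{n-1})$; $F^B_n(x)=h_{n-1}(x)\cdots h_1(x)h_0(x)h_1(x)\cdots h_{n-1}(x)$,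 $F^C_n$ the same with $h_0(x)^2$, $F^D_n(x)=h_{n-1}(x)\cdots h_2(x)h_1(x)h_{\hat1}(x)h_2(x)\cdots h_{n-1}(x)$, $F^X_n(x_1,\dots,x_n)=\prod_iF^X_n(x_i)$. $\mathcal G^A_w(a,b)$ ($w\in S_n$) is the coefficient of $u_w$ in $G_{A_{n-1}}(\bar b_1,\dots,\bar b_{n-1})^{-1}G_{A_{n-1}}(a_1,\dots,a_{n-1})$; for $X=A$ write $\mathcal G^A_w(a,b;x):=\mathcal G^A_w(a,b)$ (no $x$). For $X\in\{B,C,D\}$, $\mathcal G^X_w(a,b;x)$ is the coefficient of $u_w$ in $G_A(\bar b)^{-1}F^X_\infty(x)G_A(a)$ with $G_A(a)=\lim_nG_{A_{n-1}}(a_1,\dots,a_{n-1})$, $F^X_\infty(x)=\lim_nF^X_n(x_1,\dots,x_n)$; its $x$-dependence is through $\beta$-supersymmetric functions ($f(t,\bar t,x_3,\dots)=f(0,0,x_3,\dots)$). $\mathcal G^X_v(a,c;x)$ is the same with $b$ replaced by $c$. Action on $a$-variables ($\bar a_i=-a_i/(1+\beta a_i)$): $s^{(a)}_i$ ($i\ge1$) swaps $a_i\leftrightarrow a_{i+1}$; $s^{(a)}_0$ swaps $a_1\leftrightarrow\bar a_1$; $s^{(a)}_{\hat1}$: $a_1\mapsto\bar a_2$, $a_2\mapsto\bar a_1$; others fixed. On a $\beta$-supersymmetric $f(x)$: $s^{(a)}_if=f$ for $i\ge1$, $s^{(a)}_0f(x)=f(a_1,x_1,x_2,\dots)$, $s^{(a)}_{\hat1}f(x)=f(a_1,a_2,x_1,x_2,\dots)$;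 $b,c$ are fixed. $\alpha_i(a)=a_i\oplus\bar a_{i+1}$ ($i\ge1$), $\alpha_0(a)=\bar a_1$ (type $B$), $\bar a_1\oplus\bar a_1$ (type $C$), $\alpha_{\hat1}(a)=\bar a_1\oplus\bar a_2$. $\pi^{(a)}_if=(f-(1+\beta\alpha_i(a))s^{(a)}_if)/\alpha_i(a)$, $\psi^{(a)}_i=\pi^{(a)}_i+\beta$, and $\psi^{(a)}_v=\psi^{(a)}_{i_1}\cdots\psi^{(a)}_{i_r}$ for any reduced word $v=s_{i_1}\cdots s_{i_r}$ (well defined). For $u\le w$ define $\mathcal H^X_{u,w}(a,b;x):=\psi^{(a)}_{u^{-1}w}\big(\mathcal G^X_w(a,b;x)\big)$. *)

theory Defs
  imports
    "HOL-Computational_Algebra.Polynomial"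
    "HOL-Library.Poly_Mapping"
    "HOL-Combinatorics.Transposition"
begin

section \<open>Formal power series in a family of commuting variables\<close>

typedef ('v, 'a) mps = "UNIV :: (('v \<Rightarrow>\<^sub>0 nat) \<Rightarrow> 'a) set"
  morphisms mcoeff Abs_mps ..

lemma mcoeff_Abs_mps [simp]: "mcoeff (Abs_mps f) = f"
  by (simp add: Abs_mps_inverse)

lemma mps_eqI: "(\<And>m. mcoeff f m = mcoeff g m) \<Longrightarrow> f = g"
  by (metis mcoeff_inject ext)

definition splits :: "('v \<Rightarrow>\<^sub>0 nat) \<Rightarrow> (('v \<Rightarrow>\<^sub>0 nat) \<times> ('v \<Rightarrow>\<^sub>0 nat)) set" where
  "splits m = {(p, q). p + q = m}"

lemma finite_splits [simp]: "finite (splits m)"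
proof -
  let ?N = "{..Max (insert 0 (Poly_Mapping.lookup m ` Poly_Mapping.keys m))}"
  define L where "L = {f. \<forall>x. (x \<in> Poly_Mapping.keys m \<longrightarrow> f x \<in> ?N) \<and>
    (x \<notin> Poly_Mapping.keys m \<longrightarrow> f x = (0::nat))}"
  have "finite L"
    unfolding L_def by (rule finite_set_of_finite_funs) auto
  moreover have "inj Poly_Mapping.lookup"
    by (rule injI) (rule poly_mapping_eqI, rule fun_cong)
  ultimately have fin: "finite {p. Poly_Mapping.lookup p \<in> L}"
    unfolding vimage_def[symmetric] by (rule finite_vimageI)
  have sub: "Poly_Mapping.lookup p \<in> L" if "p + q = m" for p q
  proof -
    have le: "Poly_Mapping.lookup p x \<le> Poly_Mapping.lookup m x" for x
      using that by (auto simp: lookup_add)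
    have "Poly_Mapping.lookup p x \<in> ?N" if "x \<in> Poly_Mapping.keys m" for x
      using le[of x] that
      by (meson Max_ge atMost_iff finite_imageI finite_insert finite_keys imageI insertI2 order_trans)
    moreover have "Poly_Mapping.lookup p x = 0" if "x \<notin> Poly_Mapping.keys m" for x
      using le[of x] that by (simp add: in_keys_iff)
    ultimately show ?thesis by (auto simp: L_def)
  qed
  have "fst ` splits m \<subseteq> {p. Poly_Mapping.lookup p \<in> L}"
  proof
    fix p assume "p \<in> fst ` splits m"
    then obtain q where "p + q = m" by (auto simp: splits_def)
    then show "p \<in> {p. Poly_Mapping.lookup p \<in> L}" using sub by blast
  qed
  then have "finite (fst ` splits m)"
    using fin by (rule finite_subset)
  moreover have "inj_on fst (splits m)"
    by (auto simp: inj_on_def splits_def)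
  ultimately show ?thesis
    using finite_imageD by blast
qed

instantiation mps :: (type, comm_ring_1) comm_ring_1
begin

definition "0 = Abs_mps (\<lambda>_. 0)"
definition "1 = Abs_mps (\<lambda>m. if m = 0 then 1 else 0)"
definition "f + g = Abs_mps (\<lambda>m. mcoeff f m + mcoeff g m)"
definition "f - g = Abs_mps (\<lambda>m. mcoeff f m - mcoeff g m)"
definition "- f = Abs_mps (\<lambda>m. - mcoeff f m)"
definition "f * g = Abs_mps (\<lambda>m. \<Sum>(p, q)\<in>splits m. mcoeff f p * mcoeff g q)"

lemmas mps_ring_defs = zero_mps_def one_mps_def plus_mps_def minus_mps_def
  uminus_mps_def times_mps_def

instance
proof
  fix f g h :: "('a, 'b) mps"
  show "f * g * h = f * (g * h)"
  proof (rule mps_eqI)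
    fix m
    have "mcoeff (f * g * h) m =
        (\<Sum>(z, r)\<in>splits m. \<Sum>(p, q)\<in>splits z. mcoeff f p * mcoeff g q * mcoeff h r)"
      by (simp add: times_mps_def sum_distrib_right case_prod_unfold)
    also have "\<dots> = (\<Sum>((z, r), (p, q))\<in>(SIGMA s:splits m. splits (fst s)).
        mcoeff f p * mcoeff g q * mcoeff h r)"
      by (simp add: sum.Sigma case_prod_unfold)
    also have "\<dots> = (\<Sum>((p, z), (q, r))\<in>(SIGMA s:splits m. splits (snd s)).
        mcoeff f p * (mcoeff g q * mcoeff h r))"
      by (rule sum.reindex_bij_witness
            [where i = "\<lambda>((p, z), (q, r)). ((p + q, r), (p, q))"
               and j = "\<lambda>((z, r), (p, q)). ((p, q + r), (q, r))"])
         (auto simp: splits_def add.assoc mult.assoc)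
    also have "\<dots> = (\<Sum>(p, z)\<in>splits m. \<Sum>(q, r)\<in>splits z. mcoeff f p * (mcoeff g q * mcoeff h r))"
      by (simp add: sum.Sigma case_prod_unfold)
    also have "\<dots> = mcoeff (f * (g * h)) m"
      by (simp add: times_mps_def sum_distrib_left case_prod_unfold)
    finally show "mcoeff (f * g * h) m = mcoeff (f * (g * h)) m" .
  qed
  show "f * g = g * f"
  proof (rule mps_eqI)
    fix m
    have "(\<Sum>(p, q)\<in>splits m. mcoeff f p * mcoeff g q) =
          (\<Sum>(p, q)\<in>splits m. mcoeff g p * mcoeff f q)"
      by (rule sum.reindex_bij_witness[where i = prod.swap and j = prod.swap])
         (auto simp: splits_def add.commute mult.commute)
    then show "mcoeff (f * g) m = mcoeff (g * f) m"
      by (simp add: times_mps_def)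
  qed
  show "1 * f = f"
  proof (rule mps_eqI)
    fix m
    have "(\<Sum>(p, q)\<in>splits m. (if p = 0 then 1 else 0) * mcoeff f q) =
          (\<Sum>s\<in>splits m. if s = (0, m) then mcoeff f m else 0)"
      by (rule sum.cong) (auto simp: splits_def split: if_splits)
    also have "\<dots> = (if (0, m) \<in> splits m then mcoeff f m else 0)"
      by (rule sum.delta) (rule finite_splits)
    also have "\<dots> = mcoeff f m"
      by (simp add: splits_def)
    finally have "(\<Sum>(p, q)\<in>splits m. (if p = 0 then 1 else 0) * mcoeff f q) = mcoeff f m" .
    then show "mcoeff (1 * f) m = mcoeff f m"
      by (simp add: times_mps_def one_mps_def)
  qed
  show "(f + g) * h = f * h + g * h"
    by (rule mps_eqI)
       (simp add: times_mps_def plus_mps_def distrib_right sum.distrib case_prod_unfold)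
  show "(0 :: ('a, 'b) mps) \<noteq> 1"
  proof
    assume "(0 :: ('a, 'b) mps) = 1"
    then have "mcoeff (0 :: ('a, 'b) mps) 0 = mcoeff 1 0" by simp
    then show False by (simp add: zero_mps_def one_mps_def)
  qed
qed (auto intro!: mps_eqI simp: mps_ring_defs algebra_simps)

end

definition mconst :: "'a::zero \<Rightarrow> ('v, 'a) mps" where
  "mconst c = Abs_mps (\<lambda>m. if m = 0 then c else 0)"

definition mvar :: "'v \<Rightarrow> ('v, 'a::zero_neq_one) mps" where
  "mvar v = Abs_mps (\<lambda>m. if m = Poly_Mapping.single v 1 then 1 else 0)"

text \<open>The exact quotient \<open>f / g\<close>; it is used only when \<open>g\<close> is not a zero divisor
  and divides \<open>f\<close>.\<close>

definition mquot :: "('v, 'a::comm_ring_1) mps \<Rightarrow> ('v, 'a) mps \<Rightarrow> ('v, 'a) mps" where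
  "mquot f g = (THE q. g * q = f)"

text \<open>Substitution of \<open>\<sigma> v\<close> for every variable \<open>v\<close>.  It is used only for \<open>\<sigma>\<close> such that each
  \<open>\<sigma> v\<close> has zero constant term and each variable occurs in only finitely many of the \<open>\<sigma> v\<close>;
  then only finitely many monomials \<open>m\<close> contribute to a given coefficient.\<close>

definition mono_subst :: "('v \<Rightarrow> ('v, 'a::comm_ring_1) mps) \<Rightarrow> ('v \<Rightarrow>\<^sub>0 nat) \<Rightarrow> ('v, 'a) mps" where
  "mono_subst \<sigma> m = (\<Prod>v\<in>Poly_Mapping.keys m. \<sigma> v ^ Poly_Mapping.lookup m v)"

definition msubst :: "('v \<Rightarrow> ('v, 'a::comm_ring_1) mps) \<Rightarrow> ('v, 'a) mps \<Rightarrow> ('v, 'a) mps" where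
  "msubst \<sigma> f = Abs_mps (\<lambda>k.
     \<Sum>m | mcoeff (mono_subst \<sigma> m) k \<noteq> 0. mcoeff f m * mcoeff (mono_subst \<sigma> m) k)"

section \<open>The coefficient ring\<close>

text \<open>All families of variables are indexed from 1; index 0 is not used.\<close>

datatype var = VA nat | VB nat | VC nat | VX nat

type_synonym R = "(var, int poly) mps"

definition beta :: R where "beta = mconst [:0, 1:]"

definition oplus :: "R \<Rightarrow> R \<Rightarrow> R" where "oplus x y = x + y + beta * x * y"

definition bar :: "R \<Rightarrow> R" where "bar x = mquot (- x) (1 + beta * x)"

abbreviation avar :: "nat \<Rightarrow> R" where "avar i \<equiv> mvar (VA i)"
abbreviation bvar :: "nat \<Rightarrow> R" where "bvar i \<equiv> mvar (VB i)"
abbreviation cvar :: "nat \<Rightarrow> R" where "cvar i \<equiv> mvar (VC i)"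
abbreviation xvar :: "nat \<Rightarrow> R" where "xvar i \<equiv> mvar (VX i)"

section \<open>The Weyl groups\<close>

datatype ctype = TypeA | TypeB | TypeC | TypeD

datatype gen = Hat1 | Sgen nat

text \<open>Group elements are signed permutations of the integers (odd bijections of finite support);
  \<open>S\<^sub>n\<close> is the subgroup generated by \<open>s\<^sub>1, \<dots>, s\<^sub>n\<^sub>-\<^sub>1\<close>.\<close>

type_synonym sperm = "int \<Rightarrow> int"

definition simple :: "nat \<Rightarrow> sperm" where
  "simple i = (if i = 0 then Transposition.transpose 1 (-1)
     else Transposition.transpose (int i) (int i + 1)
          \<circ> Transposition.transpose (- int i) (- int i - 1))"

fun gperm :: "gen \<Rightarrow> sperm" where
  "gperm (Sgen i) = simple i"
| "gperm Hat1 = simple 0 \<circ> simple 1 \<circ> simple 0"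

definition wprod :: "gen list \<Rightarrow> sperm" where
  "wprod p = foldr (\<circ>) (map gperm p) id"

fun gens_upto :: "ctype \<Rightarrow> nat \<Rightarrow> gen set" where
  "gens_upto TypeA n = {Sgen i |i. 1 \<le> i \<and> i < n}"
| "gens_upto TypeB n = {Sgen i |i. i < n}"
| "gens_upto TypeC n = {Sgen i |i. i < n}"
| "gens_upto TypeD n = (if n < 2 then {} else insert Hat1 {Sgen i |i. 1 \<le> i \<and> i < n})"

definition gens :: "ctype \<Rightarrow> gen set" where
  "gens X = (\<Union>n. gens_upto X n)"

definition weyl_upto :: "ctype \<Rightarrow> nat \<Rightarrow> sperm set" where
  "weyl_upto X n = {wprod p |p. set p \<subseteq> gens_upto X n}"

definition weyl :: "ctype \<Rightarrow> sperm set" where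
  "weyl X = (\<Union>n. weyl_upto X n)"

definition wlen :: "ctype \<Rightarrow> sperm \<Rightarrow> nat" where
  "wlen X w = (LEAST k. \<exists>p. set p \<subseteq> gens X \<and> wprod p = w \<and> length p = k)"

definition reduced :: "ctype \<Rightarrow> gen list \<Rightarrow> sperm \<Rightarrow> bool" where
  "reduced X p w \<longleftrightarrow> set p \<subseteq> gens X \<and> wprod p = w \<and> length p = wlen X w"

definition reflections :: "ctype \<Rightarrow> sperm set" where
  "reflections X = {g \<circ> gperm i \<circ> inv g |g i. g \<in> weyl X \<and> i \<in> gens X}"

definition bruhat :: "ctype \<Rightarrow> sperm \<Rightarrow> sperm \<Rightarrow> bool" where
  "bruhat X = (\<lambda>u w. \<exists>t\<in>reflections X. w = u \<circ> t \<and> wlen X u < wlen X w)\<^sup>*\<^sup>*"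

section \<open>The IdCoxeter algebra\<close>

definition braid_order :: "gen \<Rightarrow> gen \<Rightarrow> nat" where
  "braid_order i j = (LEAST m. 0 < m \<and> (gperm i \<circ> gperm j) ^^ m = id)"

fun alternating :: "gen \<Rightarrow> gen \<Rightarrow> nat \<Rightarrow> gen list" where
  "alternating i j 0 = []"
| "alternating i j (Suc m) = i # alternating j i m"

text \<open>Each defining relation equates two elements of the form \<open>\<beta>\<^sup>k u\<^sub>p\<close>, where
  \<open>u\<^sub>p = u\<^sub>i\<^sub>1 \<cdots> u\<^sub>i\<^sub>r\<close> for a word \<open>p = i\<^sub>1 \<cdots> i\<^sub>r\<close>.  Hence the presented algebra is the
  integral monoid algebra of the monoid of the \<open>\<beta>\<^sup>k u\<^sub>p\<close> modulo the congruence generated by these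
  relations.  The pair \<open>(p, k)\<close> stands for \<open>\<beta>\<^sup>k u\<^sub>p\<close>.\<close>

inductive id_step :: "ctype \<Rightarrow> gen list \<times> nat \<Rightarrow> gen list \<times> nat \<Rightarrow> bool" for X where
  square: "i \<in> gens X \<Longrightarrow> id_step X (p @ [i, i] @ q, k) (p @ [i] @ q, Suc k)"
| braid: "i \<in> gens X \<Longrightarrow> j \<in> gens X \<Longrightarrow> i \<noteq> j \<Longrightarrow> m = braid_order i j \<Longrightarrow>
    id_step X (p @ alternating i j m @ q, k) (p @ alternating j i m @ q, k)"

definition id_eq :: "ctype \<Rightarrow> gen list \<times> nat \<Rightarrow> gen list \<times> nat \<Rightarrow> bool" where
  "id_eq X = equivclp (id_step X)"

text \<open>\<open>id_times X u v k w\<close> says that \<open>u\<^sub>u u\<^sub>v = \<beta>\<^sup>k u\<^sub>w\<close> follows from the relations.  For all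
  \<open>u\<close> and \<open>v\<close> in \<open>weyl X\<close> there is exactly one such pair \<open>(k, w)\<close>.\<close>

definition id_times :: "ctype \<Rightarrow> sperm \<Rightarrow> sperm \<Rightarrow> nat \<Rightarrow> sperm \<Rightarrow> bool" where
  "id_times X u v k w \<longleftrightarrow> (\<exists>p q r. reduced X p u \<and> reduced X q v \<and> reduced X r w \<and>
     id_eq X (p @ q, 0) (r, k))"

text \<open>An element of the algebra over \<open>R\<close>, completed so as to contain infinite linear
  combinations of the basis, is the family of its coefficients \<open>w \<mapsto> f w\<close>
  with respect to the \<open>u\<^sub>w\<close>; it vanishes outside \<open>weyl X\<close>.\<close>

type_synonym ialg = "sperm \<Rightarrow> R"

definition id_mult :: "ctype \<Rightarrow> ialg \<Rightarrow> ialg \<Rightarrow> ialg" where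
  "id_mult X f g = (\<lambda>w. \<Sum>(u, v) | \<exists>k. id_times X u v k w.
     beta ^ (THE k. id_times X u v k w) * f u * g v)"

definition id_basis :: "sperm \<Rightarrow> ialg" where
  "id_basis w = (\<lambda>v. if v = w then 1 else 0)"

definition id_one :: ialg where "id_one = id_basis id"

definition id_prod :: "ctype \<Rightarrow> ialg list \<Rightarrow> ialg" where
  "id_prod X fs = foldr (id_mult X) fs id_one"

definition id_inverse :: "ctype \<Rightarrow> ialg \<Rightarrow> ialg" where
  "id_inverse X f = (THE g. (\<forall>w. w \<notin> weyl X \<longrightarrow> g w = 0) \<and>
     id_mult X f g = id_one \<and> id_mult X g f = id_one)"

text \<open>The limit of a sequence each of whose coefficients, with respect to the basis and then
  to the monomials in the variables, is eventually constant.\<close>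

definition id_lim :: "(nat \<Rightarrow> ialg) \<Rightarrow> ialg" where
  "id_lim f = (\<lambda>w. Abs_mps (\<lambda>m. THE z. \<forall>\<^sub>F n in sequentially. mcoeff (f n w) m = z))"

section \<open>Double Grothendieck polynomials\<close>

definition h_elt :: "gen \<Rightarrow> R \<Rightarrow> ialg" where
  "h_elt i x = (\<lambda>w. id_one w + x * id_basis (gperm i) w)"

definition A_elt :: "ctype \<Rightarrow> nat \<Rightarrow> nat \<Rightarrow> R \<Rightarrow> ialg" where
  "A_elt X n i x = id_prod X (map (\<lambda>j. h_elt (Sgen j) x) (rev [i..<n]))"

definition G_fin :: "ctype \<Rightarrow> nat \<Rightarrow> (nat \<Rightarrow> R) \<Rightarrow> ialg" where
  "G_fin X n a = id_prod X (map (\<lambda>i. A_elt X n i (a i)) [1..<n])"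

definition G_inf :: "ctype \<Rightarrow> (nat \<Rightarrow> R) \<Rightarrow> ialg" where
  "G_inf X a = id_lim (\<lambda>n. G_fin X n a)"

fun F_word :: "ctype \<Rightarrow> nat \<Rightarrow> gen list" where
  "F_word TypeA n = []"
| "F_word TypeB n = map Sgen (rev [1..<n]) @ [Sgen 0] @ map Sgen [1..<n]"
| "F_word TypeC n = map Sgen (rev [1..<n]) @ [Sgen 0, Sgen 0] @ map Sgen [1..<n]"
| "F_word TypeD n = map Sgen (rev [2..<n]) @ [Sgen 1, Hat1] @ map Sgen [2..<n]"

definition F_one :: "ctype \<Rightarrow> nat \<Rightarrow> R \<Rightarrow> ialg" where
  "F_one X n x = id_prod X (map (\<lambda>i. h_elt i x) (F_word X n))"

definition F_fin :: "ctype \<Rightarrow> nat \<Rightarrow> (nat \<Rightarrow> R) \<Rightarrow> ialg" where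
  "F_fin X n x = id_prod X (map (\<lambda>i. F_one X n (x i)) [1..<Suc n])"

definition F_inf :: "ctype \<Rightarrow> (nat \<Rightarrow> R) \<Rightarrow> ialg" where
  "F_inf X x = id_lim (\<lambda>n. F_fin X n x)"

text \<open>In type \<open>A\<close> the coefficient is the same for every \<open>n\<close> with \<open>w \<in> S\<^sub>n\<close>; the \<open>x\<close> are not
  used.\<close>

definition grothendieck ::
  "ctype \<Rightarrow> (nat \<Rightarrow> R) \<Rightarrow> (nat \<Rightarrow> R) \<Rightarrow> (nat \<Rightarrow> R) \<Rightarrow> sperm \<Rightarrow> R" where
  "grothendieck X a b x w =
     (if X = TypeA
      then (THE z. \<forall>n. w \<in> weyl_upto TypeA n \<longrightarrow>
              z = id_mult TypeA (id_inverse TypeA (G_fin TypeA n (\<lambda>i. bar (b i)))) (G_fin TypeA n a) w)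
      else id_mult X (id_inverse X (G_inf X (\<lambda>i. bar (b i))))
             (id_mult X (F_inf X x) (G_inf X a)) w)"

section \<open>Divided difference operators\<close>

text \<open>The operators act on power series in \<open>a\<close>, \<open>b\<close>, \<open>c\<close>, \<open>x\<close> that are \<open>\<beta>\<close>-supersymmetric in
  \<open>x\<close>.  The shift \<open>f(x\<^sub>1, x\<^sub>2, \<dots>) \<mapsto> f(a\<^sub>1, x\<^sub>1, x\<^sub>2, \<dots>)\<close> is the substitution
  \<open>x\<^sub>1 \<mapsto> a\<^sub>1\<close>, \<open>x\<^sub>i\<^sub>+\<^sub>1 \<mapsto> x\<^sub>i\<close>, made simultaneously with the one for the \<open>a\<^sub>i\<close>.\<close>

fun s_var :: "gen \<Rightarrow> var \<Rightarrow> R" where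
  "s_var (Sgen i) (VA k) =
     (if i = 0 then (if k = 1 then bar (avar 1) else avar k)
      else avar (Transposition.transpose i (i + 1) k))"
| "s_var (Sgen i) (VX k) =
     (if i = 0 then (if k = 1 then avar 1 else xvar (k - 1)) else xvar k)"
| "s_var Hat1 (VA k) =
     (if k = 1 then bar (avar 2) else if k = 2 then bar (avar 1) else avar k)"
| "s_var Hat1 (VX k) =
     (if k = 1 then avar 1 else if k = 2 then avar 2 else xvar (k - 2))"
| "s_var _ v = mvar v"

definition s_act :: "gen \<Rightarrow> R \<Rightarrow> R" where "s_act i = msubst (s_var i)"

fun alpha :: "ctype \<Rightarrow> gen \<Rightarrow> R" where
  "alpha X (Sgen i) =
     (if i = 0 then (if X = TypeC then oplus (bar (avar 1)) (bar (avar 1)) else bar (avar 1))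
      else oplus (avar i) (bar (avar (i + 1))))"
| "alpha X Hat1 = oplus (bar (avar 1)) (bar (avar 2))"

definition pi_op :: "ctype \<Rightarrow> gen \<Rightarrow> R \<Rightarrow> R" where
  "pi_op X i f = mquot (f - (1 + beta * alpha X i) * s_act i f) (alpha X i)"

definition psi_op :: "ctype \<Rightarrow> gen \<Rightarrow> R \<Rightarrow> R" where
  "psi_op X i f = pi_op X i f + beta * f"

text \<open>The value does not depend on the chosen reduced word.\<close>

definition psi :: "ctype \<Rightarrow> sperm \<Rightarrow> R \<Rightarrow> R" where
  "psi X v f = foldr (psi_op X) (SOME p. reduced X p v) f"

definition H_poly :: "ctype \<Rightarrow> sperm \<Rightarrow> sperm \<Rightarrow> R" where
  "H_poly X u w = psi X (inv u \<circ> w) (grothendieck X avar bvar xvar w)"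

fun cbar_var :: "var \<Rightarrow> R" where
  "cbar_var (VA i) = bar (cvar i)"
| "cbar_var (VX i) = 0"
| "cbar_var v = mvar v"

definition H_cbar :: "ctype \<Rightarrow> sperm \<Rightarrow> sperm \<Rightarrow> R" where
  "H_cbar X u w = msubst cbar_var (H_poly X u w)"

end

theory Submission
  imports Defs "HOL-Combinatorics.Permutations"
begin

text \<open>Put \<open>M = G\<^sub>A(\<bar>b)\<^sup>-\<^sup>1 F(x) G\<^sub>A(a)\<close> in the completed Id-Coxeter algebra.  The Yang--Baxter relations
  for the \<open>h\<^sub>i\<close> show that \<open>s\<^sub>i\<close> multiplies \<open>M\<close> on the right by the inverse of \<open>h\<^sub>i(\<alpha>\<^sub>i)\<close>, which amounts to
  \<open>\<psi>\<^sub>i M = M u\<^sub>i\<close>.  Hence \<open>\<H>\<^sub>u\<^sub>,\<^sub>w\<close> is the coefficient of \<open>u\<^sub>w\<close> in \<open>M u\<^sub>v\<close> with \<open>v = u\<^sup>-\<^sup>1w\<close>, and the formula is the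
  coefficient of \<open>u\<^sub>w\<close> in the product \<open>(G\<^sub>A(\<bar>b)\<^sup>-\<^sup>1 G\<^sub>A(\<bar>c)) (G\<^sub>A(\<bar>c)\<^sup>-\<^sup>1 F(x) G\<^sub>A(a))\<close>, where the first factor
  is \<open>M\<close> at \<open>a = \<bar>c\<close>, \<open>x = 0\<close>.  The summation over \<open>u \<le> w\<close> loses nothing: if \<open>w\<close> is the Demazure
  product of some \<open>u'\<close> and \<open>v\<close>, then \<open>w v\<^sup>-\<^sup>1 \<le> w\<close>.\<close>

section \<open>Signed permutations as Coxeter groups\<close>

text \<open>The index u is only a label for v: \<open>H_cbar X u w\<close> is a coefficient of
  \<open>P * ibasis v\<close>, and it collects every u' whose Demazure product with v is w, whether
  or not u is among them. So a sum over all v is immediate, and the order enters only to show that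
  the omitted v contribute nothing. At finite rank the relation for s_i changes the shape of M: s_0
  and s_hat1 turn one or two x variables into a variables, so a product of n factors F(x_j) comes
  back with n-1 or n-2 of them. Rank and number of variables must therefore vary independently, and
  the relation closes up only in the limit. The new factors F(a_1), F(a_2) appear in front and have
  to be moved next to G_A(a), so the F(x) must commute with each other; in types B and C this is
  where the Yang-Baxter relation of length four is needed. The algebra is given by a presentation,
  its products being read off from derivability. That it is a ring with basis u_w rests on
  Matsumoto's theorem and on the 0-Hecke action on signed permutations, which separates the classes
  of words.\<close>

fun rt :: "gen \<Rightarrow> int \<times> int" where
  "rt (Sgen i) = (if i = 0 then (-1, 1) else (int i, int i + 1))"
| "rt Hat1 = (-1, 2)"

text \<open>The pair (lo, hi) stands for the simple root e_hi - e_lo, where e_(-k) = -e_k: thus 2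
  e_1 for s_0 and e_1 + e_2 for \<open>Hat1\<close>. One formula for reflections and one for
  descents then serve all four types.\<close>

abbreviation lo :: "gen \<Rightarrow> int" where "lo g \<equiv> fst (rt g)"
abbreviation hi :: "gen \<Rightarrow> int" where "hi g \<equiv> snd (rt g)"

lemma gperm_apply:
  "gperm g k = (if k = lo g then hi g else if k = hi g then lo g
     else if k = - lo g then - hi g else if k = - hi g then - lo g else k)"
  by (cases g) (auto simp: simple_def transpose_def)

declare gperm.simps [simp del]

lemma rt_props: "lo g < hi g" "lo g \<noteq> 0" "hi g \<noteq> 0" "0 < hi g" "- hi g \<le> lo g"
  by (cases g; simp)+

lemma gperm_gperm [simp]: "gperm g (gperm g k) = k"
  using rt_props[of g] by (auto simp: gperm_apply)

lemma gperm_comp_gperm [simp]: "gperm g \<circ> gperm g = id"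
  by auto

lemma comp_gperm_gperm [simp]: "w \<circ> gperm g \<circ> gperm g = w" "gperm g \<circ> (gperm g \<circ> w) = w"
  by auto

lemma gperm_uminus: "gperm g (- k) = - gperm g k"
  using rt_props[of g] by (auto simp: gperm_apply)

lemma bij_gperm: "bij (gperm g)"
  by (rule o_bij[of "gperm g"]) auto

lemma gperm_lo_hi [simp]: "gperm g (lo g) = hi g" "gperm g (hi g) = lo g"
  by (auto simp: gperm_apply)

section \<open>Odd bijections and descents\<close>

definition signed :: "sperm \<Rightarrow> bool" where
  "signed w \<longleftrightarrow> bij w \<and> (\<forall>k. w (- k) = - w k)"

lemma signed_id [simp]: "signed id"
  by (simp add: signed_def)

lemma signed_gperm [simp]: "signed (gperm g)"
  by (simp add: signed_def bij_gperm gperm_uminus)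

lemma signed_comp [simp]: "signed v \<Longrightarrow> signed w \<Longrightarrow> signed (v \<circ> w)"
  by (auto simp: signed_def intro: bij_comp)

lemma signed_uminus: "signed w \<Longrightarrow> w (- k) = - w k"
  by (simp add: signed_def)

lemma signed_zero: "signed w \<Longrightarrow> w 0 = 0"
  using signed_uminus[of w 0] by simp

lemma signed_inj: "signed w \<Longrightarrow> w x = w y \<longleftrightarrow> x = y"
  by (auto simp: signed_def bij_def inj_def)

lemma signed_inj_uminus: "signed w \<Longrightarrow> w x = - w y \<longleftrightarrow> x = - y"
  by (metis signed_inj signed_uminus)

lemma signed_eq_0: "signed w \<Longrightarrow> w x = 0 \<longleftrightarrow> x = 0"
  by (metis signed_inj signed_zero)

text \<open>A right descent: w makes the simple root of g negative. The link with length comes only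
  with \<open>wlen_desc\<close> and \<open>wlen_not_desc\<close>.\<close>

definition desc :: "sperm \<Rightarrow> gen \<Rightarrow> bool" where
  "desc w g \<longleftrightarrow> w (hi g) < w (lo g)"

lemma not_desc_id [simp]: "\<not> desc id g"
  using rt_props(1)[of g] by (simp add: desc_def)

lemma desc_comp_gperm [simp]: "signed w \<Longrightarrow> desc (w \<circ> gperm g) g \<longleftrightarrow> \<not> desc w g"
  using rt_props(1)[of g] signed_inj[of w "hi g" "lo g"] by (auto simp: desc_def)

lemma gens_Sgen [simp]: "Sgen i \<in> gens X \<longleftrightarrow> (i = 0 \<longrightarrow> X = TypeB \<or> X = TypeC)"
proof (cases X)
  case TypeA
  then show ?thesis by (auto simp: gens_def)
next
  case TypeB
  then show ?thesis by (auto simp: gens_def)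
next
  case TypeC
  then show ?thesis by (auto simp: gens_def)
next
  case TypeD
  have "\<exists>n\<ge>2. i < n" by (rule exI[of _ "i + 2"]) auto
  with TypeD show ?thesis by (auto simp: gens_def not_less split: if_splits)
qed

lemma gens_Hat1 [simp]: "Hat1 \<in> gens X \<longleftrightarrow> X = TypeD"
  by (cases X) (auto simp: gens_def split: if_splits)

text \<open>A simple reflection makes only one positive root negative, its own; the two outcomes are
  the two pairs that name this root. Entries 0 are excluded because s_0 inverts (-1, 0) and (0, 1).
  Pairs (-k, k) are no roots in type D, and \<open>Hat1\<close> does invert (-1, 1) and (-2,
  2).\<close>

lemma gperm_inversion:
  assumes "r \<in> gens X" "g \<in> gens X" and "p < q" "p \<noteq> 0" "q \<noteq> 0" "lo g \<noteq> - hi g \<Longrightarrow> p \<noteq> - q"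
    and "gperm r q < gperm r p"
  shows "p = lo r \<and> q = hi r \<or> p = - hi r \<and> q = - lo r"
proof (cases r)
  case (Sgen i)
  then show ?thesis
    using assms by (cases "i = 0") (cases g; simp add: gperm_apply split: if_splits)+
next
  case Hat1
  then have "p \<noteq> - q"
    using assms by (cases g) auto
  then show ?thesis
    using assms(3-5,7) Hat1 by (simp add: gperm_apply split: if_splits)
qed

text \<open>By \<open>gperm_inversion\<close>, r can create the descent only if w carries the pair
  of g to the pair of r, up to sign; then w conjugates g into r.\<close>

lemma desc_fold:
  assumes "signed w" "g \<in> gens X" "r \<in> gens X" "\<not> desc w g" "desc (gperm r \<circ> w) g"
  shows "w \<circ> gperm g = gperm r \<circ> w"
proof -
  let ?p = "w (lo g)" and ?q = "w (hi g)"
  have pq: "?p = lo r \<and> ?q = hi r \<or> ?p = - hi r \<and> ?q = - lo r"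
    using assms rt_props[of g] 
    by (intro gperm_inversion[of r X g])
       (auto simp: desc_def signed_eq_0 signed_inj signed_inj_uminus order.strict_iff_order)
  show ?thesis
  proof
    fix k
    consider "k = lo g" | "k = hi g" | "k = - lo g" | "k = - hi g"
      | "k \<noteq> lo g" "k \<noteq> hi g" "k \<noteq> - lo g" "k \<noteq> - hi g" by blast
    then show "(w \<circ> gperm g) k = (gperm r \<circ> w) k"
    proof cases
      case 5
      then have "w k \<noteq> ?p" "w k \<noteq> ?q" "w k \<noteq> - ?p" "w k \<noteq> - ?q"
        using assms(1) by (auto simp: signed_inj signed_inj_uminus)
      then have "gperm r (w k) = w k"
        using pq by (auto simp: gperm_apply)
      then show ?thesis
        using 5 by (simp add: gperm_apply[of g k])
    qed (use pq in \<open>auto simp: gperm_uminus signed_uminus[OF assms(1)]\<close>)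
  qed
qed

section \<open>Words and the Weyl groups\<close>

lemma wprod_Nil [simp]: "wprod [] = id"
  by (simp add: wprod_def)

lemma wprod_Cons [simp]: "wprod (g # p) = gperm g \<circ> wprod p"
  by (simp add: wprod_def)

lemma wprod_append [simp]: "wprod (p @ q) = wprod p \<circ> wprod q"
  by (induction p) (auto simp: comp_assoc)

lemma signed_wprod [simp]: "signed (wprod p)"
  by (induction p) (simp_all del: o_apply id_apply)

lemma wprod_rev_apply [simp]: "wprod (rev p) (wprod p k) = k" "wprod p (wprod (rev p) k) = k"
  by (induction p arbitrary: k) auto

lemma wprod_rev: "wprod (rev p) \<circ> wprod p = id" "wprod p \<circ> wprod (rev p) = id"
  by auto

lemma inv_wprod: "inv (wprod p) = wprod (rev p)"
  using wprod_rev inv_unique_comp by blast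

lemma gens_upto_mono: "m \<le> n \<Longrightarrow> gens_upto X m \<subseteq> gens_upto X n"
  by (cases X) (auto split: if_splits)

lemma gens_upto_subset: "gens_upto X n \<subseteq> gens X"
  by (auto simp: gens_def)

lemma finite_subset_gens_upto:
  assumes "finite A" "A \<subseteq> gens X"
  shows "\<exists>n. A \<subseteq> gens_upto X n"
  using assms
proof (induction A)
  case (insert g A)
  then obtain m n where "A \<subseteq> gens_upto X n" "g \<in> gens_upto X m"
    by (auto simp: gens_def)
  then have "insert g A \<subseteq> gens_upto X (max m n)"
    using gens_upto_mono[of m "max m n" X] gens_upto_mono[of n "max m n" X] by auto
  then show ?case by blast
qed auto

lemma weyl_eq: "weyl X = {wprod p |p. set p \<subseteq> gens X}"
proof -
  have "wprod p \<in> weyl X" if "set p \<subseteq> gens X" for p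
    using finite_subset_gens_upto[OF _ that] by (auto simp: weyl_def weyl_upto_def)
  then show ?thesis
    using gens_upto_subset by (fastforce simp: weyl_def weyl_upto_def)
qed

lemma wprod_in_weyl [simp]: "set p \<subseteq> gens X \<Longrightarrow> wprod p \<in> weyl X"
  by (auto simp: weyl_eq)

lemma weyl_signed: "w \<in> weyl X \<Longrightarrow> signed w"
  by (auto simp: weyl_eq)

lemma weyl_bij: "w \<in> weyl X \<Longrightarrow> bij w"
  using weyl_signed by (auto simp: signed_def)

lemma id_in_weyl [simp]: "id \<in> weyl X"
  using wprod_in_weyl[of "[]"] by simp

lemma weyl_comp [simp]: "v \<in> weyl X \<Longrightarrow> w \<in> weyl X \<Longrightarrow> v \<circ> w \<in> weyl X"
proof -
  assume "v \<in> weyl X" "w \<in> weyl X"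
  then obtain p q where "set p \<subseteq> gens X" "set q \<subseteq> gens X" "v = wprod p" "w = wprod q"
    by (auto simp: weyl_eq)
  then show "v \<circ> w \<in> weyl X"
    using wprod_in_weyl[of "p @ q" X] by simp
qed

lemma gperm_in_weyl [simp]: "g \<in> gens X \<Longrightarrow> gperm g \<in> weyl X"
  using wprod_in_weyl[of "[g]"] by simp

lemma weyl_inv [simp]: "w \<in> weyl X \<Longrightarrow> inv w \<in> weyl X"
  using wprod_in_weyl[of "rev _" X] by (fastforce simp: weyl_eq inv_wprod)

lemma weyl_inv_comp [simp]:
  assumes "w \<in> weyl X"
  shows "w \<circ> inv w = id" "inv w \<circ> w = id"
    "w \<circ> (inv w \<circ> v) = v" "inv w \<circ> (w \<circ> v) = v" "v \<circ> w \<circ> inv w = v" "v \<circ> inv w \<circ> w = v"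
  using weyl_bij[OF assms]
  by (auto simp: fun_eq_iff bij_is_surj surj_f_inv_f bij_is_inj inv_f_f)

section \<open>Length, the exchange condition and reduced words\<close>

lemma wlen_le: "set p \<subseteq> gens X \<Longrightarrow> wlen X (wprod p) \<le> length p"
  unfolding wlen_def by (rule Least_le) auto

lemma reduced_exists: "w \<in> weyl X \<Longrightarrow> \<exists>p. reduced X p w"
  unfolding weyl_eq reduced_def wlen_def
  by (rule LeastI_ex) (force)

lemma reduced_in_weyl: "reduced X p w \<Longrightarrow> w \<in> weyl X"
  by (auto simp: reduced_def)

text \<open>Every reflection is \<open>y \<circ> gperm g \<circ> inv y\<close> with \<open>\<not> desc y g\<close>, so this is the strong exchange
  condition.\<close>

lemma strong_exchange:
  assumes "set p \<subseteq> gens X" "g \<in> gens X" "y \<in> weyl X" "\<not> desc y g" "desc (wprod p \<circ> y) g"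
  shows "\<exists>p1 r p2. p = p1 @ r # p2 \<and> wprod p \<circ> y \<circ> gperm g \<circ> inv y = wprod (p1 @ p2)"
  using assms
proof (induction p)
  case Nil
  then show ?case by simp
next
  case (Cons r p)
  let ?w = "wprod p \<circ> y"
  show ?case
  \<comment> \<open>The letters of a word act from the right. If the descent is there before r acts,
    the letter to delete lies in p; otherwise r creates it, and \<open>desc_fold\<close> makes r
    itself the letter to delete.\<close>
  proof (cases "desc ?w g")
    case True
    then obtain p1 r' p2 where "p = p1 @ r' # p2"
        "wprod p \<circ> y \<circ> gperm g \<circ> inv y = wprod (p1 @ p2)"
      using Cons by (auto simp: comp_def)
    then have "r # p = (r # p1) @ r' # p2 \<and>
        wprod (r # p) \<circ> y \<circ> gperm g \<circ> inv y = wprod ((r # p1) @ p2)"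
      by (simp add: comp_assoc)
    then show ?thesis by blast
  next
    case False
    have "?w \<circ> gperm g = gperm r \<circ> ?w"
      using Cons.prems False signed_comp[of "wprod p" y]
      by (intro desc_fold[of _ _ X]) (auto simp: weyl_signed comp_def)
    then have "gperm r \<circ> ?w \<circ> gperm g \<circ> inv y = gperm r \<circ> gperm r \<circ> ?w \<circ> inv y"
      by (metis comp_assoc)
    then have "wprod (r # p) \<circ> y \<circ> gperm g \<circ> inv y = wprod p"
      using Cons.prems by (simp add: comp_assoc)
    then have "r # p = [] @ r # p \<and> wprod (r # p) \<circ> y \<circ> gperm g \<circ> inv y = wprod ([] @ p)"
      by simp
    then show ?thesis by blast
  qed
qed

lemma wlen_reflection:
  assumes "w \<in> weyl X" "g \<in> gens X" "y \<in> weyl X" "\<not> desc y g" "desc (w \<circ> y) g"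
  shows "wlen X (w \<circ> y \<circ> gperm g \<circ> inv y) < wlen X w"
proof -
  obtain p where p: "reduced X p w" using assms(1) reduced_exists by blast
  then obtain p1 r p2 where "p = p1 @ r # p2" "w \<circ> y \<circ> gperm g \<circ> inv y = wprod (p1 @ p2)"
    using strong_exchange[of p X g y] assms by (auto simp: reduced_def)
  then show ?thesis
    using p wlen_le[of "p1 @ p2" X] by (auto simp: reduced_def)
qed

lemma wlen_comp_gperm_le:
  assumes "w \<in> weyl X" "g \<in> gens X"
  shows "wlen X (w \<circ> gperm g) \<le> Suc (wlen X w)"
proof -
  obtain p where p: "reduced X p w" using assms(1) reduced_exists by blast
  then show ?thesis
    using wlen_le[of "p @ [g]" X] assms by (auto simp: reduced_def)
qed

lemma wlen_desc:
  assumes "w \<in> weyl X" "g \<in> gens X" "desc w g"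
  shows "wlen X w = Suc (wlen X (w \<circ> gperm g))"
  using wlen_reflection[of w X g id] wlen_comp_gperm_le[of "w \<circ> gperm g" X g] assms by auto

lemma wlen_not_desc:
  assumes "w \<in> weyl X" "g \<in> gens X" "\<not> desc w g"
  shows "wlen X (w \<circ> gperm g) = Suc (wlen X w)"
  using wlen_desc[of "w \<circ> gperm g" X g] assms by (simp add: weyl_signed)

lemma reduced_Nil [simp]: "reduced X [] id"
  using wlen_le[of "[]" X] by (simp add: reduced_def)

lemma wlen_id [simp]: "wlen X id = 0"
  using wlen_le[of "[]" X] by simp

lemma reduced_snoc:
  assumes "reduced X p w" "g \<in> gens X" "\<not> desc w g"
  shows "reduced X (p @ [g]) (w \<circ> gperm g)"
  using assms wlen_not_desc[of w X g] by (auto simp: reduced_def)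

lemma reduced_snocD:
  assumes "reduced X (p @ [g]) w"
  shows "g \<in> gens X" "reduced X p (w \<circ> gperm g)" "desc w g"
proof -
  have w: "set p \<subseteq> gens X" "g \<in> gens X" "w = wprod p \<circ> gperm g" "wlen X w = Suc (length p)"
    using assms by (auto simp: reduced_def)
  then show "g \<in> gens X" by simp
  have le: "wlen X (wprod p) \<le> length p"
    by (rule wlen_le) (use w in auto)
  show "desc w g"
  proof (rule ccontr)
    assume "\<not> desc w g"
    then have "wlen X (w \<circ> gperm g) = Suc (wlen X w)"
      using w wlen_not_desc[of w X g] by auto
    then show False using w le by simp
  qed
  then show "reduced X p (w \<circ> gperm g)"
    using wlen_desc[of w X g] w by (auto simp: reduced_def)
qed

text \<open>When an appended letter is a descent, exchange deletes a letter from the reduced word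
  found so far and introduces no new one. So elements of finite rank have reduced words of the same
  rank.\<close>

lemma reduced_in_parabolic:
  assumes "set p \<subseteq> J" "J \<subseteq> gens X"
  shows "\<exists>r. reduced X r (wprod p) \<and> set r \<subseteq> J"
  using assms(1)
proof (induction p rule: rev_induct)
  case Nil
  then show ?case by (intro exI[of _ "[]"]) (simp del: id_apply)
next
  case (snoc g p)
  then obtain r where r: "reduced X r (wprod p)" "set r \<subseteq> J" by auto
  have g: "g \<in> gens X" using snoc assms by auto
  show ?case
  proof (cases "desc (wprod p) g")
    case False
    then show ?thesis
      using reduced_snoc[OF r(1) g False] r(2) snoc.prems
      by (intro exI[of _ "r @ [g]"]) (auto simp del: o_apply)
  next
    case True
    then obtain p1 s p2 where ps: "r = p1 @ s # p2" "wprod p \<circ> gperm g = wprod (p1 @ p2)"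
      using strong_exchange[of r X g id] r g by (auto simp: reduced_def)
    have "wlen X (wprod p) = Suc (wlen X (wprod p \<circ> gperm g))"
      using reduced_in_weyl[OF r(1)] g True by (rule wlen_desc)
    then have "reduced X (p1 @ p2) (wprod (p @ [g]))"
      using r ps by (auto simp: reduced_def)
    then show ?thesis
      using ps r by (intro exI[of _ "p1 @ p2"]) (auto simp del: o_apply)
  qed
qed

section \<open>Braid relations\<close>

text \<open>The right action of the 0-Hecke monoid: up to a power of beta, u_w u_g is the basis
  element at \<open>dact w g\<close>.\<close>

definition dact :: "sperm \<Rightarrow> gen \<Rightarrow> sperm" where
  "dact w g = (if desc w g then w else w \<circ> gperm g)"

fun downs :: "sperm \<Rightarrow> gen list \<Rightarrow> bool" where
  "downs w [] = True"
| "downs w (g # p) = (desc w g \<and> downs (w \<circ> gperm g) p)"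

text \<open>Bundles all that later proofs use about a pair of generators. Agreement of the two
  \<open>dact\<close> actions makes the action respect the relations; the \<open>downs\<close> part
  lets a whole alternating word be stripped off w when i and j are both descents, as Matsumoto's
  induction requires.\<close>

definition braided :: "nat \<Rightarrow> gen \<Rightarrow> gen \<Rightarrow> bool" where
  "braided m i j \<longleftrightarrow> (2 \<le> m \<and> braid_order i j = m \<and> braid_order j i = m \<and>
     wprod (alternating i j m) = wprod (alternating j i m) \<and>
     (\<forall>w. signed w \<longrightarrow>
        foldl dact w (alternating i j m) = foldl dact w (alternating j i m) \<and>
        (desc w i \<and> desc w j \<longrightarrow> downs w (alternating i j m) \<and> downs w (alternating j i m))))"

lemma braided_commute: "braided m i j \<longleftrightarrow> braided m j i"
  unfolding braided_def by (auto simp del: o_apply)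

lemma braid_order_eqI:
  assumes "0 < m" "(gperm i \<circ> gperm j) ^^ m = id"
    and "\<And>k. 0 < k \<Longrightarrow> k < m \<Longrightarrow> ((gperm i \<circ> gperm j) ^^ k) x \<noteq> x"
  shows "braid_order i j = m"
  unfolding braid_order_def
proof (rule Least_equality)
  fix k assume k: "0 < k \<and> (gperm i \<circ> gperm j) ^^ k = id"
  show "m \<le> k"
  proof (rule ccontr)
    assume "\<not> m \<le> k"
    then have "((gperm i \<circ> gperm j) ^^ k) x \<noteq> x"
      using conjunct1[OF k] by (intro assms(3)) simp_all
    then show False using k by simp
  qed
qed (use assms in auto)

text \<open>Phrased through the permutations because commuting pairs are of two kinds: those with
  disjoint indices, and \<open>Hat1\<close> with s_1, which share both indices.\<close>

lemma braided_2:
  assumes comm: "\<And>k. gperm i (gperm j k) = gperm j (gperm i k)"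
    and ij: "gperm i \<noteq> gperm j"
    and desc: "\<And>w. signed w \<Longrightarrow> desc (w \<circ> gperm i) j = desc w j"
      "\<And>w. signed w \<Longrightarrow> desc (w \<circ> gperm j) i = desc w i"
  shows "braided 2 i j"
proof -
  have alt: "alternating i j 2 = [i, j]" "alternating j i 2 = [j, i]"
    by (simp_all add: numeral_2_eq_2)
  have cc: "w \<circ> gperm i \<circ> gperm j = w \<circ> gperm j \<circ> gperm i" for w :: sperm
    by (auto simp: comm)
  have id2: "(gperm i \<circ> gperm j) ^^ 2 = id" "(gperm j \<circ> gperm i) ^^ 2 = id"
    by (auto simp: numeral_2_eq_2 comm)
  obtain k where k: "gperm i k \<noteq> gperm j k"
    using ij by auto
  have ne: "gperm i (gperm j (gperm j k)) \<noteq> gperm j k" "gperm j (gperm i (gperm i k)) \<noteq> gperm i k"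
    using k by auto
  have "braid_order i j = 2"
    using id2 ne by (intro braid_order_eqI[of _ _ _ "gperm j k"]) (auto simp: less_Suc_eq numeral_2_eq_2)
  moreover have "braid_order j i = 2"
    using id2 ne by (intro braid_order_eqI[of _ _ _ "gperm i k"]) (auto simp: less_Suc_eq numeral_2_eq_2)
  moreover have "wprod [i, j] = wprod [j, i]"
    using comm by auto
  moreover have "foldl dact w [i, j] = foldl dact w [j, i]" if "signed w" for w
    using that desc cc[of w] by (simp add: dact_def)
  moreover have "downs w [i, j] \<and> downs w [j, i]" if "signed w" "desc w i" "desc w j" for w
    using that desc by simp
  ultimately show ?thesis
    unfolding braided_def by (simp add: alt)
qed

text \<open>The chain x, y, z is i, i+1, i+2 for s_i and s_(i+1), and -1, 2, 3 for
  \<open>Hat1\<close> and s_2. The actions are compared on the six relative orders of w x, w y, w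
  z.\<close>

lemma braided_3:
  assumes rt: "rt i = (x, y)" "rt j = (y, z)"
    and ne: "0 < \<bar>x\<bar>" "\<bar>x\<bar> < \<bar>y\<bar>" "\<bar>y\<bar> < \<bar>z\<bar>"
  shows "braided 3 i j"
proof -
  have pos [simp]: "x \<noteq> y" "x \<noteq> z" "y \<noteq> z" "x \<noteq> - y" "x \<noteq> - z" "y \<noteq> - z" "x \<noteq> 0" "y \<noteq> 0" "z \<noteq> 0"
     "y \<noteq> x" "z \<noteq> x" "z \<noteq> y" "-y \<noteq> x" "- z \<noteq> x" "- z \<noteq> y" "- x \<noteq> y" "- x \<noteq> z" "- y \<noteq> z" "y \<noteq> - x" "z \<noteq> - x" "z \<noteq> - y"
    using ne by auto
  have gi: "gperm i k = (if k = x then y else if k = y then x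
      else if k = - x then - y else if k = - y then - x else k)"
    and gj: "gperm j k = (if k = y then z else if k = z then y
      else if k = - y then - z else if k = - z then - y else k)" for k
    using rt by (simp_all add: gperm_apply)
  have [simp]: "gperm i x = y" "gperm i y = x" "gperm i z = z" "gperm j x = x" "gperm j y = z" "gperm j z = y"
    by (auto simp: gi gj)
  have alt: "alternating i j 3 = [i, j, i]" "alternating j i 3 = [j, i, j]"
    by (simp_all add: numeral_3_eq_3)
  have [simp]: "gperm i (- x) = - y" "gperm i (- y) = - x" "gperm i (- z) = - z"
    "gperm j (- x) = - x" "gperm j (- y) = - z" "gperm j (- z) = - y"
    by (simp_all add: gperm_uminus)
  have br: "gperm i (gperm j (gperm i k)) = gperm j (gperm i (gperm j k))" for k
  proof -
    consider "k = x" | "k = y" | "k = z" | "k = - x" | "k = - y" | "k = - z"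
      | "k \<noteq> x" "k \<noteq> y" "k \<noteq> z" "k \<noteq> - x" "k \<noteq> - y" "k \<noteq> - z" by blast
    then show ?thesis by cases (simp_all add: gi gj)
  qed
  have cc: "w \<circ> gperm i \<circ> gperm j \<circ> gperm i = w \<circ> gperm j \<circ> gperm i \<circ> gperm j" for w :: sperm
    by (auto simp: br)
  have id3: "(gperm i \<circ> gperm j) ^^ 3 = id" "(gperm j \<circ> gperm i) ^^ 3 = id"
    by (auto simp: numeral_3_eq_3 br)
  have "braid_order i j = 3"
    using id3 by (intro braid_order_eqI[of _ _ _ x]) (auto simp: less_Suc_eq numeral_3_eq_3)
  moreover have "braid_order j i = 3"
    using id3 by (intro braid_order_eqI[of _ _ _ x]) (auto simp: less_Suc_eq numeral_3_eq_3)
  moreover have "wprod [i, j, i] = wprod [j, i, j]"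
    using br by auto
  moreover have "foldl dact w [i, j, i] = foldl dact w [j, i, j]" if "signed w" for w
  proof -
    have "w x \<noteq> w y" "w x \<noteq> w z" "w y \<noteq> w z"
      using that by (simp_all add: signed_inj)
    then consider "w x < w y" "w y < w z" "w x < w z" | "w x < w z" "w z < w y" "w x < w y"
      | "w y < w x" "w x < w z" "w y < w z" | "w y < w z" "w z < w x" "w y < w x"
      | "w z < w x" "w x < w y" "w z < w y" | "w z < w y" "w y < w x" "w z < w x"
      by smt
    then show ?thesis
      by cases (simp_all add: dact_def desc_def rt cc)
  qed
  moreover have "downs w [i, j, i] \<and> downs w [j, i, j]" if "signed w" "desc w i" "desc w j" for w
    using that by (simp add: desc_def rt)
  ultimately show ?thesis
    unfolding braided_def by (simp add: alt)
qed

lemma braided_4: "braided 4 (Sgen 0) (Sgen 1)"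
proof -
  define i j where "i = Sgen 0" and "j = Sgen 1"
  have rt: "rt i = (-1, 1)" "rt j = (1, 2)"
    by (simp_all add: i_def j_def)
  have gi: "gperm i k = (if k = 1 then - 1 else if k = - 1 then 1 else k)"
    and gj: "gperm j k = (if k = 1 then 2 else if k = 2 then 1
      else if k = - 1 then - 2 else if k = - 2 then - 1 else k)" for k
    using rt by (simp_all add: gperm_apply)
  have [simp]: "gperm i 1 = -1" "gperm i (-1) = 1" "gperm i 2 = 2" "gperm i (-2) = -2"
    "gperm j 1 = 2" "gperm j 2 = 1" "gperm j (-1) = -2" "gperm j (-2) = -1"
    by (auto simp: gi gj)
  have alt: "alternating i j 4 = [i, j, i, j]" "alternating j i 4 = [j, i, j, i]"
    by (simp_all add: eval_nat_numeral)
  have br: "gperm i (gperm j (gperm i (gperm j k))) = gperm j (gperm i (gperm j (gperm i k)))" for k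
  proof -
    consider "k = 1" | "k = 2" | "k = - 1" | "k = - 2"
      | "k \<noteq> 1" "k \<noteq> 2" "k \<noteq> - 1" "k \<noteq> - 2" by blast
    then show ?thesis by cases (simp_all add: gi gj)
  qed
  have cc: "w \<circ> gperm i \<circ> gperm j \<circ> gperm i \<circ> gperm j
      = w \<circ> gperm j \<circ> gperm i \<circ> gperm j \<circ> gperm i" for w :: sperm
    by (auto simp: br)
  have id4: "(gperm i \<circ> gperm j) ^^ 4 = id" "(gperm j \<circ> gperm i) ^^ 4 = id"
    by (auto simp: eval_nat_numeral br)
  have "braid_order i j = 4"
    using id4 by (intro braid_order_eqI[of _ _ _ 1]) (auto simp: less_Suc_eq eval_nat_numeral)
  moreover have "braid_order j i = 4"
    using id4 by (intro braid_order_eqI[of _ _ _ 1]) (auto simp: less_Suc_eq eval_nat_numeral)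
  moreover have "wprod [i, j, i, j] = wprod [j, i, j, i]"
    using br by auto
  moreover have "foldl dact w [i, j, i, j] = foldl dact w [j, i, j, i]" if "signed w" for w
  proof -
    have [simp]: "w (-1) = - w 1" "w (-2) = - w 2"
      using that by (simp_all add: signed_uminus)
    have "w 1 \<noteq> w 2" "w 1 \<noteq> - w 2" "w 1 \<noteq> 0" "w 2 \<noteq> 0"
      using that by (simp_all add: signed_inj signed_inj_uminus signed_eq_0)
    \<comment> \<open>The eight chambers of the dihedral group of order 8: the signs of w 1 and w 2
      and the order of their absolute values.\<close>
    then consider "0 < w 1" "w 1 < w 2" | "0 < w 2" "w 2 < w 1" | "0 < - w 1" "- w 1 < w 2"
      | "0 < - w 2" "- w 2 < w 1" | "0 < w 1" "w 1 < - w 2" | "0 < w 2" "w 2 < - w 1"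
      | "0 < - w 1" "- w 1 < - w 2" | "0 < - w 2" "- w 2 < - w 1"
      by smt
    then show ?thesis
      by cases (simp_all add: dact_def desc_def rt cc)
  qed
  moreover have "downs w [i, j, i, j] \<and> downs w [j, i, j, i]" if "signed w" "desc w i" "desc w j" for w
    using that signed_uminus[OF that(1), of 1] signed_uminus[OF that(1), of 2]
    by (simp add: desc_def rt)
  ultimately have "braided 4 i j"
    unfolding braided_def by (simp add: alt)
  then show ?thesis by (simp add: i_def j_def)
qed

lemma braided_disjoint:
  assumes "{\<bar>lo i\<bar>, \<bar>hi i\<bar>} \<inter> {\<bar>lo j\<bar>, \<bar>hi j\<bar>} = {}"
  shows "braided 2 i j"
proof -
  have ne: "lo i \<noteq> lo j" "lo i \<noteq> - lo j" "lo i \<noteq> hi j" "lo i \<noteq> - hi j"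
     "hi i \<noteq> lo j" "hi i \<noteq> - lo j" "hi i \<noteq> hi j" "hi i \<noteq> - hi j"
    "lo j \<noteq> - lo i" "hi j \<noteq> - lo i" "lo j \<noteq> - hi i" "hi j \<noteq> - hi i"
    using assms by (simp_all add: abs_eq_iff)
  show ?thesis
  proof (rule braided_2)
    show "gperm i (gperm j k) = gperm j (gperm i k)" for k
      using ne by (auto simp: gperm_apply)
    have "gperm i (lo j) = lo j" "gperm j (lo j) \<noteq> lo j"
      using ne rt_props[of j] by (auto simp: gperm_apply[of i])
    then show "gperm i \<noteq> gperm j" by metis
    have "gperm i (lo j) = lo j" "gperm i (hi j) = hi j" "gperm j (lo i) = lo i" "gperm j (hi i) = hi i"
      using ne by (auto simp: gperm_apply)
    then show "desc (w \<circ> gperm i) j = desc w j" "desc (w \<circ> gperm j) i = desc w i" for w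
      by (auto simp: desc_def)
  qed
qed

text \<open>Both reflections move 1 and 2. Oddness of w is what carries a descent at one of them
  across the other: the values at -2 and -1 compare like those at 1 and 2.\<close>

lemma braided_Hat1_1: "braided 2 Hat1 (Sgen 1)"
proof (rule braided_2)
  show "gperm Hat1 (gperm (Sgen 1) k) = gperm (Sgen 1) (gperm Hat1 k)" for k
    by (auto simp: gperm_apply)
  have "gperm Hat1 1 \<noteq> gperm (Sgen 1) 1"
    by (simp add: gperm_apply)
  then show "gperm Hat1 \<noteq> gperm (Sgen 1)" by metis
  show "desc (w \<circ> gperm Hat1) (Sgen 1) = desc w (Sgen 1)"
    "desc (w \<circ> gperm (Sgen 1)) Hat1 = desc w Hat1" if "signed w" for w
    using signed_uminus[OF that, of 1] signed_uminus[OF that, of 2]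
    by (auto simp: desc_def gperm_apply)
qed

lemma braided_Sgen:
  assumes "m < n"
  shows "braided (if n = Suc m then if m = 0 then 4 else 3 else 2) (Sgen m) (Sgen n)"
proof (cases "n = Suc m")
  case True
  show ?thesis
  proof (cases "m = 0")
    case False
    then show ?thesis
      using True by (auto intro!: braided_3)
  qed (use True braided_4 in auto)
qed (use assms in \<open>auto intro!: braided_disjoint split: if_splits\<close>)

lemma braided_Hat1:
  assumes "1 \<le> n"
  shows "braided (if n = 2 then 3 else 2) Hat1 (Sgen n)"
proof -
  consider "n = 1" | "n = 2" | "n > 2" using assms by linarith
  then show ?thesis
  proof cases
    case 1
    then show ?thesis using braided_Hat1_1 by simp
  next
    case 2
    then show ?thesis by (auto intro!: braided_3)
  next
    case 3
    then show ?thesis by (auto intro!: braided_disjoint)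
  qed
qed

lemma braided_gens:
  assumes "i \<in> gens X" "j \<in> gens X" "i \<noteq> j"
  shows "\<exists>m. braided m i j"
proof (cases i; cases j)
  fix m n assume ij: "i = Sgen m" "j = Sgen n"
  then have "m < n \<or> n < m" using assms by auto
  then show ?thesis using ij braided_Sgen braided_commute by blast
next
  fix m assume ij: "i = Sgen m" "j = Hat1"
  then have "1 \<le> m" using assms by (cases m) auto
  then show ?thesis using ij braided_Hat1 braided_commute by blast
next
  fix m assume ij: "i = Hat1" "j = Sgen m"
  then have "1 \<le> m" using assms by (cases m) auto
  then show ?thesis using ij braided_Hat1 by blast
qed (use assms in auto)

section \<open>Reduced words and the Demazure product\<close>

lemma signed_dact [simp]: "signed w \<Longrightarrow> signed (dact w g)"
  by (simp add: dact_def)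

lemma signed_foldl_dact [simp]: "signed w \<Longrightarrow> signed (foldl dact w p)"
  by (induction p arbitrary: w) auto

lemma weyl_dact [simp]: "w \<in> weyl X \<Longrightarrow> g \<in> gens X \<Longrightarrow> dact w g \<in> weyl X"
  by (simp add: dact_def)

lemma weyl_foldl_dact [simp]: "w \<in> weyl X \<Longrightarrow> set p \<subseteq> gens X \<Longrightarrow> foldl dact w p \<in> weyl X"
  by (induction p arbitrary: w) auto

lemma dact_dact [simp]: "signed w \<Longrightarrow> dact (dact w g) g = dact w g"
  by (simp add: dact_def)

section \<open>Invariants of the defining relations\<close>

lemma id_eq_invariant:
  assumes "\<And>x y. id_step X x y \<Longrightarrow> f x = f y" "id_eq X x y"
  shows "f x = f y"
  using assms(2) unfolding id_eq_def
  by (induction rule: equivclp_induct) (auto dest: assms(1))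

lemma set_alternating: "2 \<le> m \<Longrightarrow> set (alternating i j m) = {i, j}"
proof -
  have sub: "set (alternating i j m) \<subseteq> {i, j}" for m
    by (induction m arbitrary: i j) auto
  assume "2 \<le> m"
  then obtain m' where "m = Suc (Suc m')" by (metis Suc_le_D numeral_2_eq_2 Suc_le_mono)
  then show ?thesis using sub[of m'] by auto
qed

lemma braid_order_ge_2: "i \<in> gens X \<Longrightarrow> j \<in> gens X \<Longrightarrow> i \<noteq> j \<Longrightarrow> 2 \<le> braid_order i j"
  using braided_gens[of i X j] by (auto simp: braided_def)

lemma length_alternating [simp]: "length (alternating i j m) = m"
  by (induction m arbitrary: i j) auto

text \<open>The relations are homogeneous when beta has degree 1; this will determine the exponent
  of beta.\<close>

lemma id_eq_length: "id_eq X (p, k) (q, l) \<Longrightarrow> length p + k = length q + l"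
  by (drule id_eq_invariant[where f = "\<lambda>(p, k). length p + k", rotated]) (auto elim!: id_step.cases)

text \<open>Braid words have length at least 2, so both sides of a braid relation use both letters.
  All statements about finite rank go back to this invariant.\<close>

lemma id_eq_set: "id_eq X (p, k) (q, l) \<Longrightarrow> set p = set q"
  by (drule id_eq_invariant[where f = "\<lambda>(p, k). set p", rotated])
     (auto elim!: id_step.cases simp: set_alternating braid_order_ge_2)

lemma foldl_dact_braid:
  assumes "i \<in> gens X" "j \<in> gens X" "i \<noteq> j" "signed w"
  shows "foldl dact w (alternating i j (braid_order i j)) =
    foldl dact w (alternating j i (braid_order i j))"
  using braided_gens[OF assms(1-3)] assms(4) unfolding braided_def by metis

text \<open>The action of a word factors through the relations, so it recovers a group element from
  a class of words; this keeps different basis elements apart.\<close>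

lemma id_eq_foldl_dact:
  assumes "id_eq X (p, k) (q, l)" "signed w"
  shows "foldl dact w p = foldl dact w q"
proof -
  have "foldl dact w (fst x) = foldl dact w (fst y)" if "id_step X x y" for x y
    using that
  proof (cases rule: id_step.cases)
    case (square i p q k)
    then show ?thesis using assms(2) by simp
  next
    case (braid i j m p q k)
    then show ?thesis
      using foldl_dact_braid[of i X j "foldl dact w p"] assms(2) by simp
  qed
  from id_eq_invariant[where f = "\<lambda>x. foldl dact w (fst x)", OF this assms(1)]
  show ?thesis by simp
qed

lemma id_eq_refl [simp]: "id_eq X x x"
  by (simp add: id_eq_def)

lemma id_eq_sym: "id_eq X x y \<Longrightarrow> id_eq X y x"
  by (simp add: id_eq_def equivclp_sym)

lemma id_eq_trans [trans]: "id_eq X x y \<Longrightarrow> id_eq X y z \<Longrightarrow> id_eq X x z"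
  unfolding id_eq_def by (rule equivclp_trans)

lemma id_step_id_eq: "id_step X x y \<Longrightarrow> id_eq X x y"
  by (simp add: id_eq_def r_into_equivclp)

lemma id_step_context:
  "id_step X (p, k) (q, l) \<Longrightarrow> id_step X (a @ p @ b, k + c) (a @ q @ b, l + c)"
proof (erule id_step.cases, goal_cases)
  case (1 i p' q' k')
  then show ?case using id_step.square[of i X "a @ p'" "q' @ b" "k + c"] by simp
next
  case (2 i j m p' q' k')
  then show ?case using id_step.braid[of i X j m "a @ p'" "q' @ b" "k + c"] by simp
qed

lemma id_eq_context:
  assumes "id_eq X (p, k) (q, l)"
  shows "id_eq X (a @ p @ b, k + c) (a @ q @ b, l + c)"
proof -
  have "id_eq X (a @ fst x @ b, snd x + c) (a @ fst y @ b, snd y + c)" if "id_eq X x y" for x y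
    using that[unfolded id_eq_def]
  proof (induction rule: equivclp_induct)
    case (step y z)
    have *: "id_eq X (a @ fst y @ b, snd y + c) (a @ fst z @ b, snd z + c)" if "id_step X y z" for y z
      using that id_step_context[of X "fst y" "snd y" "fst z" "snd z"]
      by (intro id_step_id_eq) simp
    have "id_eq X (a @ fst y @ b, snd y + c) (a @ fst z @ b, snd z + c)"
      using step.hyps(2) * id_eq_sym by blast
    then show ?case by (rule id_eq_trans[OF step.IH])
  qed simp
  from this[OF assms] show ?thesis by simp
qed

section \<open>Matsumoto's theorem and normal forms\<close>

lemma alternating_snoc: "alternating i j (Suc m) = alternating i j m @ [if even m then i else j]"
  by (induction m arbitrary: i j) auto

lemma rev_alternating:
  "rev (alternating i j m) = (if even m then alternating j i m else alternating i j m)"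
proof (induction m)
  case (Suc m)
  have "rev (alternating i j (Suc m)) = (if even m then i else j) # rev (alternating i j m)"
    by (subst alternating_snoc) simp
  then show ?case using Suc by simp
qed simp

text \<open>Every letter stripped off shortens w by one, so putting the letters back behind a
  reduced word of what remains wastes none.\<close>

lemma downs_reduced:
  "downs w a \<Longrightarrow> set a \<subseteq> gens X \<Longrightarrow> w \<in> weyl X \<Longrightarrow> reduced X r (w \<circ> wprod a) \<Longrightarrow>
    reduced X (r @ rev a) w"
proof (induction a arbitrary: w)
  case (Cons g a)
  have "reduced X (r @ rev a) (w \<circ> gperm g)"
    using Cons.prems weyl_comp[of w X "gperm g"] by (intro Cons.IH) (auto simp: comp_def)
  then have "reduced X ((r @ rev a) @ [g]) (w \<circ> gperm g \<circ> gperm g)"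
    by (rule reduced_snoc) (use Cons.prems in \<open>auto simp: weyl_signed\<close>)
  then show ?case by simp
qed simp

lemma reduced_length: "reduced X p w \<Longrightarrow> length p = wlen X w"
  by (simp add: reduced_def)

text \<open>If the last letters i and j differ, both are descents of w, so w has reduced words
  ending in either alternating word of length m. The induction hypothesis links each given word to
  one of these, and a braid relation links these two.\<close>

lemma matsumoto: "reduced X p w \<Longrightarrow> reduced X q w \<Longrightarrow> id_eq X (p, 0) (q, 0)"
proof (induction "length p" arbitrary: p q w)
  case 0
  then show ?case using reduced_length[of X p w] reduced_length[of X q w] by simp
next
  case (Suc n)
  have "length q = Suc n"
    using Suc reduced_length[of X p w] reduced_length[of X q w] by simp
  then obtain p' i q' j where pq: "p = p' @ [i]" "q = q' @ [j]"
    using Suc.hyps(2) by (metis length_Suc_conv_rev)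
  have w: "w \<in> weyl X" using Suc.prems reduced_in_weyl by blast
  note i = reduced_snocD[OF Suc.prems(1)[unfolded pq]]
  note j = reduced_snocD[OF Suc.prems(2)[unfolded pq]]
  have n: "n = length p'" "n = length q'"
    using Suc.hyps(2) \<open>length q = Suc n\<close> pq by auto
  show ?case
  proof (cases "i = j")
    case True
    then have "id_eq X (p', 0) (q', 0)"
      using Suc.hyps(1)[OF n(1) i(2)] j(2) by simp
    from id_eq_context[OF this, of "[]" "[i]" 0] show ?thesis
      using pq True by simp
  next
    case False
    obtain m where m: "m \<ge> 2" "braid_order i j = m" "braid_order j i = m"
      and alt: "wprod (alternating i j m) = wprod (alternating j i m)"
      and down: "downs w (alternating i j m)" "downs w (alternating j i m)"
      using braided_gens[OF i(1) j(1) False] i(3) j(3) weyl_signed[OF w] unfolding braided_def by blast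
    then obtain m' where m': "m = Suc m'" by (cases m) auto
    have set: "set (alternating i j m) \<subseteq> gens X" "set (alternating j i m) \<subseteq> gens X"
      using m(1) i(1) j(1) by (auto simp: set_alternating)
    then obtain r where r: "reduced X r (w \<circ> wprod (alternating i j m))"
      using reduced_exists w by (metis weyl_comp wprod_in_weyl)
    let ?a = "r @ rev (alternating j i m')" and ?b = "r @ rev (alternating i j m')"
    have ri: "reduced X (r @ rev (alternating i j m)) w"
      using downs_reduced[OF down(1) set(1) w r] .
    have rj: "reduced X (r @ rev (alternating j i m)) w"
      using downs_reduced[OF down(2) set(2) w] r alt by simp
    have "reduced X ?a (w \<circ> gperm i)"
      using ri reduced_snocD(2)[of X ?a i w] m' by simp
    then have "id_eq X (p', 0) (?a, 0)"
      using Suc.hyps(1)[OF n(1) i(2)] by simp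
    from id_eq_context[OF this, of "[]" "[i]" 0]
    have "id_eq X (p, 0) (r @ rev (alternating i j m), 0)"
      using pq m' by simp
    \<comment> \<open>Reversal keeps or exchanges the two alternating words according to the parity
      of m, so the braid relation is supplied in both directions.\<close>
    also have "id_eq X \<dots> (r @ rev (alternating j i m), 0)"
      using id_step.braid[OF i(1) j(1) False m(2)[symmetric], of r "[]" 0]
        id_step.braid[OF j(1) i(1) False[symmetric] m(3)[symmetric], of r "[]" 0]
      by (auto simp: rev_alternating intro: id_step_id_eq)
    also have "reduced X ?b (w \<circ> gperm j)"
      using rj reduced_snocD(2)[of X ?b j w] m' by simp
    then have "id_eq X (q', 0) (?b, 0)"
      using Suc.hyps(1)[OF n(2) j(2)] by simp
    from id_eq_context[OF this, of "[]" "[j]" 0]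
    have "id_eq X (r @ rev (alternating j i m), 0) (q, 0)"
      using pq m' by (simp add: id_eq_sym)
    finally show ?thesis .
  qed
qed

lemma foldl_dact_reduced: "reduced X p w \<Longrightarrow> foldl dact id p = w"
proof (induction p arbitrary: w rule: rev_induct)
  case Nil
  then show ?case by (simp add: reduced_def del: id_apply)
next
  case (snoc g p)
  note g = reduced_snocD[OF snoc.prems]
  have "w \<in> weyl X" using snoc.prems by (rule reduced_in_weyl)
  then have "dact (w \<circ> gperm g) g = w"
    using g(3) by (simp add: dact_def weyl_signed)
  moreover have "foldl dact id p = w \<circ> gperm g"
    using g(2) by (rule snoc.IH)
  ultimately show ?case by (simp del: id_apply o_apply)
qed

text \<open>A letter g that is a descent gets absorbed: by Matsumoto the reduced word can be made to
  end in g, and the square relation trades the second g for a factor beta.\<close>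

lemma id_eq_reduced:
  assumes "set p \<subseteq> gens X"
  shows "\<exists>r k. id_eq X (p, 0) (r, k) \<and> reduced X r (foldl dact id p)"
  using assms
proof (induction p rule: rev_induct)
  case Nil
  have "id_eq X ([], 0) ([], 0) \<and> reduced X [] (foldl dact id [])"
    by simp
  then show ?case by blast
next
  case (snoc g p)
  then obtain r k where r: "id_eq X (p, 0) (r, k)" "reduced X r (foldl dact id p)"
    by (auto simp del: id_apply)
  let ?w = "foldl dact id p"
  have g: "g \<in> gens X" using snoc.prems by simp
  have w: "?w \<in> weyl X" using r(2) by (rule reduced_in_weyl)
  have eq: "id_eq X (p @ [g], 0) (r @ [g], k)"
    using id_eq_context[OF r(1), of "[]" "[g]" 0] by simp
  show ?case
  proof (cases "desc ?w g")
    case False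
    then have "reduced X (r @ [g]) (foldl dact id (p @ [g]))"
      using reduced_snoc[OF r(2) g False] by (simp add: dact_def)
    then show ?thesis using eq by blast
  next
    case True
    obtain r' where r': "reduced X r' (?w \<circ> gperm g)"
      using reduced_exists w g by (metis weyl_comp gperm_in_weyl)
    then have r'': "reduced X (r' @ [g]) ?w"
      using reduced_snoc[OF r' g] True w by (simp add: weyl_signed)
    have "id_eq X (r @ [g], k) (r' @ [g, g], k)"
      using id_eq_context[OF matsumoto[OF r(2) r''], of "[]" "[g]" k] by simp
    also have "id_eq X \<dots> (r' @ [g], Suc k)"
      using id_step.square[OF g, of r' "[]" k] by (simp add: id_step_id_eq)
    finally have "id_eq X (p @ [g], 0) (r' @ [g], Suc k)"
      using eq id_eq_trans by blast
    moreover have "reduced X (r' @ [g]) (foldl dact id (p @ [g]))"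
      using r'' True by (simp add: dact_def)
    ultimately show ?thesis by blast
  qed
qed

section \<open>The Demazure product\<close>

definition dem :: "ctype \<Rightarrow> sperm \<Rightarrow> sperm \<Rightarrow> sperm" where
  "dem X u v = foldl dact u (SOME p. reduced X p v)"

lemma dem_eq:
  assumes "signed u" "reduced X p v"
  shows "dem X u v = foldl dact u p"
proof -
  have "reduced X (SOME p. reduced X p v) v"
    using assms(2) by (rule someI)
  then show ?thesis
    unfolding dem_def using assms matsumoto id_eq_foldl_dact by blast
qed

lemma dem_weyl [simp]: "u \<in> weyl X \<Longrightarrow> v \<in> weyl X \<Longrightarrow> dem X u v \<in> weyl X"
  using reduced_exists[of v X] dem_eq[of u X _ v] by (auto simp: weyl_signed reduced_def)

text \<open>The action on \<open>id\<close> forces w and the grading by length plus exponent forces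
  k; conversely, the normal form of the concatenated word provides a derivation.\<close>

lemma id_times_iff:
  "id_times X u v k w \<longleftrightarrow> u \<in> weyl X \<and> v \<in> weyl X \<and> w = dem X u v \<and> wlen X u + wlen X v = wlen X w + k"
proof
  assume "id_times X u v k w"
  then obtain p q r where r: "reduced X p u" "reduced X q v" "reduced X r w" "id_eq X (p @ q, 0) (r, k)"
    by (auto simp: id_times_def)
  then have uv: "u \<in> weyl X" "v \<in> weyl X" by (auto intro: reduced_in_weyl)
  have "w = foldl dact id (p @ q)"
    using foldl_dact_reduced[OF r(3)] id_eq_foldl_dact[OF r(4), of id] by simp
  then have "w = dem X u v"
    using dem_eq[OF _ r(2), of u] foldl_dact_reduced[OF r(1)] uv by (simp add: weyl_signed)
  then show "u \<in> weyl X \<and> v \<in> weyl X \<and> w = dem X u v \<and> wlen X u + wlen X v = wlen X w + k"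
    using uv r id_eq_length[OF r(4)] by (simp add: reduced_length)
next
  assume R: "u \<in> weyl X \<and> v \<in> weyl X \<and> w = dem X u v \<and> wlen X u + wlen X v = wlen X w + k"
  then obtain p q where pq: "reduced X p u" "reduced X q v" using reduced_exists by blast
  then have "set (p @ q) \<subseteq> gens X" by (auto simp: reduced_def)
  then obtain r l where r: "id_eq X (p @ q, 0) (r, l)" "reduced X r (foldl dact id (p @ q))"
    using id_eq_reduced by blast
  have "foldl dact id (p @ q) = w"
    using R dem_eq[OF _ pq(2), of u] foldl_dact_reduced[OF pq(1)] by (auto simp: weyl_signed)
  moreover from this have "l = k"
    using id_eq_length[OF r(1)] R pq r by (simp add: reduced_length)
  ultimately show "id_times X u v k w"
    using r pq unfolding id_times_def by blast
qed

lemma wlen_dem_le: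
  assumes "u \<in> weyl X" "v \<in> weyl X"
  shows "wlen X (dem X u v) \<le> wlen X u + wlen X v"
proof -
  obtain p q where pq: "reduced X p u" "reduced X q v" using reduced_exists assms by blast
  then have "set (p @ q) \<subseteq> gens X" by (auto simp: reduced_def)
  then obtain r l where r: "id_eq X (p @ q, 0) (r, l)" "reduced X r (foldl dact id (p @ q))"
    using id_eq_reduced by blast
  have "foldl dact id (p @ q) = dem X u v"
    using assms dem_eq[OF _ pq(2), of u] foldl_dact_reduced[OF pq(1)] by (simp add: weyl_signed)
  then show ?thesis
    using id_eq_length[OF r(1)] pq r by (simp add: reduced_length)
qed

lemma dem_id [simp]: "u \<in> weyl X \<Longrightarrow> dem X u id = u" "u \<in> weyl X \<Longrightarrow> dem X id u = u"
proof -
  assume u: "u \<in> weyl X"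
  show "dem X u id = u"
    using dem_eq[of u X "[]" id] u by (simp add: weyl_signed)
  obtain p where "reduced X p u" using u reduced_exists by blast
  then show "dem X id u = u"
    using dem_eq[of id X p u] foldl_dact_reduced by simp
qed

text \<open>Both sides result from acting on u: by q and then r, or by a reduced word for the
  product of v and w, which is equivalent to q @ r.\<close>

lemma dem_assoc:
  assumes "u \<in> weyl X" "v \<in> weyl X" "w \<in> weyl X"
  shows "dem X (dem X u v) w = dem X u (dem X v w)"
proof -
  obtain p q r where r: "reduced X p u" "reduced X q v" "reduced X r w"
    using reduced_exists assms by metis
  then have "set (q @ r) \<subseteq> gens X" by (auto simp: reduced_def)
  then obtain s l where s: "id_eq X (q @ r, 0) (s, l)" "reduced X s (foldl dact id (q @ r))"
    using id_eq_reduced by blast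
  have "foldl dact id (q @ r) = dem X v w"
    using assms dem_eq[OF _ r(3), of v] foldl_dact_reduced[OF r(2)] by (simp add: weyl_signed)
  then have "dem X u (dem X v w) = foldl dact u s"
    using dem_eq[OF _ s(2), of u] assms by (simp add: weyl_signed)
  also have "\<dots> = foldl dact u (q @ r)"
    using id_eq_foldl_dact[OF s(1)] assms by (simp add: weyl_signed)
  also have "\<dots> = dem X (dem X u v) w"
    using assms dem_eq[OF _ r(2), of u] dem_eq[OF _ r(3), of "dem X u v"] by (simp add: weyl_signed)
  finally show ?thesis by simp
qed

section \<open>Subgroups of finite rank\<close>

lemma weyl_upto_subset: "weyl_upto X n \<subseteq> weyl X"
  by (auto simp: weyl_def)

lemma weyl_upto_mono: "m \<le> n \<Longrightarrow> weyl_upto X m \<subseteq> weyl_upto X n"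
  using gens_upto_mono[of m n X] by (fastforce simp: weyl_upto_def)

lemma id_in_weyl_upto [simp]: "id \<in> weyl_upto X n"
  unfolding weyl_upto_def by (rule CollectI, rule exI[of _ "[]"]) (simp del: id_apply)

lemma reduced_weyl_upto:
  assumes "w \<in> weyl_upto X n" "reduced X p w"
  shows "set p \<subseteq> gens_upto X n"
proof -
  obtain q where "set q \<subseteq> gens_upto X n" "w = wprod q"
    using assms(1) by (auto simp: weyl_upto_def)
  then obtain r where "reduced X r w" "set r \<subseteq> gens_upto X n"
    using reduced_in_parabolic[OF _ gens_upto_subset] by blast
  then show ?thesis using id_eq_set[OF matsumoto[OF assms(2)]] by blast
qed

lemma reduced_weyl_upto_iff:
  "reduced X p w \<Longrightarrow> w \<in> weyl_upto X n \<longleftrightarrow> set p \<subseteq> gens_upto X n"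
  using reduced_weyl_upto by (auto simp: weyl_upto_def reduced_def)

text \<open>The letters of a product are exactly those of its two factors together. Because this is
  an equivalence, truncation is multiplicative and each element has only finitely many
  factorizations.\<close>

lemma dem_weyl_upto:
  assumes "u \<in> weyl X" "v \<in> weyl X"
  shows "dem X u v \<in> weyl_upto X n \<longleftrightarrow> u \<in> weyl_upto X n \<and> v \<in> weyl_upto X n"
proof -
  obtain p q where pq: "reduced X p u" "reduced X q v" using reduced_exists assms by metis
  then have "set (p @ q) \<subseteq> gens X" by (auto simp: reduced_def)
  then obtain r l where r: "id_eq X (p @ q, 0) (r, l)" "reduced X r (foldl dact id (p @ q))"
    using id_eq_reduced by blast
  have "foldl dact id (p @ q) = dem X u v"
    using assms dem_eq[OF _ pq(2), of u] foldl_dact_reduced[OF pq(1)] by (simp add: weyl_signed)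
  then show ?thesis
    using pq r id_eq_set[OF r(1)] by (auto simp: reduced_weyl_upto_iff)
qed

lemma gens_upto_rt: "g \<in> gens_upto X n \<Longrightarrow> hi g \<le> int n"
  by (cases X) (auto split: if_splits)

lemma finite_weyl_upto [simp]: "finite (weyl_upto X n)"
proof -
  let ?S = "{- int n..int n}"
  have "gperm g permutes ?S" if "g \<in> gens_upto X n" for g
  proof -
    have "gperm g k = k" if "k \<notin> ?S" for k
      using that gens_upto_rt[OF \<open>g \<in> gens_upto X n\<close>] rt_props[of g]
      by (auto simp: gperm_apply)
    then show ?thesis
      unfolding permutes_def using bij_gperm[of g] by (simp add: bij_iff)
  qed
  then have "wprod p permutes ?S" if "set p \<subseteq> gens_upto X n" for p
    using that by (induction p) (auto intro!: permutes_compose simp: permutes_id simp del: o_apply id_apply)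
  then have "weyl_upto X n \<subseteq> {p. p permutes ?S}"
    by (auto simp: weyl_upto_def)
  then show ?thesis
    using finite_permutations[of ?S] finite_subset by blast
qed

section \<open>The Bruhat order\<close>

text \<open>Exchange only deletes letters, so going down in the Bruhat order does not raise the
  rank.\<close>

lemma bruhat_step_weyl_upto:
  assumes "b \<in> weyl_upto X n" "t \<in> reflections X" "b = a \<circ> t" "wlen X a < wlen X b"
  shows "a \<in> weyl_upto X n"
proof -
  obtain g i where t: "t = g \<circ> gperm i \<circ> inv g" "g \<in> weyl X" "i \<in> gens X"
    using assms(2) by (auto simp: reflections_def)
  have b: "b \<in> weyl X" using assms(1) weyl_upto_subset by blast
  \<comment> \<open>g and \<open>g \<circ> gperm i\<close> give the same reflection, and one of them
    has no descent at i, as strong exchange requires.\<close>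
  obtain y where y: "t = y \<circ> gperm i \<circ> inv y" "y \<in> weyl X" "\<not> desc y i"
  proof (cases "desc g i")
    case True
    have "inv (g \<circ> gperm i) = inv (gperm i) \<circ> inv g"
      using weyl_bij[OF t(2)] bij_gperm by (rule o_inv_distrib)
    also have "inv (gperm i) = gperm i"
      by (rule inv_unique_comp) auto
    finally have "t = (g \<circ> gperm i) \<circ> gperm i \<circ> inv (g \<circ> gperm i)"
      using t by (simp add: comp_assoc del: o_apply)
    then show ?thesis
      using that[of "g \<circ> gperm i"] True t by (simp add: weyl_signed)
  qed (use t that in blast)
  have "t \<circ> t = y \<circ> gperm i \<circ> (inv y \<circ> y) \<circ> gperm i \<circ> inv y"
    using y by (simp add: comp_assoc)
  also have "\<dots> = id" using y(2) by simp
  finally have "a = b \<circ> t"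
    using assms(3) by (simp add: comp_assoc)
  then have a: "a = b \<circ> y \<circ> gperm i \<circ> inv y"
    using y by (simp add: comp_assoc)
  then have aw: "a \<in> weyl X" using b y t by simp
  obtain p where p: "reduced X p b" using b reduced_exists by blast
  show ?thesis
  proof (cases "desc (b \<circ> y) i")
    case True
    then obtain p1 r p2 where "p = p1 @ r # p2" "a = wprod (p1 @ p2)"
      using strong_exchange[of p X i y] p y t a by (auto simp: reduced_def)
    moreover have "set p \<subseteq> gens_upto X n"
      using assms(1) p by (rule reduced_weyl_upto)
    ultimately show ?thesis by (auto simp: weyl_upto_def intro!: exI[of _ "p1 @ p2"])
  next
    \<comment> \<open>Here a \<circ> y has the descent instead, and b, being the product of a with
      the same reflection, would be shorter than a.\<close>
    case False
    have ay: "a \<circ> y = b \<circ> y \<circ> gperm i" using a y by simp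
    then have "desc (a \<circ> y) i"
      using False b y by (simp add: weyl_signed)
    then have "wlen X (a \<circ> y \<circ> gperm i \<circ> inv y) < wlen X a"
      using aw y t by (intro wlen_reflection)
    moreover have "a \<circ> y \<circ> gperm i \<circ> inv y = b"
      unfolding ay using y by simp
    ultimately show ?thesis using assms(4) by simp
  qed
qed

lemma bruhat_weyl_upto: "bruhat X u w \<Longrightarrow> w \<in> weyl_upto X n \<Longrightarrow> u \<in> weyl_upto X n"
  unfolding bruhat_def
  by (induction rule: converse_rtranclp_induct) (auto dest: bruhat_step_weyl_upto)

lemma bruhat_trans: "bruhat X u v \<Longrightarrow> bruhat X v w \<Longrightarrow> bruhat X u w"
  unfolding bruhat_def by (rule rtranclp_trans)

lemma bruhat_refl [simp]: "bruhat X u u"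
  by (simp add: bruhat_def)

lemma bruhat_step:
  "t \<in> reflections X \<Longrightarrow> w = u \<circ> t \<Longrightarrow> wlen X u < wlen X w \<Longrightarrow> bruhat X u w"
  unfolding bruhat_def by (rule r_into_rtranclp) blast

text \<open>Let y be v without its last letter g, and w the Demazure product of u and y. If g is a
  descent of w, the product stays w, while w v^-1 lies one reflection below w y^-1, because w has
  the descent at g and y has not. Otherwise the product grows to w g, and dividing it by v gives w
  y^-1 again.\<close>

lemma bruhat_dem_aux:
  "reduced X p v \<Longrightarrow> u \<in> weyl X \<Longrightarrow>
     bruhat X (foldl dact u p \<circ> inv v) u \<and> bruhat X u (foldl dact u p)"
proof (induction p arbitrary: v rule: rev_induct)
  case Nil
  then have "v = id" by (simp add: reduced_def del: id_apply)
  then show ?case by simp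
next
  case (snoc g p)
  note g = reduced_snocD[OF snoc.prems(1)]
  let ?y = "v \<circ> gperm g" and ?w = "foldl dact u p"
  have v: "v \<in> weyl X" using snoc.prems reduced_in_weyl by blast
  have p: "set p \<subseteq> gens X" using g(2) by (auto simp: reduced_def)
  have w: "?w \<in> weyl X" using p snoc.prems by simp
  have y: "?y \<in> weyl X" "\<not> desc ?y g" using v g by (auto simp: weyl_signed)
  have IH: "bruhat X (?w \<circ> inv ?y) u" "bruhat X u ?w"
    using snoc.IH[OF g(2) snoc.prems(2)] by (auto simp del: o_apply)
  have "inv ?y = inv (gperm g) \<circ> inv v"
    using weyl_bij[OF v] bij_gperm by (rule o_inv_distrib)
  also have "inv (gperm g) = gperm g"
    by (rule inv_unique_comp) auto
  finally have iy: "inv ?y = gperm g \<circ> inv v" .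
  show ?case
  proof (cases "desc ?w g")
    case True
    let ?x = "?w \<circ> inv ?y"
    have xy: "?x \<circ> ?y = ?w" using weyl_inv_comp(6)[OF y(1)] by simp
    have x': "?x \<circ> ?y \<circ> gperm g \<circ> inv ?y = ?w \<circ> inv v"
      unfolding xy by (simp add: iy comp_assoc)
    have "wlen X (?w \<circ> inv v) < wlen X ?x"
      using wlen_reflection[of ?x X g ?y] w y g(1) True xy x' by simp
    moreover have "?y \<circ> gperm g \<circ> inv ?y \<in> reflections X"
      unfolding reflections_def using y(1) g(1) by blast
    moreover have "?x = ?w \<circ> inv v \<circ> (?y \<circ> gperm g \<circ> inv ?y)"
    proof -
      have "?w \<circ> inv v \<circ> (?y \<circ> gperm g \<circ> inv ?y) = ?w \<circ> (inv v \<circ> (v \<circ> inv ?y))"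
        by (simp add: comp_assoc)
      then show ?thesis using v by simp
    qed
    ultimately have "bruhat X (?w \<circ> inv v) ?x"
      by (intro bruhat_step)
    then have "bruhat X (?w \<circ> inv v) u"
      using IH(1) by (rule bruhat_trans)
    moreover have "foldl dact u (p @ [g]) = ?w"
      using True by (simp add: dact_def)
    ultimately show ?thesis
      using IH(2) by (simp del: o_apply foldl_append)
  next
    case False
    have "gperm g \<in> reflections X"
      unfolding reflections_def using g(1) by (intro CollectI exI[of _ id] exI[of _ g]) simp
    then have "bruhat X ?w (?w \<circ> gperm g)"
      using wlen_not_desc[OF w g(1) False] by (intro bruhat_step) auto
    moreover have "?w \<circ> gperm g \<circ> inv v = ?w \<circ> inv ?y"
      by (simp add: iy comp_assoc)
    moreover have "foldl dact u (p @ [g]) = ?w \<circ> gperm g"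
      using False by (simp add: dact_def)
    ultimately show ?thesis
      using IH(1) bruhat_trans[OF IH(2)] by (simp del: o_apply foldl_append)
  qed
qed

lemma bruhat_dem:
  assumes "u \<in> weyl X" "v \<in> weyl X"
  shows "bruhat X (dem X u v \<circ> inv v) (dem X u v)"
proof -
  obtain p where "reduced X p v" using assms reduced_exists by blast
  then show ?thesis
    using bruhat_dem_aux[of X p v u] dem_eq[of u X p v] assms bruhat_trans by (auto simp: weyl_signed)
qed

lemma finite_bruhat: "w \<in> weyl X \<Longrightarrow> finite {u. bruhat X u w}"
  using finite_subset[OF _ finite_weyl_upto] bruhat_weyl_upto
  by (metis (no_types, lifting) UN_E weyl_def mem_Collect_eq subsetI)

section \<open>Power series and substitutions\<close>

lemma mcoeff_simps [simp]:
  "mcoeff 0 m = 0" "mcoeff (f + g) m = mcoeff f m + mcoeff g m"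
  "mcoeff (- f) m = - mcoeff f m" "mcoeff (f - g) m = mcoeff f m - mcoeff g m"
  by (simp_all add: mps_ring_defs)

lemma mcoeff_one: "mcoeff 1 m = (if m = 0 then 1 else 0)"
  by (simp add: one_mps_def)

lemma mcoeff_mult: "mcoeff (f * g) m = (\<Sum>(p, q)\<in>splits m. mcoeff f p * mcoeff g q)"
  by (simp add: times_mps_def)

lemma mcoeff_sum: "mcoeff (sum f A) m = (\<Sum>x\<in>A. mcoeff (f x) m)"
  by (induction A rule: infinite_finite_induct) auto

lemma sum_splits_single:
  assumes "\<And>p q. p + q = m \<Longrightarrow> p \<noteq> p0 \<Longrightarrow> F p q = 0"
  shows "(\<Sum>(p, q)\<in>splits m. F p q) = (if \<exists>q. p0 + q = m then F p0 (m - p0) else 0)"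
proof -
  have "(\<Sum>(p, q)\<in>splits m. F p q) = (\<Sum>(p, q)\<in>{(p, q). p = p0 \<and> p + q = m}. F p q)"
    by (rule sum.mono_neutral_right) (use assms in \<open>auto simp: splits_def\<close>, (metis finite_splits splits_def)?)
  also have "{(p, q). p = p0 \<and> p + q = m} = (if \<exists>q. p0 + q = m then {(p0, m - p0)} else {})"
    by auto
  finally show ?thesis by auto
qed

lemma mcoeff_mconst_mult: "mcoeff (mconst c * f) m = c * mcoeff f m"
  unfolding mcoeff_mult
  by (subst sum_splits_single[where ?p0.0 = 0]) (auto simp: mconst_def)

lemma single_add_eq: "(\<exists>q. Poly_Mapping.single v (1::nat) + q = m) \<longleftrightarrow> Poly_Mapping.lookup m v \<noteq> 0"
proof
  assume "Poly_Mapping.lookup m v \<noteq> 0"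
  then have "Poly_Mapping.single v 1 + (m - Poly_Mapping.single v 1) = m"
    by (intro poly_mapping_eqI) (auto simp: lookup_add lookup_minus lookup_single when_def)
  then show "\<exists>q. Poly_Mapping.single v (1::nat) + q = m" by blast
qed (auto simp: lookup_add)

lemma mcoeff_mvar_mult:
  "mcoeff (mvar v * f) m =
     (if Poly_Mapping.lookup m v = 0 then 0 else mcoeff f (m - Poly_Mapping.single v 1))"
  unfolding mcoeff_mult
  by (subst sum_splits_single[where ?p0.0 = "Poly_Mapping.single v 1"])
     (simp_all add: mvar_def single_add_eq del: One_nat_def)

section \<open>Substitution as a ring homomorphism\<close>

definition mdeg :: "('v \<Rightarrow>\<^sub>0 nat) \<Rightarrow> nat" where
  "mdeg m = (\<Sum>v\<in>Poly_Mapping.keys m. Poly_Mapping.lookup m v)"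

lemma mdeg_superset:
  "finite A \<Longrightarrow> Poly_Mapping.keys m \<subseteq> A \<Longrightarrow> mdeg m = (\<Sum>v\<in>A. Poly_Mapping.lookup m v)"
  unfolding mdeg_def by (rule sum.mono_neutral_left) (auto simp: in_keys_iff)

lemma keys_add_nat: "Poly_Mapping.keys (p + q :: 'v \<Rightarrow>\<^sub>0 nat) = Poly_Mapping.keys p \<union> Poly_Mapping.keys q"
  by (auto simp: in_keys_iff lookup_add)

lemma mdeg_add: "mdeg (p + q) = mdeg p + mdeg q"
  using mdeg_superset[of "Poly_Mapping.keys p \<union> Poly_Mapping.keys q"]
  by (simp add: keys_add_nat lookup_add sum.distrib)

lemma mdeg_pos: "m \<noteq> 0 \<Longrightarrow> 0 < mdeg m"
  by (auto simp: mdeg_def in_keys_iff intro!: Nat.gr0I poly_mapping_eqI)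

lemma mono_subst_superset:
  assumes "finite A" "Poly_Mapping.keys m \<subseteq> A"
  shows "mono_subst \<sigma> m = (\<Prod>v\<in>A. \<sigma> v ^ Poly_Mapping.lookup m v)"
  unfolding mono_subst_def
  by (rule prod.mono_neutral_left) (use assms in \<open>auto simp: in_keys_iff\<close>)

lemma mono_subst_add: "mono_subst \<sigma> (p + q) = mono_subst \<sigma> p * mono_subst \<sigma> q"
proof -
  let ?A = "Poly_Mapping.keys p \<union> Poly_Mapping.keys q"
  have "mono_subst \<sigma> m = (\<Prod>v\<in>?A. \<sigma> v ^ Poly_Mapping.lookup m v)" if "Poly_Mapping.keys m \<subseteq> ?A" for m
    using that by (intro mono_subst_superset) auto
  then show ?thesis
    by (simp add: keys_add_nat lookup_add power_add prod.distrib)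
qed

lemma mono_subst_0 [simp]: "mono_subst \<sigma> 0 = 1"
  by (simp add: mono_subst_def)

lemma mono_subst_single [simp]: "mono_subst \<sigma> (Poly_Mapping.single v (Suc 0)) = \<sigma> v"
  by (simp add: mono_subst_def)

definition occurs :: "'v \<Rightarrow> ('v, 'a::zero) mps \<Rightarrow> bool" where
  "occurs v f \<longleftrightarrow> (\<exists>m. mcoeff f m \<noteq> 0 \<and> Poly_Mapping.lookup m v \<noteq> 0)"

definition adm :: "('v \<Rightarrow> ('v, 'a::comm_ring_1) mps) \<Rightarrow> bool" where
  "adm \<sigma> \<longleftrightarrow> (\<forall>v. mcoeff (\<sigma> v) 0 = 0) \<and> (\<forall>u. finite {v. occurs u (\<sigma> v)})"

definition svars :: "('v \<Rightarrow> ('v, 'a::comm_ring_1) mps) \<Rightarrow> ('v \<Rightarrow>\<^sub>0 nat) \<Rightarrow> 'v set" where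
  "svars \<sigma> k = (\<Union>u\<in>Poly_Mapping.keys k. {v. occurs u (\<sigma> v)})"

text \<open>A finite box that contains every monomial contributing to the coefficient at k. A box
  serves better than the exact set: it is closed under divisors and grows with k, so a product can
  be expanded over one index set.\<close>

definition smonos :: "('v \<Rightarrow> ('v, 'a::comm_ring_1) mps) \<Rightarrow> ('v \<Rightarrow>\<^sub>0 nat) \<Rightarrow> ('v \<Rightarrow>\<^sub>0 nat) set" where
  "smonos \<sigma> k = {m. Poly_Mapping.keys m \<subseteq> svars \<sigma> k \<and> (\<forall>v. Poly_Mapping.lookup m v \<le> mdeg k)}"

lemma finite_bounded_monos:
  assumes "finite A"
  shows "finite {m. Poly_Mapping.keys m \<subseteq> A \<and> (\<forall>v. Poly_Mapping.lookup m v \<le> (N::nat))}"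
proof -
  let ?L = "{f. \<forall>x. (x \<in> A \<longrightarrow> f x \<in> {..N}) \<and> (x \<notin> A \<longrightarrow> f x = 0)}"
  have "finite ?L"
    using assms by (intro finite_set_of_finite_funs) auto
  moreover have "inj Poly_Mapping.lookup"
    by (rule injI) (rule poly_mapping_eqI, rule fun_cong)
  ultimately have "finite (Poly_Mapping.lookup -` ?L)"
    by (rule finite_vimageI)
  then show ?thesis
    by (rule rev_finite_subset) (auto simp: in_keys_iff)
qed

lemma finite_smonos [simp]: "adm \<sigma> \<Longrightarrow> finite (smonos \<sigma> k)"
  unfolding smonos_def by (rule finite_bounded_monos) (auto simp: svars_def adm_def)

lemma smonos_mono: "p + q = k \<Longrightarrow> smonos \<sigma> p \<subseteq> smonos \<sigma> k \<and> smonos \<sigma> q \<subseteq> smonos \<sigma> k"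
  by (fastforce simp: smonos_def svars_def keys_add_nat mdeg_add intro: order_trans)

lemma smonos_add: "p + q \<in> smonos \<sigma> k \<Longrightarrow> p \<in> smonos \<sigma> k \<and> q \<in> smonos \<sigma> k"
  by (auto simp: smonos_def keys_add_nat lookup_add intro: add_leD1 add_leD2)

lemma mcoeff_mult_nz:
  "mcoeff (f * g) k \<noteq> 0 \<Longrightarrow> \<exists>p q. p + q = k \<and> mcoeff f p \<noteq> 0 \<and> mcoeff g q \<noteq> 0"
  unfolding mcoeff_mult
  by (drule sum.not_neutral_contains_not_neutral)
     (auto simp: splits_def, metis mult_zero_left mult_zero_right)

lemma mcoeff_power_nz:
  "mcoeff f 0 = 0 \<Longrightarrow> mcoeff (f ^ e) k \<noteq> 0 \<Longrightarrow> e \<le> mdeg k"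
proof (induction e arbitrary: k)
  case (Suc e)
  then obtain p q where pq: "p + q = k" "mcoeff f p \<noteq> 0" "mcoeff (f ^ e) q \<noteq> 0"
    using mcoeff_mult_nz[of f "f ^ e" k] by auto
  then have "p \<noteq> 0" "e \<le> mdeg q" using Suc by auto
  then show ?case using mdeg_pos[of p] pq(1) mdeg_add[of p q] by auto
qed simp

text \<open>As \<sigma> v has no constant term, its e-th power starts in degree e, which bounds the
  exponents. If v occurs in m, some nonconstant monomial of \<sigma> v divides k, so \<sigma> v
  shares a variable with k.\<close>

lemma mono_subst_nz:
  assumes "adm \<sigma>" "mcoeff (mono_subst \<sigma> m) k \<noteq> 0"
  shows "m \<in> smonos \<sigma> k"
proof -
  have 0: "mcoeff (\<sigma> v) 0 = 0" for v using assms(1) by (simp add: adm_def)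
  have *: "v \<in> svars \<sigma> k \<and> Poly_Mapping.lookup m v \<le> mdeg k" if v: "v \<in> Poly_Mapping.keys m" for v
  proof -
    let ?e = "Poly_Mapping.lookup m v"
    have "mono_subst \<sigma> m = \<sigma> v ^ ?e * (\<Prod>w\<in>Poly_Mapping.keys m - {v}. \<sigma> w ^ Poly_Mapping.lookup m w)"
      unfolding mono_subst_def using v by (intro prod.remove) auto
    then obtain p q where pq: "p + q = k" "mcoeff (\<sigma> v ^ ?e) p \<noteq> 0"
      using assms(2) mcoeff_mult_nz by metis
    then have le: "?e \<le> mdeg k"
      using mcoeff_power_nz[OF 0 pq(2)] mdeg_add[of p q] by auto
    obtain e where "?e = Suc e" using v by (cases ?e) (auto simp: in_keys_iff)
    then obtain r s where rs: "r + s = p" "mcoeff (\<sigma> v) r \<noteq> 0"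
      using pq(2) mcoeff_mult_nz[of "\<sigma> v" "\<sigma> v ^ e" p] by auto
    then have "r \<noteq> 0" using 0 by auto
    then obtain u where u: "u \<in> Poly_Mapping.keys r"
      using keys_eq_empty by blast
    then have "occurs u (\<sigma> v)" using rs by (auto simp: occurs_def in_keys_iff)
    moreover have "u \<in> Poly_Mapping.keys k"
      using u rs(1) pq(1) by (auto simp: keys_add_nat)
    ultimately show ?thesis using le by (auto simp: svars_def)
  qed
  have "Poly_Mapping.lookup m v \<le> mdeg k" for v
    using * by (cases "v \<in> Poly_Mapping.keys m") (auto simp: in_keys_iff)
  with * show ?thesis by (auto simp: smonos_def)
qed

text \<open>The set T is left free so that coefficients at several k can be summed over the same
  set.\<close>

lemma mcoeff_msubst:
  assumes "adm \<sigma>" "finite T" "smonos \<sigma> k \<subseteq> T"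
  shows "mcoeff (msubst \<sigma> f) k = (\<Sum>m\<in>T. mcoeff f m * mcoeff (mono_subst \<sigma> m) k)"
  unfolding msubst_def mcoeff_Abs_mps
  by (rule sum.mono_neutral_left) (use assms mono_subst_nz in auto)

lemma msubst_mult:
  assumes "adm \<sigma>"
  shows "msubst \<sigma> (f * g) = msubst \<sigma> f * msubst \<sigma> g"
proof (rule mps_eqI)
  fix k
  let ?S = "smonos \<sigma> k" and ?c = "\<lambda>m k. mcoeff (mono_subst \<sigma> m) k"
  have z: "?c m k = 0" if "m \<notin> ?S" for m
    using mono_subst_nz[OF assms] that by blast
  have "mcoeff (msubst \<sigma> (f * g)) k =
      (\<Sum>m\<in>?S. \<Sum>(p, q)\<in>splits m. mcoeff f p * mcoeff g q * ?c (p + q) k)"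
    using assms by (subst mcoeff_msubst[of _ ?S])
      (auto simp: mcoeff_mult sum_distrib_right splits_def intro!: sum.cong)
  also have "\<dots> = (\<Sum>(m, (p, q))\<in>Sigma ?S splits. mcoeff f p * mcoeff g q * ?c (p + q) k)"
    using assms by (subst sum.Sigma) (auto simp: case_prod_unfold)
  also have "\<dots> = (\<Sum>(p, q)\<in>{(p, q). p + q \<in> ?S}. mcoeff f p * mcoeff g q * ?c (p + q) k)"
    by (rule sum.reindex_bij_witness[where i = "\<lambda>(p, q). (p + q, (p, q))" and j = snd])
       (auto simp: splits_def)
  \<comment> \<open>Pairs with p + q outside the box contribute zero, and over the full square the
    double sum factors.\<close>
  also have "\<dots> = (\<Sum>(p, q)\<in>?S \<times> ?S. mcoeff f p * mcoeff g q * ?c (p + q) k)"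
  proof (rule sum.mono_neutral_left)
    show "{(p, q). p + q \<in> ?S} \<subseteq> ?S \<times> ?S" by (auto dest: smonos_add)
    show "\<forall>i\<in>?S \<times> ?S - {(p, q). p + q \<in> ?S}.
        (case i of (p, q) \<Rightarrow> mcoeff f p * mcoeff g q * ?c (p + q) k) = 0"
    proof
      fix i assume "i \<in> ?S \<times> ?S - {(p, q). p + q \<in> ?S}"
      then show "(case i of (p, q) \<Rightarrow> mcoeff f p * mcoeff g q * ?c (p + q) k) = 0"
        by (cases i) (simp add: z)
    qed
  qed (use assms in simp)
  also have "\<dots> = (\<Sum>(p, q)\<in>?S \<times> ?S. \<Sum>(k1, k2)\<in>splits k.
      mcoeff f p * ?c p k1 * (mcoeff g q * ?c q k2))"
    by (intro sum.cong refl)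
       (auto simp: mono_subst_add mcoeff_mult sum_distrib_left mult_ac case_prod_unfold)
  also have "\<dots> = (\<Sum>(k1, k2)\<in>splits k. \<Sum>(p, q)\<in>?S \<times> ?S.
      mcoeff f p * ?c p k1 * (mcoeff g q * ?c q k2))"
    by (simp add: case_prod_unfold) (rule sum.swap)
  also have "\<dots> = (\<Sum>(k1, k2)\<in>splits k. mcoeff (msubst \<sigma> f) k1 * mcoeff (msubst \<sigma> g) k2)"
  proof (intro sum.cong refl, clarify)
    fix k1 k2 assume "(k1, k2) \<in> splits k"
    then have "smonos \<sigma> k1 \<subseteq> ?S" "smonos \<sigma> k2 \<subseteq> ?S"
      using smonos_mono[of k1 k2 k] by (auto simp: splits_def)
    then show "(\<Sum>(p, q)\<in>?S \<times> ?S. mcoeff f p * ?c p k1 * (mcoeff g q * ?c q k2)) =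
        mcoeff (msubst \<sigma> f) k1 * mcoeff (msubst \<sigma> g) k2"
      using assms by (simp add: mcoeff_msubst[of _ ?S] sum_product sum.cartesian_product)
  qed
  also have "\<dots> = mcoeff (msubst \<sigma> f * msubst \<sigma> g) k"
    by (simp add: mcoeff_mult)
  finally show "mcoeff (msubst \<sigma> (f * g)) k = mcoeff (msubst \<sigma> f * msubst \<sigma> g) k" .
qed

lemma msubst_add: "adm \<sigma> \<Longrightarrow> msubst \<sigma> (f + g) = msubst \<sigma> f + msubst \<sigma> g"
  by (rule mps_eqI) (simp add: mcoeff_msubst[OF _ _ order_refl] distrib_right sum.distrib)

lemma msubst_mconst: 
  assumes "adm \<sigma>"
  shows "msubst \<sigma> (mconst c) = mconst c"
proof (rule mps_eqI)
  fix k
  have "mcoeff (msubst \<sigma> (mconst c)) k =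
      (\<Sum>m\<in>insert 0 (smonos \<sigma> k). mcoeff (mconst c) m * mcoeff (mono_subst \<sigma> m) k)"
    using assms by (intro mcoeff_msubst) auto
  also have "\<dots> = (\<Sum>m\<in>insert 0 (smonos \<sigma> k). if m = 0 then c * mcoeff 1 k else 0)"
    by (rule sum.cong) (auto simp: mconst_def)
  also have "\<dots> = mcoeff (mconst c) k"
    using assms by (simp add: mcoeff_one mconst_def del: sum.insert)
  finally show "mcoeff (msubst \<sigma> (mconst c)) k = mcoeff (mconst c) k" .
qed

lemma msubst_mvar:
  assumes "adm \<sigma>"
  shows "msubst \<sigma> (mvar v) = \<sigma> v"
proof (rule mps_eqI)
  fix k
  let ?s = "Poly_Mapping.single v 1"
  have "mcoeff (msubst \<sigma> (mvar v)) k =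
      (\<Sum>m\<in>insert ?s (smonos \<sigma> k). mcoeff (mvar v) m * mcoeff (mono_subst \<sigma> m) k)"
    using assms by (intro mcoeff_msubst) auto
  also have "\<dots> = (\<Sum>m\<in>insert ?s (smonos \<sigma> k). if m = ?s then mcoeff (\<sigma> v) k else 0)"
    by (rule sum.cong) (auto simp: mvar_def)
  also have "\<dots> = mcoeff (\<sigma> v) k"
    using assms by (simp del: sum.insert)
  finally show "mcoeff (msubst \<sigma> (mvar v)) k = mcoeff (\<sigma> v) k" .
qed

lemma mconst_1: "mconst 1 = 1"
  by (simp add: mconst_def one_mps_def)

section \<open>Coefficientwise convergence\<close>

definition mtends :: "(nat \<Rightarrow> ('v, 'a) mps) \<Rightarrow> ('v, 'a) mps \<Rightarrow> bool" where
  "mtends f g \<longleftrightarrow> (\<forall>m. \<forall>\<^sub>F n in sequentially. mcoeff (f n) m = mcoeff g m)"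

lemma mtends_const [simp]: "mtends (\<lambda>n. f) f"
  by (simp add: mtends_def)

lemma mtends_mult:
  assumes "mtends f g" "mtends f' g'"
  shows "mtends (\<lambda>n. f n * f' n) (g * g')"
  unfolding mtends_def
proof
  fix m
  have "\<forall>\<^sub>F n in sequentially. \<forall>s\<in>splits m.
      mcoeff (f n) (fst s) = mcoeff g (fst s) \<and> mcoeff (f' n) (snd s) = mcoeff g' (snd s)"
    using assms by (intro eventually_ball_finite ballI eventually_conj) (auto simp: mtends_def)
  then show "\<forall>\<^sub>F n in sequentially. mcoeff (f n * f' n) m = mcoeff (g * g') m"
    by (rule eventually_mono) (simp add: mcoeff_mult case_prod_unfold)
qed

lemma mtends_sum:
  assumes "\<And>x. x \<in> A \<Longrightarrow> mtends (\<lambda>n. f n x) (g x)" "finite A"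
  shows "mtends (\<lambda>n. \<Sum>x\<in>A. f n x) (\<Sum>x\<in>A. g x)"
  unfolding mtends_def
proof
  fix m
  have "\<forall>\<^sub>F n in sequentially. \<forall>x\<in>A. mcoeff (f n x) m = mcoeff (g x) m"
    using assms by (intro eventually_ball_finite) (auto simp: mtends_def)
  then show "\<forall>\<^sub>F n in sequentially. mcoeff (\<Sum>x\<in>A. f n x) m = mcoeff (\<Sum>x\<in>A. g x) m"
    by (rule eventually_mono) (simp add: mcoeff_sum)
qed

lemma mtends_unique:
  assumes "mtends f g" "mtends f h"
  shows "g = h"
proof (rule mps_eqI)
  fix m
  have "\<forall>\<^sub>F n in sequentially. mcoeff (f n) m = mcoeff g m \<and> mcoeff (f n) m = mcoeff h m"
    using assms by (intro eventually_conj) (auto simp: mtends_def)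
  then have "\<forall>\<^sub>F n :: nat in sequentially. mcoeff g m = mcoeff h m"
    by (rule eventually_mono) metis
  then show "mcoeff g m = mcoeff h m" by simp
qed

lemma msubst_mtends:
  assumes "adm \<sigma>" "mtends f g"
  shows "mtends (\<lambda>n. msubst \<sigma> (f n)) (msubst \<sigma> g)"
  unfolding mtends_def
proof
  fix k
  have "\<forall>\<^sub>F n in sequentially. \<forall>m\<in>smonos \<sigma> k. mcoeff (f n) m = mcoeff g m"
    using assms by (intro eventually_ball_finite) (auto simp: mtends_def)
  then show "\<forall>\<^sub>F n in sequentially. mcoeff (msubst \<sigma> (f n)) k = mcoeff (msubst \<sigma> g) k"
    by (rule eventually_mono) (simp add: mcoeff_msubst[OF assms(1) _ order_refl] assms(1))
qed

text \<open>Sets the variables in V to 0. Coefficients at monomials that avoid V do not change,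
  which is how \<open>mcoeff_Fprod\<close> gets rid of surplus x variables.\<close>

definition mdrop :: "'v set \<Rightarrow> ('v, 'a::zero) mps \<Rightarrow> ('v, 'a) mps" where
  "mdrop V f = Abs_mps (\<lambda>m. if Poly_Mapping.keys m \<inter> V = {} then mcoeff f m else 0)"

lemma mdrop_mult: "mdrop V (f * g) = mdrop V f * (mdrop V g :: ('v, 'a::comm_ring_1) mps)"
proof (rule mps_eqI)
  fix m
  let ?d = "\<lambda>p. Poly_Mapping.keys p \<inter> V = {}"
  have "mcoeff (mdrop V f) p * mcoeff (mdrop V g) q = (if ?d m then mcoeff f p * mcoeff g q else 0)"
    if "p + q = m" for p q
    using that by (auto simp: mdrop_def keys_add_nat)
  then have "mcoeff (mdrop V f * mdrop V g) m =
      (\<Sum>(p, q)\<in>splits m. if ?d m then mcoeff f p * mcoeff g q else 0)"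
    unfolding mcoeff_mult by (intro sum.cong) (auto simp: splits_def)
  then show "mcoeff (mdrop V (f * g)) m = mcoeff (mdrop V f * mdrop V g) m"
    by (simp add: mdrop_def mcoeff_mult)
qed

lemma mdrop_add: "mdrop V (f + g) = mdrop V f + (mdrop V g :: ('v, 'a::comm_ring_1) mps)"
  by (rule mps_eqI) (auto simp: mdrop_def)

lemma mdrop_1: "mdrop V 1 = (1 :: ('v, 'a::comm_ring_1) mps)"
  by (rule mps_eqI) (auto simp: mdrop_def mcoeff_one)

lemma mdrop_mconst: "mdrop V (mconst c) = mconst c"
  by (rule mps_eqI) (auto simp: mdrop_def mconst_def)

lemma mdrop_mvar: "mdrop V (mvar v) = (if v \<in> V then 0 else mvar v :: ('v, 'a::comm_ring_1) mps)"
  by (rule mps_eqI) (auto simp: mdrop_def mvar_def)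

section \<open>Nonzerodivisors and exact quotients\<close>

definition cancellable :: "'r::comm_ring_1 \<Rightarrow> bool" where
  "cancellable g \<longleftrightarrow> (\<forall>f. g * f = 0 \<longrightarrow> f = 0)"

lemma mquot_eqI:
  assumes "cancellable g" "g * q = f"
  shows "mquot f g = q"
  unfolding mquot_def
proof (rule the_equality)
  fix r assume "g * r = f"
  then have "g * (r - q) = 0" using assms(2) by (simp add: right_diff_distrib)
  then show "r = q" using assms(1) by (auto simp: cancellable_def)
qed (rule assms(2))

lemma cancellable_unit: "u * e = 1 \<Longrightarrow> cancellable u"
  unfolding cancellable_def by (metis mult.assoc mult.commute mult_1 mult_zero_right)

lemma cancellable_mult: "cancellable f \<Longrightarrow> cancellable g \<Longrightarrow> cancellable (f * g)"
  unfolding cancellable_def by (metis mult.assoc)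

lemma cancellable_minus: "cancellable f \<Longrightarrow> cancellable (- f)"
  unfolding cancellable_def by simp

lemma cancellable_mvar: "cancellable (mvar v :: ('v, 'a::comm_ring_1) mps)"
  unfolding cancellable_def
proof (intro allI impI mps_eqI)
  fix f :: "('v, 'a) mps" and m assume "mvar v * f = 0"
  then have "mcoeff (mvar v * f) (m + Poly_Mapping.single v 1) = 0" by simp
  then show "mcoeff f m = mcoeff 0 m" by (simp add: mcoeff_mvar_mult lookup_add)
qed

text \<open>If f is killed, let f' be its part of least degree k in v. In degree k the summand with
  the factor v cannot contribute, so g kills f', although f' is not 0.\<close>

lemma cancellable_add_mvar_mult:
  fixes g :: "('v, 'a::comm_ring_1) mps"
  assumes "cancellable g" "\<not> occurs v g"
  shows "cancellable (g + mvar v * g')"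
  unfolding cancellable_def
proof (intro allI impI, rule ccontr)
  fix f assume f: "(g + mvar v * g') * f = 0" "f \<noteq> 0"
  define P where "P k \<longleftrightarrow> (\<exists>m. mcoeff f m \<noteq> 0 \<and> Poly_Mapping.lookup m v = k)" for k
  have "\<exists>k. P k" using f(2) by (metis P_def mcoeff_simps(1) mps_eqI)
  define k where "k = (LEAST k. P k)"
  have k: "P k" unfolding k_def using \<open>\<exists>k. P k\<close> by (rule LeastI_ex)
  have least: "mcoeff f m = 0" if "Poly_Mapping.lookup m v < k" for m
    using not_less_Least[of "Poly_Mapping.lookup m v" P] that by (auto simp: k_def P_def)
  define f' where "f' = Abs_mps (\<lambda>m. if Poly_Mapping.lookup m v = k then mcoeff f m else 0)"
  have g: "mcoeff g p = 0" if "Poly_Mapping.lookup p v \<noteq> 0" for p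
    using assms(2) that by (auto simp: occurs_def)
  have "g * f' = 0"
  proof (rule mps_eqI)
    fix m
    show "mcoeff (g * f') m = mcoeff 0 m"
    proof (cases "Poly_Mapping.lookup m v = k")
      case True
      have "mcoeff g p * mcoeff f' q = mcoeff g p * mcoeff f q" if "p + q = m" for p q
        using that True g[of p] by (auto simp: f'_def lookup_add)
      then have "mcoeff (g * f') m = mcoeff (g * f) m"
        unfolding mcoeff_mult by (intro sum.cong) (auto simp: splits_def)
      moreover have "mcoeff (mvar v * (g' * f)) m = 0"
      proof -
        have "mcoeff (g' * f) (m - Poly_Mapping.single v 1) = 0" if "k \<noteq> 0"
          unfolding mcoeff_mult
        proof (rule sum.neutral, clarify)
          fix p q assume "(p, q) \<in> splits (m - Poly_Mapping.single v 1)"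
          then have "Poly_Mapping.lookup (p + q) v = k - 1"
            using True by (simp add: splits_def lookup_minus)
          then have "Poly_Mapping.lookup q v < k"
            using that by (simp add: lookup_add)
          then show "mcoeff g' p * mcoeff f q = 0" using least by simp
        qed
        then show ?thesis using True by (simp add: mcoeff_mvar_mult)
      qed
      moreover have "mcoeff (g * f) m + mcoeff (mvar v * (g' * f)) m = 0"
        using arg_cong[OF f(1), of "\<lambda>f. mcoeff f m"] by (simp add: distrib_right mult.assoc)
      ultimately show ?thesis by simp
    next
      case False
      have "mcoeff g p * mcoeff f' q = 0" if "p + q = m" for p q
        using that False g[of p] by (auto simp: f'_def lookup_add)
      then show ?thesis
        unfolding mcoeff_mult by (auto simp: splits_def intro!: sum.neutral)
    qed
  qed
  then have "f' = 0" using assms(1) by (simp add: cancellable_def)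
  moreover obtain m where "mcoeff f m \<noteq> 0" "Poly_Mapping.lookup m v = k"
    using k by (auto simp: P_def)
  then have "mcoeff f' m \<noteq> 0" by (simp add: f'_def)
  ultimately show False by simp
qed

lemma occurs_mvar [simp]: "occurs u (mvar v :: ('v, 'a::zero_neq_one) mps) \<longleftrightarrow> u = v"
  by (auto simp: occurs_def mvar_def lookup_single when_def)

lemma occurs_mult: "occurs v (f * g) \<Longrightarrow> occurs v f \<or> occurs v g"
  unfolding occurs_def using mcoeff_mult_nz by (fastforce simp: lookup_add)

lemma occurs_minus [simp]: "occurs v (- f :: ('v, 'a::comm_ring_1) mps) \<longleftrightarrow> occurs v f"
  by (simp add: occurs_def)

lemma mcoeff_mult_0:
  fixes f g :: "('v, 'a::comm_ring_1) mps"
  shows "mcoeff (f * g) 0 = mcoeff f 0 * mcoeff g 0"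
proof -
  have "p = 0" if "p + q = (0 :: 'v \<Rightarrow>\<^sub>0 nat)" for p q
    using that mdeg_pos[of p] mdeg_add[of p q] by (auto simp: mdeg_def)
  then show ?thesis
    unfolding mcoeff_mult by (subst sum_splits_single[where ?p0.0 = 0]) auto
qed

section \<open>The formal group law\<close>

lemma mcoeff_beta_mult: "mcoeff (beta * f) m = [:0, 1:] * mcoeff f m"
  by (simp only: beta_def mcoeff_mconst_mult)

text \<open>The geometric series of the (- beta v)^k, inverse to 1 + beta v.\<close>

definition geom :: "var \<Rightarrow> R" where
  "geom v = Abs_mps (\<lambda>m. if m = Poly_Mapping.single v (Poly_Mapping.lookup m v)
     then (- [:0, 1:]) ^ Poly_Mapping.lookup m v else 0)"

lemma geom_mult: "(1 + beta * mvar v) * geom v = 1"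
proof (rule mps_eqI)
  fix m :: "var \<Rightarrow>\<^sub>0 nat"
  let ?s = "Poly_Mapping.single v :: nat \<Rightarrow> _" and ?l = "Poly_Mapping.lookup m v"
  have eq: "mcoeff ((1 + beta * mvar v) * geom v) m =
      mcoeff (geom v) m + [:0, 1:] * mcoeff (mvar v * geom v) m"
    by (simp add: distrib_right mult.assoc mcoeff_beta_mult)
  show "mcoeff ((1 + beta * mvar v) * geom v) m = mcoeff 1 m"
  proof (cases "?l = 0")
    case True
    then show ?thesis
      unfolding eq by (auto simp: mcoeff_mvar_mult geom_def mcoeff_one)
  next
    case False
    then obtain k where k: "?l = Suc k" by (cases ?l) auto
    have "m - ?s 1 = ?s k \<longleftrightarrow> m = ?s (Suc k)"
      using k by (auto simp: poly_mapping_eq_iff fun_eq_iff lookup_minus lookup_single when_def)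
    moreover have "m \<noteq> 0" using k by auto
    ultimately show ?thesis
      unfolding eq using k by (auto simp: mcoeff_mvar_mult geom_def mcoeff_one lookup_minus)
  qed
qed

lemma occurs_geom: "occurs u (geom v) \<Longrightarrow> u = v"
proof -
  assume "occurs u (geom v)"
  then obtain m where "mcoeff (geom v) m \<noteq> 0" and u: "Poly_Mapping.lookup m u \<noteq> 0"
    by (auto simp: occurs_def)
  then have "m = Poly_Mapping.single v (Poly_Mapping.lookup m v)"
    by (simp add: geom_def split: if_splits)
  with u have "Poly_Mapping.lookup (Poly_Mapping.single v (Poly_Mapping.lookup m v)) u \<noteq> 0"
    by metis
  then show "u = v" by (auto simp: lookup_single when_def split: if_splits)
qed

text \<open>The condition under which \<open>bar x\<close> is a true inverse of x for \<oplus>; it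
  passes to \<open>bar x\<close> and through every \<open>beta_hom\<close>.\<close>

definition good :: "R \<Rightarrow> bool" where
  "good x \<longleftrightarrow> (\<exists>e. (1 + beta * x) * e = 1)"

lemma good_mvar [simp]: "good (mvar v)"
  using geom_mult by (auto simp: good_def)

lemma bar_eqI: "good x \<Longrightarrow> (1 + beta * x) * y = - x \<Longrightarrow> bar x = y"
  unfolding bar_def good_def by (auto intro: mquot_eqI cancellable_unit)

lemma bar_mult:
  assumes "good x"
  shows "(1 + beta * x) * bar x = - x"
proof -
  obtain e where e: "(1 + beta * x) * e = 1" using assms by (auto simp: good_def)
  then have *: "(1 + beta * x) * (- x * e) = - x"
    by (metis mult.left_commute mult.right_neutral)
  then have "bar x = - x * e"
    using assms by (intro bar_eqI)
  then show ?thesis using * by simp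
qed

lemma bar_mult_one: "good x \<Longrightarrow> (1 + beta * x) * (1 + beta * bar x) = 1"
proof -
  assume "good x"
  then have "(1 + beta * x) * (1 + beta * bar x) = 1 + beta * x + beta * (- x)"
    using bar_mult[of x] by (simp add: distrib_left mult.left_commute)
  then show ?thesis by simp
qed

lemma good_bar [simp]: "good x \<Longrightarrow> good (bar x)"
  using bar_mult_one[of x] unfolding good_def by (auto simp: mult.commute)

lemma bar_bar [simp]: "good x \<Longrightarrow> bar (bar x) = x"
proof -
  assume x: "good x"
  then have "(1 + beta * bar x) * x = - bar x"
    using bar_mult[OF x] by (simp add: algebra_simps eq_neg_iff_add_eq_0)
  then show ?thesis using x by (intro bar_eqI) auto
qed

lemma oplus_bar [simp]: "good x \<Longrightarrow> oplus x (bar x) = 0"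
  using bar_mult[of x] by (simp add: oplus_def algebra_simps)

lemma oplus_commute: "oplus x y = oplus y x"
  by (simp add: oplus_def algebra_simps)

lemma oplus_assoc: "oplus (oplus x y) z = oplus x (oplus y z)"
  by (simp add: oplus_def algebra_simps)

lemma oplus_exchange: "oplus (oplus x y) (oplus z w) = oplus (oplus x z) (oplus y w)"
  by (simp add: oplus_def algebra_simps)

lemma oplus_0 [simp]: "oplus x 0 = x" "oplus 0 x = x"
  by (simp_all add: oplus_def)

lemma bar_mvar: "bar (mvar v) = - mvar v * geom v"
  by (rule bar_eqI) (simp_all add: geom_mult mult.left_commute)

section \<open>Endomorphisms of the coefficient ring\<close>

locale beta_hom =
  fixes \<phi> :: "R \<Rightarrow> R"
  assumes hom_add: "\<phi> (x + y) = \<phi> x + \<phi> y"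
    and hom_mult: "\<phi> (x * y) = \<phi> x * \<phi> y"
    and hom_1 [simp]: "\<phi> 1 = 1"
    and hom_beta [simp]: "\<phi> beta = beta"
begin

lemma hom_0 [simp]: "\<phi> 0 = 0"
  using hom_add[of 0 0] by simp

lemma hom_uminus: "\<phi> (- x) = - \<phi> x"
  using hom_add[of x "- x"] by (simp add: eq_neg_iff_add_eq_0 add.commute)

lemma hom_sum: "\<phi> (\<Sum>x\<in>A. f x) = (\<Sum>x\<in>A. \<phi> (f x))"
  by (induction A rule: infinite_finite_induct) (auto simp: hom_add)

lemma hom_power: "\<phi> (x ^ n) = \<phi> x ^ n"
  by (induction n) (auto simp: hom_mult)

lemma hom_good: "good x \<Longrightarrow> good (\<phi> x)"
  unfolding good_def by (metis hom_1 hom_add hom_beta hom_mult)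

lemma hom_bar: "good x \<Longrightarrow> \<phi> (bar x) = bar (\<phi> x)"
  using arg_cong[OF bar_mult[of x], of \<phi>]
  by (intro bar_eqI[symmetric] hom_good) (simp_all add: hom_add hom_mult hom_uminus)

end

lemma beta_hom_msubst: "adm \<sigma> \<Longrightarrow> beta_hom (msubst \<sigma>)"
  by unfold_locales
     (auto simp: msubst_add msubst_mult beta_def msubst_mconst mconst_1[symmetric])

lemma beta_hom_mdrop: "beta_hom (mdrop V)"
  by unfold_locales (auto simp: mdrop_add mdrop_mult mdrop_1 beta_def mdrop_mconst)

fun vindex :: "var \<Rightarrow> nat" where
  "vindex (VA k) = k" | "vindex (VB k) = k" | "vindex (VC k) = k" | "vindex (VX k) = k"

lemma finite_vindex_le: "finite {v. vindex v \<le> n}"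
proof (rule finite_subset)
  show "{v. vindex v \<le> n} \<subseteq> VA ` {..n} \<union> VB ` {..n} \<union> VC ` {..n} \<union> VX ` {..n}"
  proof
    fix v assume "v \<in> {v. vindex v \<le> n}"
    then show "v \<in> VA ` {..n} \<union> VB ` {..n} \<union> VC ` {..n} \<union> VX ` {..n}"
      by (cases v) auto
  qed
qed auto

text \<open>At most the variable \<tau> v occurs in \<sigma> v, and its index is at most 2 lower
  than that of v, so a given variable comes from finitely many v. The 2 is the shift of the x
  variables by s_hat1.\<close>

lemma admI:
  fixes \<sigma> :: "var \<Rightarrow> R"
  assumes "\<And>v. \<sigma> v = 0 \<or> \<sigma> v = mvar (\<tau> v) \<or> \<sigma> v = bar (mvar (\<tau> v))"
    and "\<And>v. vindex v \<le> vindex (\<tau> v) + 2"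
  shows "adm \<sigma>"
proof -
  have "mcoeff (mvar u :: R) 0 = 0" for u
  proof -
    have "Poly_Mapping.lookup (Poly_Mapping.single u (1::nat)) u \<noteq> Poly_Mapping.lookup 0 u"
      by simp
    then have "0 \<noteq> Poly_Mapping.single u (1::nat)" by metis
    then show ?thesis by (simp add: mvar_def)
  qed
  then have "mcoeff (\<sigma> v) 0 = 0" for v
    using assms(1)[of v] by (auto simp: bar_mvar mcoeff_mult_0)
  moreover have "finite {v. occurs u (\<sigma> v)}" for u
  proof (rule finite_subset[OF _ finite_vindex_le])
    show "{v. occurs u (\<sigma> v)} \<subseteq> {v. vindex v \<le> vindex u + 2}"
    proof clarify
      fix v assume u: "occurs u (\<sigma> v)"
      then have "\<sigma> v \<noteq> 0" by (auto simp: occurs_def)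
      then have "u = \<tau> v"
        using u assms(1)[of v] by (auto simp: bar_mvar dest!: occurs_mult occurs_geom)
      then show "vindex v \<le> vindex u + 2" using assms(2)[of v] by simp
    qed
  qed
  ultimately show ?thesis by (simp add: adm_def)
qed

fun s_src :: "gen \<Rightarrow> var \<Rightarrow> var" where
  "s_src (Sgen i) (VA k) = VA (if i = 0 then k else Transposition.transpose i (i + 1) k)"
| "s_src (Sgen i) (VX k) = (if i = 0 then if k = 1 then VA 1 else VX (k - 1) else VX k)"
| "s_src Hat1 (VA k) = VA (if k = 1 then 2 else if k = 2 then 1 else k)"
| "s_src Hat1 (VX k) = (if k = 1 then VA 1 else if k = 2 then VA 2 else VX (k - 2))"
| "s_src _ v = v"

lemma adm_s_var: "adm (s_var i)"
proof (rule admI[of _ "s_src i"])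
  fix v
  show "s_var i v = 0 \<or> s_var i v = mvar (s_src i v) \<or> s_var i v = bar (mvar (s_src i v))"
    by (cases i; cases v) auto
  show "vindex v \<le> vindex (s_src i v) + 2"
    by (cases i; cases v) (auto simp: transpose_def)
qed

lemma adm_cbar_var: "adm cbar_var"
proof (rule admI[of _ "\<lambda>v. case v of VA k \<Rightarrow> VC k | _ \<Rightarrow> v"])
  fix v
  show "cbar_var v = 0 \<or> cbar_var v = mvar (case v of VA k \<Rightarrow> VC k | _ \<Rightarrow> v) \<or>
      cbar_var v = bar (mvar (case v of VA k \<Rightarrow> VC k | _ \<Rightarrow> v))"
    by (cases v) auto
  show "vindex v \<le> vindex (case v of VA k \<Rightarrow> VC k | _ \<Rightarrow> v) + 2"
    by (cases v) auto
qed

text \<open>For type C, where alpha_0 contains the factor 2 + beta a_1.\<close>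

lemma cancellable_2: "cancellable (2 :: R)"
  unfolding cancellable_def
proof (intro allI impI mps_eqI)
  fix f :: R and m assume "2 * f = 0"
  then have "mcoeff f m + mcoeff f m = 0"
    by (simp only: mult_2 mcoeff_simps(2)[symmetric] mcoeff_simps(1))
  then have "2 * mcoeff f m = 0" by (simp only: mult_2)
  then show "mcoeff f m = mcoeff 0 m" by simp
qed

text \<open>Up to sign, each alpha is a product of inverses e_k of the units 1 + beta a_k and an
  element seen to be a nonzerodivisor: a_n - a_(n+1), a_1, a_1 (2 + beta a_1) or a_1 + a_2 (1 + beta
  a_1). This makes the quotient in \<open>pi_op\<close> unique.\<close>

lemma cancellable_alpha:
  assumes "i \<in> gens X"
  shows "cancellable (alpha X i)"
proof -
  define e where "e k = geom (VA k)" for k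
  have e: "e k + beta * avar k * e k = 1" for k
    using geom_mult[of "VA k"] by (simp add: e_def distrib_right)
  have e': "1 - beta * avar k * e k = e k" for k
    using e[of k] by (metis add_diff_cancel_right')
  have ce: "cancellable (e k)" for k
    using geom_mult[of "VA k"] by (intro cancellable_unit[of _ "1 + beta * avar k"]) (simp add: e_def mult.commute)
  have ba: "bar (avar k) = - avar k * e k" for k
    by (simp add: bar_mvar e_def)
  have diff: "cancellable (avar j - avar k)" if "j \<noteq> k" for j k
    using cancellable_add_mvar_mult[OF cancellable_mvar, of "VA k" "VA j" "- 1"] that by simp
  show ?thesis
  proof (cases i)
    case Hat1
    have "alpha X i = - ((avar 1 + avar 2 * (1 + beta * avar 1)) * e 1 * e 2)"
    proof -
      have 1: "e 1 * (1 + beta * avar 1) = 1" and 2: "1 - beta * avar 2 * e 2 = e 2"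
        using e[of 1] e' by (simp_all add: algebra_simps)
      have "- ((avar 1 + avar 2 * (1 + beta * avar 1)) * e 1 * e 2) =
          - avar 1 * e 1 * e 2 - avar 2 * e 2 * (e 1 * (1 + beta * avar 1))"
        by (simp add: algebra_simps)
      also have "\<dots> = - avar 1 * e 1 * (1 - beta * avar 2 * e 2) - avar 2 * e 2"
        unfolding 1 2 by simp
      also have "\<dots> = alpha X i"
        unfolding Hat1 alpha.simps oplus_def ba by (simp add: algebra_simps)
      finally show ?thesis by simp
    qed
    moreover have "cancellable (avar 1 + avar 2 * (1 + beta * avar 1))"
      by (intro cancellable_add_mvar_mult cancellable_mvar) simp
    ultimately show ?thesis
      using ce by (simp only:) (intro cancellable_minus cancellable_mult)
  next
    case (Sgen n)
    consider "n \<noteq> 0" | "n = 0" "X \<noteq> TypeC" | "n = 0" "X = TypeC" by blast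
    then show ?thesis
    proof cases
      case 1
      have "oplus (avar n) (bar (avar (n + 1))) = (avar n - avar (n + 1)) * e (n + 1)"
      proof -
        have "avar n * (1 - beta * avar (n + 1) * e (n + 1)) = avar n * e (n + 1)"
          by (simp only: e')
        then show ?thesis
          unfolding oplus_def ba by (simp add: algebra_simps)
      qed
      then show ?thesis
        using 1 Sgen ce diff[of n "n + 1"] by (simp add: cancellable_mult)
    next
      case 2
      then show ?thesis
        using Sgen ce by (simp add: ba cancellable_minus cancellable_mult cancellable_mvar)
    next
      case 3
      have "alpha X i = - (avar 1 * (2 + avar 1 * beta) * e 1 * e 1)"
      proof -
        have "(2 + avar 1 * beta) * e 1 = 2 - beta * avar 1 * e 1"
          using arg_cong[OF e[of 1], of "\<lambda>x. 2 * x"] by (simp add: algebra_simps)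
        then have "avar 1 * ((2 + avar 1 * beta) * e 1) * e 1 =
            avar 1 * (2 - beta * avar 1 * e 1) * e 1" by simp
        then show ?thesis
          unfolding Sgen alpha.simps oplus_def ba using 3 by (simp add: algebra_simps)
      qed
      moreover have "mcoeff (2 :: R) m = (if m = 0 then 2 else 0)" for m
        using mcoeff_simps(2)[of "1 :: R" 1 m] by (simp add: mcoeff_one)
      then have "cancellable (2 + avar 1 * beta)"
        by (intro cancellable_add_mvar_mult cancellable_2) (auto simp: occurs_def split: if_splits)
      ultimately show ?thesis
        using ce by (simp only:) (intro cancellable_minus cancellable_mult cancellable_mvar)
    qed
  qed
qed

section \<open>The Id-Coxeter algebra as a ring\<close>

definition dsplits :: "ctype \<Rightarrow> sperm \<Rightarrow> (sperm \<times> sperm) set" where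
  "dsplits X w = {(u, v). u \<in> weyl X \<and> v \<in> weyl X \<and> dem X u v = w}"

text \<open>The exponent of beta in the product of two basis elements; on the group the subtraction
  loses nothing, by \<open>wlen_dem_le\<close>.\<close>

definition defect :: "ctype \<Rightarrow> sperm \<Rightarrow> sperm \<Rightarrow> nat" where
  "defect X u v = wlen X u + wlen X v - wlen X (dem X u v)"

lemma dsplits_weyl_upto: "w \<in> weyl_upto X n \<Longrightarrow> dsplits X w \<subseteq> weyl_upto X n \<times> weyl_upto X n"
  by (auto simp: dsplits_def dem_weyl_upto)

lemma finite_dsplits [simp]: "finite (dsplits X w)"
proof (cases "w \<in> weyl X")
  case True
  then obtain n where "w \<in> weyl_upto X n" by (auto simp: weyl_def)
  then show ?thesis
    using dsplits_weyl_upto finite_subset by (metis finite_SigmaI finite_weyl_upto)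
next
  case False
  then have "dsplits X w = {}" by (auto simp: dsplits_def)
  then show ?thesis by simp
qed

lemma id_mult_eq:
  "id_mult X f g w = (\<Sum>(u, v)\<in>dsplits X w. beta ^ defect X u v * f u * g v)"
proof -
  have iff: "id_times X u v k w \<longleftrightarrow> (u, v) \<in> dsplits X w \<and> k = defect X u v" for u v k
    using wlen_dem_le[of u X v] by (auto simp: id_times_iff dsplits_def defect_def)
  have eq: "{(u, v). \<exists>k. id_times X u v k w} = dsplits X w"
    by (auto simp: iff)
  have "(THE k. id_times X u v k w) = defect X u v" if "(u, v) \<in> dsplits X w" for u v
    using that by (auto simp: iff)
  then show ?thesis
    unfolding id_mult_def eq by (intro sum.cong) auto
qed

lemma id_mult_outside: "w \<notin> weyl X \<Longrightarrow> id_mult X f g w = 0"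
proof -
  assume "w \<notin> weyl X"
  then have "dsplits X w = {}" by (auto simp: dsplits_def)
  then show ?thesis by (simp add: id_mult_eq)
qed

text \<open>The triples are reindexed by associativity of the Demazure product. On either side the
  exponents of beta add up to the three lengths minus the length of w.\<close>

lemma id_mult_assoc: "id_mult X (id_mult X f g) h = id_mult X f (id_mult X g h)"
proof
  fix w
  let ?S = "dsplits X" and ?\<delta> = "\<lambda>u v. beta ^ defect X u v" and ?l = "wlen X"
  have wt: "?\<delta> (dem X u v) r * ?\<delta> u v = ?\<delta> u (dem X v r) * ?\<delta> v r"
    if "u \<in> weyl X" "v \<in> weyl X" "r \<in> weyl X" for u v r
    using that wlen_dem_le[of u X v] wlen_dem_le[of v X r] wlen_dem_le[of "dem X u v" X r]
      wlen_dem_le[of u X "dem X v r"]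
    by (simp add: power_add[symmetric] defect_def dem_assoc add_ac)
  have "id_mult X (id_mult X f g) h w =
      (\<Sum>(z, r)\<in>?S w. \<Sum>(u, v)\<in>?S z. ?\<delta> z r * ?\<delta> u v * (f u * g v * h r))"
    by (simp add: id_mult_eq sum_distrib_left sum_distrib_right case_prod_unfold mult_ac)
  also have "\<dots> = (\<Sum>((z, r), (u, v))\<in>(SIGMA s:?S w. ?S (fst s)).
      ?\<delta> z r * ?\<delta> u v * (f u * g v * h r))"
    by (simp add: sum.Sigma case_prod_unfold)
  also have "\<dots> = (\<Sum>((u, z), (v, r))\<in>(SIGMA s:?S w. ?S (snd s)).
      ?\<delta> u z * ?\<delta> v r * (f u * g v * h r))"
    by (rule sum.reindex_bij_witness
          [where i = "\<lambda>((u, z), (v, r)). ((dem X u v, r), (u, v))"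
             and j = "\<lambda>((z, r), (u, v)). ((u, dem X v r), (v, r))"])
       (auto simp: dsplits_def dem_assoc wt)
  also have "\<dots> = (\<Sum>(u, z)\<in>?S w. \<Sum>(v, r)\<in>?S z. ?\<delta> u z * ?\<delta> v r * (f u * g v * h r))"
    by (simp add: sum.Sigma case_prod_unfold)
  also have "\<dots> = id_mult X f (id_mult X g h) w"
    by (simp add: id_mult_eq sum_distrib_left sum_distrib_right case_prod_unfold mult_ac)
  finally show "id_mult X (id_mult X f g) h w = id_mult X f (id_mult X g h) w" .
qed

lemma id_one_eq: "id_one w = (if w = id then 1 else 0)"
  by (simp add: id_one_def id_basis_def)

lemma id_mult_one_left:
  assumes "\<And>w. w \<notin> weyl X \<Longrightarrow> f w = 0"
  shows "id_mult X id_one f = f"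
proof
  fix w
  show "id_mult X id_one f w = f w"
  proof (cases "w \<in> weyl X")
    case True
    have "(\<Sum>(u, v)\<in>dsplits X w. beta ^ defect X u v * id_one u * f v) =
        (\<Sum>(u, v)\<in>{(id, w)}. beta ^ defect X u v * id_one u * f v)"
    proof (rule sum.mono_neutral_right)
      show "{(id, w)} \<subseteq> dsplits X w"
        using True by (simp add: dsplits_def del: id_apply)
      show "\<forall>i\<in>dsplits X w - {(id, w)}. (case i of (u, v) \<Rightarrow> beta ^ defect X u v * id_one u * f v) = 0"
        by (auto simp: dsplits_def id_one_eq split: if_splits)
    qed simp
    then show ?thesis
      using True by (simp add: id_mult_eq id_one_eq defect_def del: id_apply)
  qed (use assms in \<open>simp add: id_mult_outside\<close>)
qed

lemma id_mult_one_right: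
  assumes "\<And>w. w \<notin> weyl X \<Longrightarrow> f w = 0"
  shows "id_mult X f id_one = f"
proof
  fix w
  show "id_mult X f id_one w = f w"
  proof (cases "w \<in> weyl X")
    case True
    have "(\<Sum>(u, v)\<in>dsplits X w. beta ^ defect X u v * f u * id_one v) =
        (\<Sum>(u, v)\<in>{(w, id)}. beta ^ defect X u v * f u * id_one v)"
    proof (rule sum.mono_neutral_right)
      show "{(w, id)} \<subseteq> dsplits X w"
        using True by (simp add: dsplits_def del: id_apply)
      show "\<forall>i\<in>dsplits X w - {(w, id)}. (case i of (u, v) \<Rightarrow> beta ^ defect X u v * f u * id_one v) = 0"
        by (auto simp: dsplits_def id_one_eq split: if_splits)
    qed simp
    then show ?thesis
      using True by (simp add: id_mult_eq id_one_eq defect_def del: id_apply)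
  qed (use assms in \<open>simp add: id_mult_outside\<close>)
qed

text \<open>The completed algebra has to be a type in order to be a ring; since it depends on the type
  \<open>X\<close> of the Weyl group, it is indexed by a phantom type that names \<open>X\<close>.\<close>

class ctag =
  fixes ctype_of :: "'a itself \<Rightarrow> ctype"

typedef (overloaded) ('x::ctag) idalg =
  "{f :: ialg. \<forall>w. w \<notin> weyl (ctype_of TYPE('x)) \<longrightarrow> f w = 0}"
  morphisms icoeff Abs_idalg
  by (rule exI[of _ "\<lambda>_. 0"]) simp

lemma icoeff_outside: "w \<notin> weyl (ctype_of TYPE('x)) \<Longrightarrow> icoeff (f :: 'x::ctag idalg) w = 0"
  using icoeff[of f] by blast

lemma icoeff_Abs:
  "(\<And>w. w \<notin> weyl (ctype_of TYPE('x)) \<Longrightarrow> f w = 0) \<Longrightarrow> icoeff (Abs_idalg f :: 'x::ctag idalg) = f"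
  by (simp add: Abs_idalg_inverse)

lemma idalg_eqI:
  fixes f g :: "'x::ctag idalg"
  assumes "\<And>w. w \<in> weyl (ctype_of TYPE('x)) \<Longrightarrow> icoeff f w = icoeff g w"
  shows "f = g"
proof -
  have "icoeff f = icoeff g"
  proof
    fix w
    show "icoeff f w = icoeff g w"
      using assms icoeff_outside[of w f] icoeff_outside[of w g] by (cases "w \<in> weyl (ctype_of TYPE('x))") auto
  qed
  then show ?thesis by (simp add: icoeff_inject)
qed

instantiation idalg :: (ctag) ring_1
begin

definition "0 = (Abs_idalg (\<lambda>_. 0) :: 'a idalg)"
definition "1 = (Abs_idalg id_one :: 'a idalg)"
definition "f + g = (Abs_idalg (\<lambda>w. icoeff f w + icoeff g w) :: 'a idalg)"
definition "f - g = (Abs_idalg (\<lambda>w. icoeff f w - icoeff g w) :: 'a idalg)"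
definition "- f = (Abs_idalg (\<lambda>w. - icoeff f w) :: 'a idalg)"
definition "f * g = (Abs_idalg (id_mult (ctype_of TYPE('a)) (icoeff f) (icoeff g)) :: 'a idalg)"

lemma icoeff_simps:
  fixes f g :: "'a idalg"
  shows "icoeff (0 :: 'a idalg) w = 0" "icoeff (f + g) w = icoeff f w + icoeff g w"
    "icoeff (f - g) w = icoeff f w - icoeff g w" "icoeff (- f) w = - icoeff f w"
  by (simp_all add: zero_idalg_def plus_idalg_def minus_idalg_def uminus_idalg_def icoeff_Abs icoeff_outside)

lemma icoeff_1: "icoeff (1 :: 'a idalg) = id_one"
  unfolding one_idalg_def by (rule icoeff_Abs) (auto simp: id_one_eq)

lemma icoeff_mult: "icoeff (f * g :: 'a idalg) = id_mult (ctype_of TYPE('a)) (icoeff f) (icoeff g)"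
  unfolding times_idalg_def by (rule icoeff_Abs) (simp add: id_mult_outside)

instance
proof
  fix f g h :: "'a idalg"
  show "f * g * h = f * (g * h)"
    by (rule idalg_eqI) (simp add: icoeff_mult id_mult_assoc)
  show "1 * f = f" "f * 1 = f"
    by (rule idalg_eqI, simp add: icoeff_mult icoeff_1 id_mult_one_left id_mult_one_right icoeff_outside)+
  show "(f + g) * h = f * h + g * h" "f * (g + h) = f * g + f * h"
    by (rule idalg_eqI, simp add: icoeff_mult icoeff_simps id_mult_eq algebra_simps sum.distrib case_prod_unfold)+
  show "(0 :: 'a idalg) \<noteq> 1"
  proof
    assume "(0 :: 'a idalg) = 1"
    then have "icoeff (0 :: 'a idalg) id = icoeff (1 :: 'a idalg) id" by simp
    then show False by (simp add: icoeff_simps icoeff_1 id_one_eq del: id_apply)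
  qed
qed (rule idalg_eqI; simp add: icoeff_simps algebra_simps)+

end

declare icoeff_simps [simp]

lemma icoeff_mult_eq:
  fixes f g :: "'x::ctag idalg"
  defines "X \<equiv> ctype_of TYPE('x)"
  shows "icoeff (f * g) w = (\<Sum>(u, v)\<in>dsplits X w. beta ^ defect X u v * icoeff f u * icoeff g v)"
  by (simp add: icoeff_mult id_mult_eq X_def)

definition smul :: "R \<Rightarrow> 'x::ctag idalg \<Rightarrow> 'x idalg" (infixr "\<bullet>" 75) where
  "r \<bullet> f = Abs_idalg (\<lambda>w. r * icoeff f w)"

lemma icoeff_smul [simp]: "icoeff (r \<bullet> f) w = r * icoeff f w"
  by (simp add: smul_def icoeff_Abs icoeff_outside)

lemma smul_left_distrib: "(r + s) \<bullet> f = r \<bullet> f + s \<bullet> f"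
  and smul_right_distrib: "r \<bullet> (f + g) = r \<bullet> f + r \<bullet> g"
  and smul_left_diff: "(r - s) \<bullet> f = r \<bullet> f - s \<bullet> f"
  and smul_right_diff: "r \<bullet> (f - g) = r \<bullet> f - r \<bullet> g"
  and smul_smul [simp]: "r \<bullet> s \<bullet> f = (r * s) \<bullet> f"
  and smul_1 [simp]: "1 \<bullet> f = f"
  and smul_0 [simp]: "0 \<bullet> f = 0"
  and smul_minus: "(- r) \<bullet> f = - (r \<bullet> f)"
  by (rule idalg_eqI; simp add: algebra_simps)+

lemma smul_mult_left [simp]: "(r \<bullet> f) * g = r \<bullet> (f * g)"
  and smul_mult_right [simp]: "f * (r \<bullet> g) = r \<bullet> (f * g)"
  by (rule idalg_eqI; simp add: icoeff_mult_eq sum_distrib_left case_prod_unfold mult_ac)+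

text \<open>Cut off outside the group, so that every v, also one outside it, gives an element of the
  type.\<close>

definition ibasis :: "sperm \<Rightarrow> 'x::ctag idalg" where
  "ibasis v = Abs_idalg (\<lambda>w. if w \<in> weyl (ctype_of TYPE('x)) then id_basis v w else 0)"

lemma icoeff_ibasis:
  "v \<in> weyl (ctype_of TYPE('x)) \<Longrightarrow> icoeff (ibasis v :: 'x::ctag idalg) w = (if w = v then 1 else 0)"
  by (auto simp: ibasis_def icoeff_Abs id_basis_def)

lemma icoeff_mult_ibasis:
  fixes f :: "'x::ctag idalg"
  defines "X \<equiv> ctype_of TYPE('x)"
  assumes "v \<in> weyl X"
  shows "icoeff (f * ibasis v) w =
    (\<Sum>u | u \<in> weyl X \<and> dem X u v = w. beta ^ defect X u v * icoeff f u)"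
proof -
  have "icoeff (f * ibasis v) w =
      (\<Sum>(u, v')\<in>dsplits X w. if v' = v then beta ^ defect X u v * icoeff f u else 0)"
    using assms by (auto simp: icoeff_mult_eq icoeff_ibasis intro!: sum.cong)
  also have "\<dots> = (\<Sum>(u, v')\<in>{u. u \<in> weyl X \<and> dem X u v = w} \<times> {v}. beta ^ defect X u v * icoeff f u)"
  proof (rule sum.mono_neutral_cong_right)
    show "{u. u \<in> weyl X \<and> dem X u v = w} \<times> {v} \<subseteq> dsplits X w"
      using assms by (auto simp: dsplits_def)
    show "finite (dsplits X w)" by simp
  qed (auto simp: dsplits_def split: if_splits)
  finally show ?thesis by (simp add: sum.cartesian_product[symmetric])
qed

text \<open>Expands the right factor in the basis. V only has to contain the v that contribute,
  since the index set coming from the Bruhat order may be larger.\<close>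

lemma icoeff_mult_expand:
  fixes f g :: "'x::ctag idalg"
  defines "X \<equiv> ctype_of TYPE('x)"
  assumes "finite V" "V \<subseteq> weyl X" "\<And>u v. u \<in> weyl X \<Longrightarrow> v \<in> weyl X \<Longrightarrow> dem X u v = w \<Longrightarrow> v \<in> V"
  shows "icoeff (f * g) w = (\<Sum>v\<in>V. icoeff (f * ibasis v) w * icoeff g v)"
proof -
  have fin: "finite {u. u \<in> weyl X \<and> dem X u v = w}" if "v \<in> V" for v
  proof (rule finite_subset)
    show "{u. u \<in> weyl X \<and> dem X u v = w} \<subseteq> fst ` dsplits X w"
      using that assms(3) by (force simp: dsplits_def)
  qed simp
  have "icoeff (f * g) w = (\<Sum>(u, v)\<in>dsplits X w. beta ^ defect X u v * icoeff f u * icoeff g v)"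
    by (simp add: icoeff_mult_eq X_def)
  also have "\<dots> = (\<Sum>(v, u)\<in>(SIGMA v:V. {u. u \<in> weyl X \<and> dem X u v = w}).
      beta ^ defect X u v * icoeff f u * icoeff g v)"
    by (rule sum.reindex_bij_witness[where i = prod.swap and j = prod.swap])
       (use assms(3,4) in \<open>auto simp: dsplits_def\<close>)
  also have "\<dots> = (\<Sum>v\<in>V. \<Sum>u | u \<in> weyl X \<and> dem X u v = w. beta ^ defect X u v * icoeff f u * icoeff g v)"
    using fin assms(2) by (subst sum.Sigma) auto
  also have "\<dots> = (\<Sum>v\<in>V. icoeff (f * ibasis v) w * icoeff g v)"
  proof (intro sum.cong refl)
    fix v assume "v \<in> V"
    then have "v \<in> weyl (ctype_of TYPE('x))" using assms(3) X_def by blast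
    then show "(\<Sum>u | u \<in> weyl X \<and> dem X u v = w. beta ^ defect X u v * icoeff f u * icoeff g v) =
        icoeff (f * ibasis v) w * icoeff g v"
      by (simp add: icoeff_mult_ibasis sum_distrib_right X_def)
  qed
  finally show ?thesis .
qed

section \<open>Products of the generators\<close>

abbreviation ugen :: "gen \<Rightarrow> 'x::ctag idalg" where "ugen i \<equiv> ibasis (gperm i)"

lemma reduced_single: "g \<in> gens X \<Longrightarrow> reduced X [g] (gperm g)"
  using reduced_snoc[of X "[]" id g] by simp

lemma dem_gperm: "u \<in> weyl X \<Longrightarrow> g \<in> gens X \<Longrightarrow> dem X u (gperm g) = dact u g"
  using dem_eq[OF _ reduced_single, of u g X] by (simp add: weyl_signed)

lemma wlen_gperm: "g \<in> gens X \<Longrightarrow> wlen X (gperm g) = 1"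
  using reduced_length[OF reduced_single] by simp

lemma ibasis_mult_ugen:
  fixes X defines "X \<equiv> ctype_of TYPE('x::ctag)"
  assumes "u \<in> weyl X" "g \<in> gens X"
  shows "ibasis u * ugen g = (beta ^ (wlen X u + 1 - wlen X (dact u g)) \<bullet> ibasis (dact u g) :: 'x idalg)"
proof (rule idalg_eqI)
  fix w
  have "icoeff (ibasis u * ugen g :: 'x idalg) w =
      (\<Sum>u' | u' \<in> weyl X \<and> dem X u' (gperm g) = w. beta ^ defect X u' (gperm g) * (if u' = u then 1 else 0))"
    using assms by (simp add: icoeff_mult_ibasis icoeff_ibasis)
  also have "\<dots> = (\<Sum>u'\<in>(if dact u g = w then {u} else {}). beta ^ (wlen X u + 1 - wlen X (dact u g)))"
  proof (rule sum.mono_neutral_cong)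
    have "{u'. u' \<in> weyl X \<and> dem X u' (gperm g) = w} \<subseteq> fst ` dsplits X w"
    proof
      fix u' assume "u' \<in> {u'. u' \<in> weyl X \<and> dem X u' (gperm g) = w}"
      then have "(u', gperm g) \<in> dsplits X w"
        using assms by (simp add: dsplits_def)
      then show "u' \<in> fst ` dsplits X w" by (rule image_eqI[rotated]) simp
    qed
    then show "finite {u'. u' \<in> weyl X \<and> dem X u' (gperm g) = w}"
      by (rule finite_subset) simp
  qed (use assms in \<open>auto simp: dem_gperm defect_def wlen_gperm split: if_splits\<close>)
  finally show "icoeff (ibasis u * ugen g :: 'x idalg) w =
      icoeff (beta ^ (wlen X u + 1 - wlen X (dact u g)) \<bullet> ibasis (dact u g) :: 'x idalg) w"
    using assms by (auto simp: icoeff_ibasis)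
qed

lemma ibasis_id [simp]: "(ibasis id :: 'x::ctag idalg) = 1"
  by (rule idalg_eqI) (simp add: icoeff_ibasis icoeff_1 id_one_eq del: id_apply)

text \<open>The exponent counts the letters that were absorbed; the first conjunct is carried along
  so that the subtraction is exact.\<close>

lemma prod_list_ugen:
  fixes X defines "X \<equiv> ctype_of TYPE('x::ctag)"
  assumes "set p \<subseteq> gens X"
  shows "wlen X (foldl dact id p) \<le> length p \<and>
    prod_list (map ugen p) =
      (beta ^ (length p - wlen X (foldl dact id p)) \<bullet> ibasis (foldl dact id p) :: 'x idalg)"
  using assms(2)
proof (induction p rule: rev_induct)
  case Nil
  have "foldl dact id [] = id" by simp
  then show ?case by (simp del: id_apply foldl_Nil)
next
  case (snoc g p)
  define w where "w = foldl dact id p"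
  have w: "w \<in> weyl X" using snoc.prems by (simp add: w_def del: id_apply)
  have g: "g \<in> gens X" using snoc.prems by simp
  have IH: "wlen X w \<le> length p"
      "prod_list (map ugen p) = (beta ^ (length p - wlen X w) \<bullet> ibasis w :: 'x idalg)"
    using snoc by (simp_all add: w_def del: id_apply)
  have le: "wlen X (dact w g) \<le> wlen X w + 1"
    using wlen_comp_gperm_le[OF w g] by (simp add: dact_def)
  have "prod_list (map ugen (p @ [g])) =
      (beta ^ (length p - wlen X w) * beta ^ (wlen X w + 1 - wlen X (dact w g))) \<bullet> (ibasis (dact w g) :: 'x idalg)"
    using w g by (simp add: IH ibasis_mult_ugen X_def)
  also have "beta ^ (length p - wlen X w) * beta ^ (wlen X w + 1 - wlen X (dact w g)) =
      beta ^ (length (p @ [g]) - wlen X (dact w g))"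
    using le IH(1) by (simp add: power_add[symmetric])
  finally have "prod_list (map ugen (p @ [g])) =
      (beta ^ (length (p @ [g]) - wlen X (dact w g)) \<bullet> ibasis (dact w g) :: 'x idalg)" .
  moreover have "foldl dact id (p @ [g]) = dact w g"
    by (simp add: w_def)
  ultimately show ?case
    using le IH(1) by (simp del: id_apply foldl_append map_append)
qed

lemma prod_list_ugen_reduced:
  fixes X defines "X \<equiv> ctype_of TYPE('x::ctag)"
  assumes "reduced X p w"
  shows "prod_list (map ugen p) = (ibasis w :: 'x idalg)"
  using prod_list_ugen[of p, where ?'x = 'x] assms foldl_dact_reduced[OF assms(2)]
  by (simp add: reduced_def del: id_apply)

lemma ugen_square:
  assumes "g \<in> gens (ctype_of TYPE('x::ctag))"
  shows "ugen g * ugen g = (beta \<bullet> ugen g :: 'x idalg)"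
proof -
  have "dact (gperm g) g = gperm g"
    using desc_comp_gperm[of id g] by (simp add: dact_def)
  then show ?thesis
    using assms ibasis_mult_ugen[of "gperm g" g, where ?'x = 'x] by (simp add: wlen_gperm)
qed

lemma ugen_braid:
  assumes "i \<in> gens (ctype_of TYPE('x::ctag))" "j \<in> gens (ctype_of TYPE('x))" "i \<noteq> j" "braided m i j"
  shows "prod_list (map ugen (alternating i j m)) = (prod_list (map ugen (alternating j i m)) :: 'x idalg)"
proof -
  let ?X = "ctype_of TYPE('x)"
  have "foldl dact id (alternating i j m) = foldl dact id (alternating j i m)"
    using assms(4) by (simp add: braided_def)
  moreover have "set (alternating i j m) \<subseteq> gens ?X" "set (alternating j i m) \<subseteq> gens ?X"
    using assms by (auto simp: set_alternating braided_def)
  ultimately show ?thesis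
    using prod_list_ugen[of "alternating i j m", where ?'x = 'x]
      prod_list_ugen[of "alternating j i m", where ?'x = 'x] by simp
qed

section \<open>The factors h_i(x) and the Yang-Baxter relations\<close>

definition hfac :: "gen \<Rightarrow> R \<Rightarrow> 'x::ctag idalg" where
  "hfac i x = 1 + x \<bullet> ugen i"

lemma icoeff_hfac: "i \<in> gens (ctype_of TYPE('x)) \<Longrightarrow> icoeff (hfac i x :: 'x::ctag idalg) = h_elt i x"
  by (auto simp: hfac_def h_elt_def icoeff_1 icoeff_ibasis id_basis_def)

lemma hfac_0 [simp]: "hfac i 0 = 1"
  by (simp add: hfac_def)

text \<open>The square relation turns x into a one-parameter family for \<oplus>, so h_i(bar x) is
  the inverse of h_i(x).\<close>

lemma hfac_mult:
  assumes "i \<in> gens (ctype_of TYPE('x::ctag))"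
  shows "hfac i x * hfac i y = (hfac i (oplus x y) :: 'x idalg)"
  using assms
  by (simp add: hfac_def oplus_def algebra_simps ugen_square smul_left_distrib smul_right_distrib)

lemma hfac_bar:
  assumes "i \<in> gens (ctype_of TYPE('x::ctag))" "good x"
  shows "hfac i x * hfac i (bar x) = (1 :: 'x idalg)" "hfac i (bar x) * hfac i x = (1 :: 'x idalg)"
  using assms by (simp_all add: hfac_mult oplus_commute[of "bar x"])

lemma hfac_commute:
  assumes "i \<in> gens (ctype_of TYPE('x::ctag))" "j \<in> gens (ctype_of TYPE('x))" "i \<noteq> j" "braided 2 i j"
  shows "hfac i x * hfac j y = (hfac j y * hfac i x :: 'x idalg)"
  using ugen_braid[OF assms]
  by (simp add: hfac_def algebra_simps numeral_2_eq_2 smul_right_distrib)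

lemma hfac_yang_baxter_3:
  assumes "i \<in> gens (ctype_of TYPE('x::ctag))" "j \<in> gens (ctype_of TYPE('x))" "i \<noteq> j" "braided 3 i j"
  shows "hfac i x * hfac j (oplus x y) * hfac i y =
    (hfac j y * hfac i (oplus x y) * hfac j x :: 'x idalg)"
proof -
  define u v :: "'x idalg" where "u = ugen i" and "v = ugen j"
  have uv: "u * u = beta \<bullet> u" "v * v = beta \<bullet> v" "u * (u * z) = beta \<bullet> (u * z)"
    "v * (v * z) = beta \<bullet> (v * z)" for z
    using assms by (simp_all add: u_def v_def ugen_square mult.assoc[symmetric])
  have br: "v * (u * v) = u * (v * u)"
    using ugen_braid[OF assms] by (simp add: numeral_3_eq_3 u_def v_def)
  \<comment> \<open>For an arbitrary middle parameter z the two expansions differ only in the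
    coefficients of u and v, which are x \<oplus> y and z in one case and z and x \<oplus> y in the
    other. Taking z = x \<oplus> y makes them agree.\<close>
  have *: "(1 + x \<bullet> u) * (1 + z \<bullet> v) * (1 + y \<bullet> u) =
      1 + oplus x y \<bullet> u + z \<bullet> v + (x * z) \<bullet> (u * v) + (z * y) \<bullet> (v * u) + (x * z * y) \<bullet> (u * (v * u))"
    for z
    by (simp add: algebra_simps uv smul_left_distrib smul_right_distrib oplus_def)
  have **: "(1 + y \<bullet> v) * (1 + z \<bullet> u) * (1 + x \<bullet> v) =
      1 + oplus x y \<bullet> v + z \<bullet> u + (y * z) \<bullet> (v * u) + (z * x) \<bullet> (u * v) + (x * z * y) \<bullet> (u * (v * u))"
    for z
    by (simp add: algebra_simps uv br smul_left_distrib smul_right_distrib oplus_def)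
  show ?thesis
    unfolding hfac_def u_def[symmetric] v_def[symmetric] * **
    by (simp add: algebra_simps)
qed

text \<open>It is used for \<open>q = x \<oplus> y\<close>, \<open>s = y \<ominus> x\<close>, and for \<open>p = x\<close>, \<open>r = y\<close> in type \<open>B\<close>,
  \<open>p = x \<oplus> x\<close>, \<open>r = y \<oplus> y\<close> in type \<open>C\<close>.\<close>

lemma hfac_yang_baxter_4:
  assumes "i \<in> gens (ctype_of TYPE('x::ctag))" "j \<in> gens (ctype_of TYPE('x))" "i \<noteq> j" "braided 4 i j"
    and eq: "q * r = p * q + p * s + r * s + beta * (p * q * s + p * r * s)"
  shows "hfac i p * hfac j q * hfac i r * hfac j s =
    (hfac j s * hfac i r * hfac j q * hfac i p :: 'x idalg)"
proof -
  define u v :: "'x idalg" where "u = ugen i" and "v = ugen j"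
  have uv: "u * u = beta \<bullet> u" "v * v = beta \<bullet> v" "u * (u * z) = beta \<bullet> (u * z)"
    "v * (v * z) = beta \<bullet> (v * z)" for z
    using assms by (simp_all add: u_def v_def ugen_square mult.assoc[symmetric])
  have br: "v * (u * (v * u)) = u * (v * (u * v))"
    using ugen_braid[OF assms(1-4)] by (simp add: eval_nat_numeral u_def v_def)
  \<comment> \<open>The two expansions differ only by an exchange of the coefficients of u v and v
    u, and \<open>eq\<close> says that these two are equal.\<close>
  have *: "(1 + p \<bullet> u) * (1 + q \<bullet> v) * (1 + r \<bullet> u) * (1 + s \<bullet> v) =
      1 + oplus p r \<bullet> u + oplus q s \<bullet> v
      + (p * q + p * s + r * s + beta * (p * q * s + p * r * s)) \<bullet> (u * v) + (q * r) \<bullet> (v * u)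
      + (p * q * r) \<bullet> (u * (v * u)) + (q * r * s) \<bullet> (v * (u * v)) + (p * q * r * s) \<bullet> (u * (v * (u * v)))"
    by (simp add: algebra_simps uv smul_left_distrib smul_right_distrib oplus_def)
  have **: "(1 + s \<bullet> v) * (1 + r \<bullet> u) * (1 + q \<bullet> v) * (1 + p \<bullet> u) =
      1 + oplus p r \<bullet> u + oplus q s \<bullet> v
      + (p * q + p * s + r * s + beta * (p * q * s + p * r * s)) \<bullet> (v * u) + (q * r) \<bullet> (u * v)
      + (p * q * r) \<bullet> (u * (v * u)) + (q * r * s) \<bullet> (v * (u * v)) + (p * q * r * s) \<bullet> (u * (v * (u * v)))"
    by (simp add: algebra_simps uv br smul_left_distrib smul_right_distrib oplus_def)
  show ?thesis
    unfolding hfac_def u_def[symmetric] v_def[symmetric] * ** eq[symmetric]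
    by (simp add: add_ac)
qed

section \<open>Limits and the generating functions\<close>

definition itends :: "(nat \<Rightarrow> 'x::ctag idalg) \<Rightarrow> 'x idalg \<Rightarrow> bool" where
  "itends F f \<longleftrightarrow> (\<forall>w. mtends (\<lambda>n. icoeff (F n) w) (icoeff f w))"

lemma itends_const [simp]: "itends (\<lambda>n. f) f"
  by (simp add: itends_def)

lemma itends_mult: "itends F f \<Longrightarrow> itends G g \<Longrightarrow> itends (\<lambda>n. F n * G n) (f * g)"
  unfolding itends_def icoeff_mult_eq case_prod_unfold
  by (intro allI mtends_sum mtends_mult mtends_const) auto

lemma itends_unique:
  assumes "itends F f" "itends F g"
  shows "f = g"
proof (rule idalg_eqI)
  fix w
  show "icoeff f w = icoeff g w"
    by (rule mtends_unique[of "\<lambda>n. icoeff (F n) w"]) (use assms in \<open>simp_all add: itends_def\<close>)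
qed

lemma itends_cong:
  assumes "\<forall>\<^sub>F n in sequentially. F n = G n" "itends F f"
  shows "itends G f"
  unfolding itends_def mtends_def
proof (intro allI)
  fix w m
  have "\<forall>\<^sub>F n in sequentially. mcoeff (icoeff (F n) w) m = mcoeff (icoeff f w) m"
    using assms(2) by (simp add: itends_def mtends_def)
  then show "\<forall>\<^sub>F n in sequentially. mcoeff (icoeff (G n) w) m = mcoeff (icoeff f w) m"
    using assms(1) by eventually_elim simp
qed

lemma itends_exI:
  fixes F :: "nat \<Rightarrow> 'x::ctag idalg"
  assumes "\<And>w m. w \<in> weyl (ctype_of TYPE('x)) \<Longrightarrow> \<exists>z. \<forall>\<^sub>F n in sequentially. mcoeff (icoeff (F n) w) m = z"
  shows "\<exists>f. itends F f"
proof -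
  let ?W = "weyl (ctype_of TYPE('x))"
  have "\<forall>w m. \<exists>z. w \<in> ?W \<longrightarrow> (\<forall>\<^sub>F n in sequentially. mcoeff (icoeff (F n) w) m = z)"
    using assms by blast
  then obtain z where z: "\<And>w m. w \<in> ?W \<Longrightarrow> \<forall>\<^sub>F n in sequentially. mcoeff (icoeff (F n) w) m = z w m"
    by metis
  define f :: "'x idalg" where "f = Abs_idalg (\<lambda>w. if w \<in> ?W then Abs_mps (z w) else 0)"
  have f: "icoeff f w = (if w \<in> ?W then Abs_mps (z w) else 0)" for w
    by (simp add: f_def icoeff_Abs)
  have "itends F f"
    unfolding itends_def mtends_def f using z by (auto simp: icoeff_outside)
  then show ?thesis by blast
qed

lemma id_lim_eq:
  assumes "itends F f"
  shows "id_lim (\<lambda>n. icoeff (F n)) = icoeff f"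
proof
  fix w
  have ev: "\<forall>\<^sub>F n in sequentially. mcoeff (icoeff (F n) w) m = mcoeff (icoeff f w) m" for m
    using assms by (simp add: itends_def mtends_def)
  have "(THE z. \<forall>\<^sub>F n in sequentially. mcoeff (icoeff (F n) w) m = z) = mcoeff (icoeff f w) m" for m
  proof (rule the_equality)
    show "\<forall>\<^sub>F n in sequentially. mcoeff (icoeff (F n) w) m = mcoeff (icoeff f w) m" by (rule ev)
    fix z assume "\<forall>\<^sub>F n in sequentially. mcoeff (icoeff (F n) w) m = z"
    then have "\<forall>\<^sub>F n :: nat in sequentially. z = mcoeff (icoeff f w) m"
      using ev[of m] by eventually_elim simp
    then show "z = mcoeff (icoeff f w) m" by simp
  qed
  then show "id_lim (\<lambda>n. icoeff (F n)) w = icoeff f w"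
    by (simp add: id_lim_def mcoeff_inverse)
qed

section \<open>Truncation to finite rank\<close>

definition trunc :: "nat \<Rightarrow> 'x::ctag idalg \<Rightarrow> 'x idalg" where
  "trunc n f = Abs_idalg (\<lambda>w. if w \<in> weyl_upto (ctype_of TYPE('x)) n then icoeff f w else 0)"

lemma icoeff_trunc:
  "icoeff (trunc n f :: 'x::ctag idalg) w = (if w \<in> weyl_upto (ctype_of TYPE('x)) n then icoeff f w else 0)"
  by (simp add: trunc_def icoeff_Abs icoeff_outside)

lemma trunc_mult: "trunc n (f * g) = trunc n f * (trunc n g :: 'x::ctag idalg)"
proof (rule idalg_eqI)
  fix w assume "w \<in> weyl (ctype_of TYPE('x))"
  show "icoeff (trunc n (f * g)) w = icoeff (trunc n f * trunc n g) w"
  proof (cases "w \<in> weyl_upto (ctype_of TYPE('x)) n")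
    case True
    then show ?thesis
      using dsplits_weyl_upto[OF True]
      by (auto simp: icoeff_mult_eq icoeff_trunc intro!: sum.cong)
  next
    case False
    have "u \<notin> weyl_upto (ctype_of TYPE('x)) n \<or> v \<notin> weyl_upto (ctype_of TYPE('x)) n"
      if "(u, v) \<in> dsplits (ctype_of TYPE('x)) w" for u v
      using that False dem_weyl_upto[of u "ctype_of TYPE('x)" v n] by (auto simp: dsplits_def)
    then have "icoeff (trunc n f * trunc n g) w = 0"
      unfolding icoeff_mult_eq by (intro sum.neutral) (force simp: icoeff_trunc)
    with False show ?thesis by (simp add: icoeff_trunc)
  qed
qed

lemma trunc_1 [simp]: "trunc n 1 = 1"
  by (rule idalg_eqI) (auto simp: icoeff_trunc icoeff_1 id_one_eq simp del: id_apply)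

lemma trunc_prod_list: "trunc n (prod_list fs) = prod_list (map (trunc n) fs)"
  by (induction fs) (auto simp: trunc_mult)

text \<open>Coefficients of rank n are final from index n on, for all monomials at once. The G
  factors satisfy this; the F factors of types B, C, D do not, because new x variables keep
  entering.\<close>

definition stable :: "(nat \<Rightarrow> 'x::ctag idalg) \<Rightarrow> bool" where
  "stable F \<longleftrightarrow> (\<forall>n N. n \<le> N \<longrightarrow> trunc n (F N) = trunc n (F n))"

lemma stable_icoeff:
  fixes F :: "nat \<Rightarrow> 'x::ctag idalg"
  assumes "stable F" "w \<in> weyl_upto (ctype_of TYPE('x)) n" "n \<le> N"
  shows "icoeff (F N) w = icoeff (F n) w"
proof -
  have "trunc n (F N) = trunc n (F n)"
    using assms(1)[unfolded stable_def] assms(3) by blast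
  from arg_cong[OF this, of "\<lambda>f. icoeff f w"] show ?thesis
    using assms(2) by (simp add: icoeff_trunc)
qed

lemma stable_itends:
  fixes F :: "nat \<Rightarrow> 'x::ctag idalg"
  assumes "stable F"
  shows "\<exists>f. itends F f"
proof (rule itends_exI)
  fix w m assume "w \<in> weyl (ctype_of TYPE('x))"
  then obtain n where n: "w \<in> weyl_upto (ctype_of TYPE('x)) n" by (auto simp: weyl_def)
  have "icoeff (F N) w = icoeff (F n) w" if "N \<ge> n" for N
    using stable_icoeff[OF assms n that] .
  then have "\<forall>\<^sub>F N in sequentially. mcoeff (icoeff (F N) w) m = mcoeff (icoeff (F n) w) m"
    by (metis (mono_tags, lifting) eventually_sequentiallyI)
  then show "\<exists>z. \<forall>\<^sub>F N in sequentially. mcoeff (icoeff (F N) w) m = z" by blast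
qed

lemma stable_trunc_lim:
  fixes F :: "nat \<Rightarrow> 'x::ctag idalg"
  assumes "stable F" "itends F f"
  shows "trunc n f = trunc n (F n)"
proof (rule idalg_eqI)
  fix w
  show "icoeff (trunc n f) w = icoeff (trunc n (F n)) w"
  proof (cases "w \<in> weyl_upto (ctype_of TYPE('x)) n")
    case True
    have "icoeff (F N) w = icoeff (F n) w" if "N \<ge> n" for N
      using stable_icoeff[OF assms(1) True that] .
    then have ev: "\<forall>\<^sub>F N in sequentially. icoeff (F N) w = icoeff (F n) w"
      by (rule eventually_sequentiallyI)
    have "mtends (\<lambda>N. icoeff (F N) w) (icoeff (F n) w)"
      unfolding mtends_def using ev by (auto elim: eventually_mono)
    then have "icoeff f w = icoeff (F n) w"
      using assms(2) mtends_unique unfolding itends_def by blast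
    then show ?thesis by (simp add: icoeff_trunc)
  qed (simp add: icoeff_trunc)
qed

section \<open>Units and inverses of limits\<close>

definition iunit :: "'r::ring_1 \<Rightarrow> bool" where
  "iunit f \<longleftrightarrow> (\<exists>g. f * g = 1 \<and> g * f = 1)"

definition iinv :: "'r::ring_1 \<Rightarrow> 'r" where
  "iinv f = (SOME g. f * g = 1 \<and> g * f = 1)"

lemma iunitI: "f * g = 1 \<Longrightarrow> g * f = 1 \<Longrightarrow> iunit f"
  by (auto simp: iunit_def)

lemma iinv [simp]: "iunit f \<Longrightarrow> f * iinv f = 1" "iunit f \<Longrightarrow> iinv f * f = 1"
  unfolding iunit_def iinv_def by (metis (mono_tags, lifting) someI_ex)+

lemma iinv_mult [simp]: "iunit f \<Longrightarrow> f * (iinv f * g) = g" "iunit f \<Longrightarrow> iinv f * (f * g) = g"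
  by (simp_all add: mult.assoc[symmetric])

lemma iunit_cancel: "iunit f \<Longrightarrow> g * f = h * f \<longleftrightarrow> g = h"
  by (metis iinv(1) mult.assoc mult.right_neutral)

lemma iinv_unique: "iunit f \<Longrightarrow> f * g = 1 \<Longrightarrow> g = iinv f"
  by (metis iinv_mult(2) mult.right_neutral)

lemma iunit_1 [simp]: "iunit 1"
  by (rule iunitI[of _ 1]) auto

lemma iunit_mult: "iunit f \<Longrightarrow> iunit g \<Longrightarrow> iunit (f * g)"
  by (rule iunitI[of _ "iinv g * iinv f"]) (simp_all add: mult.assoc)

lemma iunit_prod_list: "(\<And>f. f \<in> set fs \<Longrightarrow> iunit f) \<Longrightarrow> iunit (prod_list fs)"
  by (induction fs) (auto intro: iunit_mult)

text \<open>Truncation is a ring homomorphism, so it takes inverses to inverses, and inverses are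
  unique.\<close>

lemma stable_iinv:
  assumes "stable F" "\<And>n. iunit (F n)"
  shows "stable (\<lambda>n. iinv (F n))"
  unfolding stable_def
proof (intro allI impI)
  fix n N :: nat assume "n \<le> N"
  then have eq: "trunc n (F N) = trunc n (F n)" using assms(1)[unfolded stable_def] by blast
  have "iunit (trunc n (F n))"
    by (rule iunitI[of _ "trunc n (iinv (F n))"]) (simp_all add: trunc_mult[symmetric] assms(2))
  moreover have "trunc n (F n) * trunc n (iinv (F n)) = 1"
    by (simp add: trunc_mult[symmetric] assms(2))
  moreover have "trunc n (F n) * trunc n (iinv (F N)) = 1"
    by (simp add: eq[symmetric] trunc_mult[symmetric] assms(2))
  ultimately show "trunc n (iinv (F N)) = trunc n (iinv (F n))"
    by (metis iinv_unique)
qed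

lemma iunit_lim:
  assumes "stable F" "\<And>n. iunit (F n)" "itends F f"
  shows "iunit f"
proof -
  obtain g where g: "itends (\<lambda>n. iinv (F n)) g"
    using stable_itends stable_iinv assms by blast
  have "itends (\<lambda>n. 1) (f * g)" "itends (\<lambda>n. 1) (g * f)"
    using itends_mult[OF assms(3) g] itends_mult[OF g assms(3)] assms(2) by simp_all
  then show ?thesis
    using itends_unique itends_const by (intro iunitI[of f g]) blast+
qed

lemma id_inverse_eq:
  fixes f :: "'x::ctag idalg"
  assumes "iunit f"
  shows "id_inverse (ctype_of TYPE('x)) (icoeff f) = icoeff (iinv f)"
  unfolding id_inverse_def
proof (rule the_equality)
  show "(\<forall>w. w \<notin> weyl (ctype_of TYPE('x)) \<longrightarrow> icoeff (iinv f) w = 0) \<and>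
      id_mult (ctype_of TYPE('x)) (icoeff f) (icoeff (iinv f)) = id_one \<and>
      id_mult (ctype_of TYPE('x)) (icoeff (iinv f)) (icoeff f) = id_one"
    using assms by (simp add: icoeff_outside icoeff_mult[symmetric] icoeff_1)
next
  fix g assume g: "(\<forall>w. w \<notin> weyl (ctype_of TYPE('x)) \<longrightarrow> g w = 0) \<and>
    id_mult (ctype_of TYPE('x)) (icoeff f) g = id_one \<and> id_mult (ctype_of TYPE('x)) g (icoeff f) = id_one"
  then have gi: "icoeff (Abs_idalg g :: 'x idalg) = g" by (intro icoeff_Abs) blast
  have "icoeff (f * Abs_idalg g) = icoeff (1 :: 'x idalg)"
    using g by (simp add: icoeff_mult gi icoeff_1)
  then have "f * Abs_idalg g = 1" by (simp add: icoeff_inject)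
  then have "Abs_idalg g = iinv f" using assms by (rule iinv_unique[rotated])
  then show "g = icoeff (iinv f)" using gi by simp
qed

section \<open>Endomorphisms acting on the coefficients of the algebra\<close>

context beta_hom
begin

definition imap :: "'x::ctag idalg \<Rightarrow> 'x idalg" where
  "imap f = Abs_idalg (\<lambda>w. \<phi> (icoeff f w))"

lemma icoeff_imap [simp]: "icoeff (imap f) w = \<phi> (icoeff f w)"
  by (simp add: imap_def icoeff_Abs icoeff_outside)

lemma imap_mult: "imap (f * g) = imap f * imap g"
  by (rule idalg_eqI) (simp add: icoeff_mult_eq hom_sum hom_mult hom_power case_prod_unfold)

lemma imap_add: "imap (f + g) = imap f + imap g"
  by (rule idalg_eqI) (simp add: hom_add)

lemma imap_1 [simp]: "imap 1 = 1"
  by (rule idalg_eqI) (simp add: icoeff_1 id_one_eq)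

lemma imap_prod_list: "imap (prod_list fs) = prod_list (map imap fs)"
  by (induction fs) (auto simp: imap_mult)

lemma imap_smul: "imap (r \<bullet> f) = \<phi> r \<bullet> imap f"
  by (rule idalg_eqI) (simp add: hom_mult)

lemma imap_ibasis [simp]: "v \<in> weyl (ctype_of TYPE('x)) \<Longrightarrow> imap (ibasis v :: 'x::ctag idalg) = ibasis v"
  by (rule idalg_eqI) (simp add: icoeff_ibasis)

lemma imap_hfac [simp]:
  "i \<in> gens (ctype_of TYPE('x)) \<Longrightarrow> imap (hfac i x :: 'x::ctag idalg) = hfac i (\<phi> x)"
  by (simp add: hfac_def imap_add imap_smul)

lemma imap_iinv: "iunit f \<Longrightarrow> imap (iinv f) = iinv (imap f)"
proof -
  assume f: "iunit f"
  have "imap f * imap (iinv f) = 1" "imap (iinv f) * imap f = 1"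
    using f by (simp_all add: imap_mult[symmetric])
  then show ?thesis using iinv_unique iunitI by blast
qed

lemma itends_imap:
  assumes "\<And>f g. mtends f g \<Longrightarrow> mtends (\<lambda>n. \<phi> (f n)) (\<phi> g)" "itends F f"
  shows "itends (\<lambda>n. imap (F n)) (imap f)"
  using assms by (simp add: itends_def)

end

lemma icoeff_prod_list:
  "icoeff (prod_list fs :: 'x::ctag idalg) = id_prod (ctype_of TYPE('x)) (map icoeff fs)"
  by (induction fs) (simp_all add: id_prod_def icoeff_1 icoeff_mult)

section \<open>The generating functions of finite rank and their limits\<close>

definition Afac :: "nat \<Rightarrow> nat \<Rightarrow> R \<Rightarrow> 'x::ctag idalg" where
  "Afac n i x = prod_list (map (\<lambda>j. hfac (Sgen j) x) (rev [i..<n]))"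

definition Gprod :: "nat \<Rightarrow> (nat \<Rightarrow> R) \<Rightarrow> 'x::ctag idalg" where
  "Gprod n a = prod_list (map (\<lambda>i. Afac n i (a i)) [1..<n])"

definition Ffac :: "nat \<Rightarrow> R \<Rightarrow> 'x::ctag idalg" where
  "Ffac n x = prod_list (map (\<lambda>i. hfac i x) (F_word (ctype_of TYPE('x)) n))"

text \<open>The rank n and the number k of x variables are separate, because s_0 and s_hat1 use up
  variables at fixed rank.\<close>

definition Fprod :: "nat \<Rightarrow> nat \<Rightarrow> (nat \<Rightarrow> R) \<Rightarrow> 'x::ctag idalg" where
  "Fprod n k x = prod_list (map (\<lambda>i. Ffac n (x i)) [1..<Suc k])"

lemma icoeff_Afac: "0 < i \<Longrightarrow> icoeff (Afac n i x :: 'x::ctag idalg) = A_elt (ctype_of TYPE('x)) n i x"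
  by (auto simp: Afac_def A_elt_def icoeff_prod_list o_def icoeff_hfac intro!: arg_cong[of _ _ "id_prod _"])

lemma icoeff_Gprod: "icoeff (Gprod n a :: 'x::ctag idalg) = G_fin (ctype_of TYPE('x)) n a"
  by (auto simp: Gprod_def G_fin_def icoeff_prod_list o_def icoeff_Afac intro!: arg_cong[of _ _ "id_prod _"])

lemma F_word_gens: "set (F_word X n) \<subseteq> gens X"
  by (cases X) auto

lemma icoeff_Ffac: "icoeff (Ffac n x :: 'x::ctag idalg) = F_one (ctype_of TYPE('x)) n x"
proof -
  have "icoeff (hfac i x :: 'x idalg) = h_elt i x" if "i \<in> set (F_word (ctype_of TYPE('x)) n)" for i
    using that F_word_gens by (intro icoeff_hfac) blast
  then show ?thesis
    unfolding Ffac_def F_one_def icoeff_prod_list map_map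
    by (intro arg_cong[of _ _ "id_prod _"] map_cong) auto
qed

lemma icoeff_Fprod: "icoeff (Fprod n n x :: 'x::ctag idalg) = F_fin (ctype_of TYPE('x)) n x"
  by (auto simp: Fprod_def F_fin_def icoeff_prod_list o_def icoeff_Ffac intro!: arg_cong[of _ _ "id_prod _"])

lemma Afac_Suc: "i \<le> n \<Longrightarrow> Afac (Suc n) i x = hfac (Sgen n) x * Afac n i x"
  by (simp add: Afac_def)

lemma Afac_ge [simp]: "n \<le> i \<Longrightarrow> Afac n i x = 1"
  by (simp add: Afac_def)

lemma Afac_rec: "i < n \<Longrightarrow> Afac n i x = Afac n (Suc i) x * hfac (Sgen i) x"
  by (simp add: Afac_def upt_rec[of i n])

lemma Sgen_gens_upto: "0 < i \<Longrightarrow> n \<le> i \<Longrightarrow> Sgen i \<notin> gens_upto X n"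
  by (cases X) auto

lemma trunc_hfac:
  assumes "0 < i" "n \<le> i"
  shows "trunc n (hfac (Sgen i) x :: 'x::ctag idalg) = 1"
proof (rule idalg_eqI)
  fix w
  have "gperm (Sgen i) \<notin> weyl_upto (ctype_of TYPE('x)) n"
    using assms reduced_weyl_upto_iff[OF reduced_single[of "Sgen i" "ctype_of TYPE('x)"], of n]
      Sgen_gens_upto[of i n] by simp
  then show "icoeff (trunc n (hfac (Sgen i) x :: 'x idalg)) w = icoeff (1 :: 'x idalg) w"
    using assms by (auto simp: icoeff_trunc icoeff_hfac h_elt_def icoeff_1 id_basis_def id_one_eq simp del: id_apply)
qed

lemma trunc_Afac_Suc: "n \<le> N \<Longrightarrow> 0 < i \<Longrightarrow> trunc n (Afac (Suc N) i x) = trunc n (Afac N i x)"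
  by (cases "i \<le> N") (simp_all add: Afac_Suc trunc_mult trunc_hfac)

lemma trunc_Gprod_Suc: "n \<le> N \<Longrightarrow> trunc n (Gprod (Suc N) a) = trunc n (Gprod N a)"
proof (cases "N = 0")
  case False
  assume "n \<le> N"
  then show ?thesis
    using False
    by (auto simp: Gprod_def trunc_prod_list trunc_mult trunc_Afac_Suc o_def intro!: arg_cong[of _ _ prod_list])
qed (simp add: Gprod_def)

lemma stable_Gprod: "stable (\<lambda>n. Gprod n a)"
  unfolding stable_def
proof (intro allI impI)
  fix n N :: nat assume "n \<le> N"
  then show "trunc n (Gprod N a) = trunc n (Gprod n a)"
    by (induction N rule: dec_induct) (simp_all add: trunc_Gprod_Suc)
qed

lemma iunit_hfac: "i \<in> gens (ctype_of TYPE('x)) \<Longrightarrow> good x \<Longrightarrow> iunit (hfac i x :: 'x::ctag idalg)"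
  using hfac_bar iunitI by blast

lemma iunit_Afac: "good x \<Longrightarrow> 0 < i \<Longrightarrow> iunit (Afac n i x)"
  unfolding Afac_def by (rule iunit_prod_list) (auto intro!: iunit_hfac)

lemma iunit_Gprod: "(\<And>i. good (a i)) \<Longrightarrow> iunit (Gprod n a)"
  unfolding Gprod_def by (rule iunit_prod_list) (auto intro!: iunit_Afac)

definition Glim :: "(nat \<Rightarrow> R) \<Rightarrow> 'x::ctag idalg" where
  "Glim a = (SOME f. itends (\<lambda>n. Gprod n a) f)"

lemma itends_Glim: "itends (\<lambda>n. Gprod n a) (Glim a)"
  unfolding Glim_def using stable_itends[OF stable_Gprod] by (rule someI_ex)

lemma iunit_Glim: "(\<And>i. good (a i)) \<Longrightarrow> iunit (Glim a)"
  using iunit_lim[OF stable_Gprod _ itends_Glim] iunit_Gprod by blast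

text \<open>In type D the words for n = 1 and n = 2 coincide, so the recursion starts at 2.\<close>

lemma F_word_Suc:
  assumes "2 \<le> n" "X \<noteq> TypeA"
  shows "F_word X (Suc n) = Sgen n # F_word X n @ [Sgen n]"
  using assms by (cases X) auto

lemma trunc_Ffac:
  assumes "2 \<le> n" "n \<le> N"
  shows "trunc n (Ffac N x :: 'x::ctag idalg) = trunc n (Ffac n x)"
  using assms(2)
proof (induction N rule: dec_induct)
  case (step N)
  show ?case
  proof (cases "ctype_of TYPE('x) = TypeA")
    case False
    then have "Ffac (Suc N) x = hfac (Sgen N) x * (Ffac N x * hfac (Sgen N) x :: 'x idalg)"
      using assms step by (simp add: Ffac_def F_word_Suc)
    then show ?thesis
      using assms step by (simp add: trunc_mult trunc_hfac)
  qed (use step in \<open>simp add: Ffac_def\<close>)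
qed simp

lemma trunc_Fprod:
  assumes "2 \<le> n" "n \<le> N"
  shows "trunc n (Fprod N k x) = trunc n (Fprod n k x)"
  using assms
  by (simp add: Fprod_def trunc_prod_list trunc_Ffac[OF assms] o_def del: upt_Suc)

lemma (in beta_hom) imap_Ffac: "imap (Ffac n x :: 'x::ctag idalg) = Ffac n (\<phi> x)"
  unfolding Ffac_def imap_prod_list map_map o_def
  using F_word_gens[of "ctype_of TYPE('x)" n] by (intro arg_cong[of _ _ prod_list] map_cong) auto

lemma (in beta_hom) imap_Fprod: "imap (Fprod n k x) = Fprod n k (\<lambda>i. \<phi> (x i))"
  unfolding Fprod_def imap_prod_list map_map o_def imap_Ffac ..

lemma (in beta_hom) imap_Afac: "0 < i \<Longrightarrow> imap (Afac n i x) = Afac n i (\<phi> x)"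
  unfolding Afac_def imap_prod_list map_map o_def
  by (intro arg_cong[of _ _ prod_list] map_cong) auto

lemma (in beta_hom) imap_Gprod: "imap (Gprod n a) = Gprod n (\<lambda>i. \<phi> (a i))"
  unfolding Gprod_def imap_prod_list map_map o_def
  by (intro arg_cong[of _ _ prod_list] map_cong) (auto simp: imap_Afac)

lemma Ffac_0 [simp]: "Ffac n 0 = 1"
proof -
  have "prod_list (map (\<lambda>_. 1) p) = (1 :: 'a idalg)" for p :: "gen list"
    by (induction p) auto
  then show ?thesis by (simp add: Ffac_def)
qed

lemma Fprod_0: "Fprod n k (\<lambda>_. 0) = 1"
  unfolding Fprod_def Ffac_0 by (induction k) auto

lemma Fprod_drop:
  assumes "M \<le> K"
  shows "Fprod n K (\<lambda>i. if i \<le> M then x i else 0) = Fprod n M x"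
  using assms
proof (induction K rule: dec_induct)
  case base
  show ?case
    unfolding Fprod_def by (intro arg_cong[of _ _ prod_list] map_cong) auto
next
  case (step K)
  then show ?case by (simp add: Fprod_def)
qed

text \<open>Truncation lowers the rank from N to n. A monomial whose x variables have index at most
  M is not affected by setting the later x_j to 0, which turns their factors into 1.\<close>

lemma mcoeff_Fprod:
  fixes n M :: nat and w m
  defines "z \<equiv> mcoeff (icoeff (Fprod n M xvar :: 'x::ctag idalg) w) m"
  assumes "2 \<le> n" "n \<le> N" "M \<le> K" "w \<in> weyl_upto (ctype_of TYPE('x)) n"
    "\<And>j. VX j \<in> Poly_Mapping.keys m \<Longrightarrow> j \<le> M"
  shows "mcoeff (icoeff (Fprod N K xvar :: 'x idalg) w) m = z"
proof -
  define V where "V = {VX j |j. M < j}"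
  interpret beta_hom "mdrop V" by (rule beta_hom_mdrop)
  have V: "Poly_Mapping.keys m \<inter> V = {}"
    using assms(6) by (fastforce simp: V_def)
  have "icoeff (Fprod N K xvar :: 'x idalg) w = icoeff (trunc n (Fprod N K xvar :: 'x idalg)) w"
    using assms by (simp add: icoeff_trunc)
  also have "\<dots> = icoeff (Fprod n K xvar :: 'x idalg) w"
    using assms(5) by (simp add: trunc_Fprod[OF assms(2,3)] icoeff_trunc)
  finally have "mcoeff (icoeff (Fprod N K xvar :: 'x idalg) w) m =
      mcoeff (mdrop V (icoeff (Fprod n K xvar :: 'x idalg) w)) m"
    using V by (simp add: mdrop_def)
  also have "mdrop V (icoeff (Fprod n K xvar :: 'x idalg) w) =
      icoeff (imap (Fprod n K xvar) :: 'x idalg) w"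
    by simp
  also have "(imap (Fprod n K xvar) :: 'x idalg) = Fprod n K (\<lambda>i. if i \<le> M then xvar i else 0)"
  proof -
    have "(\<lambda>i. mdrop V (xvar i)) = (\<lambda>i. if i \<le> M then xvar i else 0)"
      by (auto simp: mdrop_mvar V_def)
    then show ?thesis by (simp add: imap_Fprod)
  qed
  also have "\<dots> = Fprod n M xvar"
    using assms by (intro Fprod_drop)
  finally show ?thesis by (simp add: z_def)
qed

text \<open>The value z is chosen before K: the limit does not depend on how the number of variables
  grows, so n, n-1 and n-2 variables lead to the same element.\<close>

lemma Fprod_eventually:
  fixes w m
  assumes "w \<in> weyl (ctype_of TYPE('x::ctag))"
  shows "\<exists>z. \<forall>K. filterlim K at_top sequentially \<longrightarrow>
    (\<forall>\<^sub>F N in sequentially. mcoeff (icoeff (Fprod N (K N) xvar :: 'x idalg) w) m = z)"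
proof -
  obtain n0 where "w \<in> weyl_upto (ctype_of TYPE('x)) n0"
    using assms by (auto simp: weyl_def)
  then have w: "w \<in> weyl_upto (ctype_of TYPE('x)) (max 2 n0)"
    using weyl_upto_mono[of n0 "max 2 n0" "ctype_of TYPE('x)"] by auto
  define M where "M = Max (insert 0 (vindex ` Poly_Mapping.keys m))"
  have M: "j \<le> M" if "VX j \<in> Poly_Mapping.keys m" for j
    using imageI[OF that, of vindex] unfolding M_def by (intro Max_ge) auto
  have "\<forall>\<^sub>F N in sequentially. mcoeff (icoeff (Fprod N (K N) xvar :: 'x idalg) w) m =
      mcoeff (icoeff (Fprod (max 2 n0) M xvar :: 'x idalg) w) m"
    if "filterlim K at_top sequentially" for K
  proof -
    have "\<forall>\<^sub>F N in sequentially. M \<le> K N"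
      using that by (simp add: filterlim_at_top)
    with eventually_ge_at_top[of "max 2 n0"] show ?thesis
      by eventually_elim (rule mcoeff_Fprod, use w M in auto)
  qed
  then show ?thesis by blast
qed

definition Flim :: "'x::ctag idalg" where
  "Flim = (SOME f. itends (\<lambda>N. Fprod N N xvar) f)"

lemma itends_Flim:
  assumes "filterlim K at_top sequentially"
  shows "itends (\<lambda>N. Fprod N (K N) xvar) (Flim :: 'x::ctag idalg)"
proof -
  have id: "filterlim (\<lambda>N. N) at_top (sequentially :: nat filter)"
    by (rule filterlim_ident)
  have "\<exists>f. itends (\<lambda>N. Fprod N N xvar :: 'x idalg) f"
    by (rule itends_exI) (use Fprod_eventually id in blast)
  then have F: "itends (\<lambda>N. Fprod N N xvar) (Flim :: 'x idalg)"
    unfolding Flim_def by (rule someI_ex)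
  show ?thesis
    unfolding itends_def mtends_def
  proof (intro allI)
    fix w m
    show "\<forall>\<^sub>F N in sequentially. mcoeff (icoeff (Fprod N (K N) xvar :: 'x idalg) w) m =
      mcoeff (icoeff (Flim :: 'x idalg) w) m"
    proof (cases "w \<in> weyl (ctype_of TYPE('x))")
      case True
      then obtain z where z: "\<And>K. filterlim K at_top sequentially \<Longrightarrow>
          \<forall>\<^sub>F N in sequentially. mcoeff (icoeff (Fprod N (K N) xvar :: 'x idalg) w) m = z"
        using Fprod_eventually by blast
      have "\<forall>\<^sub>F N in sequentially. mcoeff (icoeff (Fprod N N xvar :: 'x idalg) w) m =
          mcoeff (icoeff (Flim :: 'x idalg) w) m"
        using F by (simp add: itends_def mtends_def)
      with z[OF id] have "\<forall>\<^sub>F N :: nat in sequentially. z = mcoeff (icoeff (Flim :: 'x idalg) w) m"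
        by eventually_elim simp
      then show ?thesis using z[OF assms] by simp
    qed (simp add: icoeff_outside)
  qed
qed

text \<open>One formula for all four types. In type A the factor F is 1, and every admissible n
  yields the coefficient of the limit, so the definite description is justified.\<close>

lemma grothendieck_eq:
  fixes a b :: "nat \<Rightarrow> R" and w
  defines "X \<equiv> ctype_of TYPE('x::ctag)"
  assumes b: "\<And>i. good (b i)" and w: "w \<in> weyl X"
  shows "grothendieck X a b xvar w =
    icoeff (iinv (Glim (\<lambda>i. bar (b i))) * (Flim * Glim a) :: 'x idalg) w"
proof -
  let ?b = "\<lambda>i. bar (b i)"
  have gb: "good (?b i)" for i using b by simp
  have Ginf: "G_inf X a = icoeff (Glim a :: 'x idalg)" for a
    unfolding G_inf_def X_def icoeff_Gprod[symmetric] by (rule id_lim_eq[OF itends_Glim])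
  have Finf: "F_inf X xvar = icoeff (Flim :: 'x idalg)"
    unfolding F_inf_def X_def icoeff_Fprod[symmetric]
    by (rule id_lim_eq) (intro itends_Flim filterlim_ident)
  show ?thesis
  proof (cases "X = TypeA")
    case False
    then show ?thesis
      using gb by (simp add: grothendieck_def Ginf[unfolded X_def] Finf[unfolded X_def] X_def
          id_inverse_eq iunit_Glim icoeff_mult)
  next
    case True
    then have TA: "TypeA = ctype_of TYPE('x)" by (simp add: X_def)
    have "Ffac n x = (1 :: 'x idalg)" for n x
      using True by (simp add: Ffac_def X_def)
    then have "Fprod n k x = (1 :: 'x idalg)" for n k x
      unfolding Fprod_def by (induction k) auto
    then have "itends (\<lambda>N. 1) (Flim :: 'x idalg)"
      using itends_Flim[OF filterlim_ident, where ?'x = 'x] by simp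
    then have F: "(Flim :: 'x idalg) = 1"
      by (rule itends_unique) simp
    have "id_mult TypeA (id_inverse TypeA (G_fin TypeA n ?b)) (G_fin TypeA n a) w =
        icoeff (iinv (Glim ?b) * Glim a :: 'x idalg) w" if n: "w \<in> weyl_upto TypeA n" for n
    proof -
      have "id_mult TypeA (id_inverse TypeA (G_fin TypeA n ?b)) (G_fin TypeA n a) =
          icoeff (iinv (Gprod n ?b) * Gprod n a :: 'x idalg)"
        unfolding TA using gb
        by (simp add: icoeff_Gprod[symmetric] id_inverse_eq iunit_Gprod icoeff_mult)
      then have "id_mult TypeA (id_inverse TypeA (G_fin TypeA n ?b)) (G_fin TypeA n a) w =
          icoeff (trunc n (iinv (Gprod n ?b) * Gprod n a :: 'x idalg)) w"
        using n TA by (simp add: icoeff_trunc)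
      \<comment> \<open>The inverse of the limit is the limit of the inverses; both sequences are
        stable, so their limits truncate to the n-th terms.\<close>
      also have "trunc n (iinv (Gprod n ?b) * Gprod n a :: 'x idalg) = trunc n (iinv (Glim ?b) * Glim a)"
      proof -
        have st: "stable (\<lambda>n. iinv (Gprod n ?b) :: 'x idalg)"
          by (intro stable_iinv stable_Gprod iunit_Gprod gb)
        then obtain g :: "'x idalg" where g: "itends (\<lambda>n. iinv (Gprod n ?b)) g"
          using stable_itends by blast
        have "itends (\<lambda>n. 1 :: 'x idalg) (Glim ?b * g)"
          using itends_mult[OF itends_Glim[of ?b] g] by (simp add: iunit_Gprod gb)
        then have "Glim ?b * g = 1"
          using itends_unique itends_const by blast
        then have "g = iinv (Glim ?b)"
          by (intro iinv_unique iunit_Glim gb)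
        moreover have "trunc n (Glim a :: 'x idalg) = trunc n (Gprod n a)"
          by (rule stable_trunc_lim[OF stable_Gprod itends_Glim])
        ultimately show ?thesis
          using stable_trunc_lim[OF st g, of n] by (simp add: trunc_mult)
      qed
      finally show ?thesis using n TA by (simp add: icoeff_trunc)
    qed
    moreover obtain n where "w \<in> weyl_upto TypeA n"
      using w True by (auto simp: weyl_def)
    ultimately have "(THE z. \<forall>n. w \<in> weyl_upto TypeA n \<longrightarrow>
        z = id_mult TypeA (id_inverse TypeA (G_fin TypeA n ?b)) (G_fin TypeA n a) w) =
        icoeff (iinv (Glim ?b) * Glim a :: 'x idalg) w"
      by (intro the_equality) auto
    then show ?thesis using True by (simp add: grothendieck_def F)
  qed
qed

section \<open>Exchange relations for the factors\<close>

lemma prod_list_commute: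
  fixes g :: "'r::monoid_mult"
  shows "(\<And>f. f \<in> set fs \<Longrightarrow> g * f = f * g) \<Longrightarrow> g * prod_list fs = prod_list fs * g"
proof (induction fs)
  case (Cons f fs)
  have "g * (f * prod_list fs) = f * (g * prod_list fs)"
    using Cons.prems[of f] by (simp add: mult.assoc[symmetric])
  also have "\<dots> = f * (prod_list fs * g)"
    using Cons by simp
  finally show ?case by (simp add: mult.assoc)
qed simp

lemma prod_list_inverse:
  fixes f g :: "'a \<Rightarrow> 'r::monoid_mult"
  shows "(\<And>j. j \<in> set xs \<Longrightarrow> f j * g j = 1) \<Longrightarrow>
    prod_list (map f xs) * prod_list (map g (rev xs)) = 1"
proof (induction xs)
  case (Cons x xs)
  have "prod_list (map f (x # xs)) * prod_list (map g (rev (x # xs))) =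
      f x * (prod_list (map f xs) * prod_list (map g (rev xs))) * g x"
    by (simp add: mult.assoc)
  then show ?case using Cons by simp
qed simp

abbreviation ominus :: "R \<Rightarrow> R \<Rightarrow> R" where "ominus x y \<equiv> oplus x (bar y)"

lemma oplus_ominus [simp]: "good y \<Longrightarrow> oplus (ominus x y) y = x" "good y \<Longrightarrow> oplus y (ominus x y) = x"
proof -
  assume y: "good y"
  then show "oplus (ominus x y) y = x"
    by (simp add: oplus_assoc oplus_commute[of "bar y"])
  then show "oplus y (ominus x y) = x"
    by (simp add: oplus_commute)
qed

lemma hfac_Afac_commute:
  assumes "g \<in> gens (ctype_of TYPE('x::ctag))" "0 < j"
    and "\<And>k. j \<le> k \<Longrightarrow> g \<noteq> Sgen k \<and> braided 2 g (Sgen k)"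
  shows "hfac g x * Afac n j y = (Afac n j y * hfac g x :: 'x idalg)"
  unfolding Afac_def
proof (rule prod_list_commute)
  fix f :: "'x idalg" assume "f \<in> set (map (\<lambda>j. hfac (Sgen j) y) (rev [j..<n]))"
  then obtain k where "j \<le> k" "f = hfac (Sgen k) y" by auto
  then show "hfac g x * f = f * hfac g x"
    using assms(3)[of k] assms(1,2) by (auto intro!: hfac_commute)
qed

lemma hfac_prod_Afac_commute:
  assumes "g \<in> gens (ctype_of TYPE('x::ctag))" "0 < j"
    and "\<And>k. j \<le> k \<Longrightarrow> g \<noteq> Sgen k \<and> braided 2 g (Sgen k)"
  shows "hfac g x * prod_list (map (\<lambda>i. Afac n i (a i)) [j..<n]) =
    (prod_list (map (\<lambda>i. Afac n i (a i)) [j..<n]) * hfac g x :: 'x idalg)"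
proof (rule prod_list_commute)
  fix f :: "'x idalg" assume "f \<in> set (map (\<lambda>i. Afac n i (a i)) [j..<n])"
  then obtain i where i: "j \<le> i" "f = Afac n i (a i)" by auto
  show "hfac g x * f = f * hfac g x"
    unfolding i(2)
  proof (rule hfac_Afac_commute)
    show "g \<noteq> Sgen k \<and> braided 2 g (Sgen k)" if "i \<le> k" for k
      using assms(3)[of k] that i(1) by simp
  qed (use assms i in auto)
qed

text \<open>Prolongs the exchange relation by one letter g attached to s_j. It is stated for general
  g because it is used twice: g = s_(j-1) prolongs A_j to A_(j-1), and g = \<open>Hat1\<close> with
  j = 2 gives the branch that occurs in type D.\<close>

lemma Afac_swap_step:
  fixes g defines "H \<equiv> (hfac :: gen \<Rightarrow> R \<Rightarrow> 'x::ctag idalg)"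
  assumes g: "g \<in> gens (ctype_of TYPE('x))" and j: "0 < j" and "braided 3 (Sgen j) g" "Sgen j \<noteq> g"
    and comm: "\<And>k. j < k \<Longrightarrow> g \<noteq> Sgen k \<and> braided 2 g (Sgen k)"
    and swap: "j < n \<Longrightarrow> Afac n j x * Afac n (Suc j) y = Afac n j y * Afac n (Suc j) x * H (Sgen j) (ominus x y)"
    and y: "good y"
  shows "(Afac n j x * H g x) * Afac n j y = (Afac n j y * H g y) * Afac n j x * H g (ominus x y)"
proof (cases "j < n")
  case False
  then show ?thesis using g y by (simp add: H_def hfac_mult)
next
  case True
  have c: "hfac g z * Afac n (Suc j) z' = (Afac n (Suc j) z' * hfac g z :: 'x idalg)" for z z'
    using g comm by (intro hfac_Afac_commute) auto
  \<comment> \<open>The Yang-Baxter relation with parameters x \<ominus> y and y, whose sum, the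
    middle parameter, is x.\<close>
  have yb: "hfac (Sgen j) (ominus x y) * hfac g x * hfac (Sgen j) y =
      (hfac g y * hfac (Sgen j) x * hfac g (ominus x y) :: 'x idalg)"
    using hfac_yang_baxter_3[of "Sgen j" g "ominus x y" y, where ?'x = 'x] assms by simp
  have "(Afac n j x * H g x) * Afac n j y = Afac n j x * (H g x * Afac n (Suc j) y) * H (Sgen j) y"
    using True by (simp add: H_def Afac_rec[of j n y] mult.assoc)
  also have "\<dots> = (Afac n j x * Afac n (Suc j) y) * H g x * H (Sgen j) y"
    by (simp add: H_def c mult.assoc)
  also have "\<dots> = Afac n j y * Afac n (Suc j) x * (H (Sgen j) (ominus x y) * H g x * H (Sgen j) y)"
    by (simp add: swap[OF True] mult.assoc)
  also have "\<dots> = Afac n j y * (Afac n (Suc j) x * H g y) * H (Sgen j) x * H g (ominus x y)"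
    by (simp add: H_def yb[unfolded mult.assoc] mult.assoc)
  also have "\<dots> = (Afac n j y * H g y) * (Afac n (Suc j) x * H (Sgen j) x) * H g (ominus x y)"
    by (simp add: H_def c[symmetric] mult.assoc)
  finally show ?thesis
    using True by (simp add: H_def Afac_rec[of j n x])
qed

lemma braided_Sgen_far: "0 < i \<Longrightarrow> Suc i < k \<Longrightarrow> braided 2 (Sgen i) (Sgen k)"
  using braided_Sgen[of i k] by simp

lemma braided_0_far: "2 \<le> k \<Longrightarrow> braided 2 (Sgen 0) (Sgen k)"
  using braided_Sgen[of 0 k] by simp

text \<open>Since A_i is A_(i+1) followed by h_i, the case i follows from the case i+1. Neighbouring
  A factors are thus symmetric up to one h_i, which is the source of the action of s_i on G.\<close>

lemma Afac_swap:
  assumes "0 < i" "i < n" "good y"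
  shows "Afac n i x * Afac n (Suc i) y =
    (Afac n i y * Afac n (Suc i) x * hfac (Sgen i) (ominus x y) :: 'x::ctag idalg)"
  using assms
proof (induction "n - i" arbitrary: i rule: less_induct)
  case less
  have "(Afac n (Suc i) x * hfac (Sgen i) x) * Afac n (Suc i) y =
      ((Afac n (Suc i) y * hfac (Sgen i) y) * Afac n (Suc i) x * hfac (Sgen i) (ominus x y) :: 'x idalg)"
  proof (rule Afac_swap_step)
    show "braided 3 (Sgen (Suc i)) (Sgen i)"
      using braided_Sgen[of i "Suc i"] less.prems braided_commute by auto
    show "Afac n (Suc i) x * Afac n (Suc (Suc i)) y =
        (Afac n (Suc i) y * Afac n (Suc (Suc i)) x * hfac (Sgen (Suc i)) (ominus x y) :: 'x idalg)"
      if "Suc i < n"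
      using that less.prems by (intro less.hyps) auto
  qed (use less.prems in \<open>auto intro: braided_Sgen_far\<close>)
  then show ?case
    using less.prems by (simp add: Afac_rec[of i n])
qed

lemma Gprod_split:
  assumes "0 < i" "Suc i < n"
  shows "Gprod n a = prod_list (map (\<lambda>j. Afac n j (a j)) [1..<i]) *
    (Afac n i (a i) * Afac n (Suc i) (a (Suc i))) * prod_list (map (\<lambda>j. Afac n j (a j)) [Suc (Suc i)..<n])"
proof -
  have "[1..<n] = [1..<i] @ [i..<n]"
    using assms by (metis One_nat_def Suc_leI less_imp_le_nat Suc_lessD le_add_diff_inverse upt_add_eq_append)
  also have "[i..<n] = i # Suc i # [Suc (Suc i)..<n]"
    using assms by (simp add: upt_conv_Cons)
  finally show ?thesis by (simp add: Gprod_def mult.assoc)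
qed

lemma Gprod_swap:
  assumes "0 < i" "Suc i < n" "good (a (Suc i))"
  shows "Gprod n a = (Gprod n (\<lambda>j. a (Transposition.transpose i (Suc i) j)) *
    hfac (Sgen i) (ominus (a i) (a (Suc i))) :: 'x::ctag idalg)"
proof -
  let ?a = "\<lambda>j. a (Transposition.transpose i (Suc i) j)" and ?h = "hfac (Sgen i) (ominus (a i) (a (Suc i))) :: 'x idalg"
  have "prod_list (map (\<lambda>j. Afac n j (?a j)) [1..<i]) = (prod_list (map (\<lambda>j. Afac n j (a j)) [1..<i]) :: 'x idalg)"
    by (intro arg_cong[of _ _ prod_list] map_cong) auto
  moreover have "prod_list (map (\<lambda>j. Afac n j (?a j)) [Suc (Suc i)..<n]) =
      (prod_list (map (\<lambda>j. Afac n j (a j)) [Suc (Suc i)..<n]) :: 'x idalg)"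
    by (intro arg_cong[of _ _ prod_list] map_cong) (auto simp: transpose_def)
  moreover have "?h * prod_list (map (\<lambda>j. Afac n j (a j)) [Suc (Suc i)..<n]) =
      prod_list (map (\<lambda>j. Afac n j (a j)) [Suc (Suc i)..<n]) * ?h"
    using assms by (intro hfac_prod_Afac_commute) (auto intro: braided_Sgen_far)
  ultimately show ?thesis
    using assms by (simp add: Gprod_split[of i n] Afac_swap[of i n "a (Suc i)" "a i"] mult.assoc)
qed

lemma Afac_reverse:
  assumes "0 < i" "good x"
  shows "prod_list (map (\<lambda>j. hfac (Sgen j) x) [i..<n]) * Afac n i (bar x) = (1 :: 'x::ctag idalg)"
  unfolding Afac_def by (rule prod_list_inverse) (use assms in \<open>auto intro!: hfac_bar(1)\<close>)

section \<open>The factors F(x) and their commutation\<close>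

text \<open>The parameter of the middle factor of F(x): h_0(x)^2 = h_0(x \<oplus> x) in type
  C.\<close>

definition zpar :: "ctype \<Rightarrow> R \<Rightarrow> R" where
  "zpar X x = (if X = TypeC then oplus x x else x)"

text \<open>The right half of F(x) is the reversed product of A_1(x), hence inverse to A_1(bar
  x).\<close>

lemma Ffac_Afac_BC:
  assumes "ctype_of TYPE('x::ctag) = TypeB \<or> ctype_of TYPE('x) = TypeC" "good x"
  shows "Ffac n x * Afac n 1 (bar x) =
    (Afac n 1 x * hfac (Sgen 0) (zpar (ctype_of TYPE('x)) x) :: 'x idalg)"
proof -
  have "Ffac n x = (Afac n 1 x * hfac (Sgen 0) (zpar (ctype_of TYPE('x)) x) *
      prod_list (map (\<lambda>j. hfac (Sgen j) x) [1..<n]) :: 'x idalg)"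
    using assms by (auto simp: Ffac_def Afac_def zpar_def o_def mult.assoc hfac_mult[symmetric])
  then show ?thesis
    using Afac_reverse[of 1 x n, where ?'x = 'x] assms by (simp add: mult.assoc)
qed

text \<open>The index is 2 on the left because the right half of the type D word begins with s_2;
  the s_1 in its middle belongs to A_1(x).\<close>

lemma Ffac_Afac_D:
  assumes "ctype_of TYPE('x::ctag) = TypeD" "good x" "2 \<le> n"
  shows "Ffac n x * Afac n 2 (bar x) = (Afac n 1 x * hfac Hat1 x :: 'x idalg)"
proof -
  have "Ffac n x = (Afac n 1 x * hfac Hat1 x *
      prod_list (map (\<lambda>j. hfac (Sgen j) x) [2..<n]) :: 'x idalg)"
    using assms Afac_rec[of 1 n x, where ?'a = 'x]
    by (simp add: Ffac_def Afac_def o_def mult.assoc numeral_2_eq_2)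
  then show ?thesis
    using Afac_reverse[of 2 x n, where ?'x = 'x] assms by (simp add: mult.assoc)
qed

text \<open>The unit A_1(bar y) A_2(bar x) strips F(x) F(y) down to a word in h_0 and h_1 behind two
  A factors; there commutation becomes a statement about the dihedral group of s_0 and s_1.\<close>

lemma Ffac_pair_BC:
  fixes X defines "X \<equiv> ctype_of TYPE('x::ctag)"
  assumes X: "X = TypeB \<or> X = TypeC" and n: "2 \<le> n" and xy: "good x" "good y"
  shows "Ffac n x * Ffac n y * (Afac n 1 (bar y) * Afac n 2 (bar x)) =
    (Afac n 1 x * Afac n 2 y * (hfac (Sgen 0) (zpar X x) * hfac (Sgen 1) (oplus x y) * hfac (Sgen 0) (zpar X y)) :: 'x idalg)"
proof -
  let ?A = "Afac n :: nat \<Rightarrow> R \<Rightarrow> 'x idalg" and ?h = "hfac :: gen \<Rightarrow> R \<Rightarrow> 'x idalg"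
  have F: "Ffac n z * ?A 1 (bar z) = ?A 1 z * ?h (Sgen 0) (zpar X z)" if "good z" for z
    using Ffac_Afac_BC[of z n, where ?'x = 'x] X that by (simp add: X_def)
  have c: "?h (Sgen 0) z * ?A 2 z' = ?A 2 z' * ?h (Sgen 0) z" for z z'
    using X by (intro hfac_Afac_commute) (auto simp: X_def braided_0_far)
  have sw: "?A 1 y * ?A 2 (bar x) = ?A 1 (bar x) * ?A 2 y * ?h (Sgen 1) (oplus x y)"
    using Afac_swap[of 1 n "bar x" y, where ?'x = 'x] n xy
    by (simp add: numeral_2_eq_2 oplus_commute)
  have "Ffac n x * Ffac n y * (?A 1 (bar y) * ?A 2 (bar x)) =
      Ffac n x * (Ffac n y * ?A 1 (bar y)) * ?A 2 (bar x)"
    by (simp add: mult.assoc del: One_nat_def)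
  also have "\<dots> = Ffac n x * (?A 1 y * ?A 2 (bar x)) * ?h (Sgen 0) (zpar X y)"
    by (simp add: F[OF xy(2)] c mult.assoc del: One_nat_def)
  also have "\<dots> = (Ffac n x * ?A 1 (bar x)) * ?A 2 y * ?h (Sgen 1) (oplus x y) * ?h (Sgen 0) (zpar X y)"
    by (simp only: sw mult.assoc)
  also have "\<dots> = ?A 1 x * (?h (Sgen 0) (zpar X x) * ?A 2 y) * ?h (Sgen 1) (oplus x y) * ?h (Sgen 0) (zpar X y)"
    by (simp add: F[OF xy(1)] mult.assoc del: One_nat_def)
  finally show ?thesis by (simp add: c mult.assoc del: One_nat_def)
qed

text \<open>The hypothesis \<open>eq\<close> of \<open>hfac_yang_baxter_4\<close>; writing y as x
  \<oplus> s keeps it polynomial.\<close>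

lemma zpar_identity:
  fixes x s :: R
  defines "y \<equiv> oplus x s"
  shows "oplus x y * zpar X y = zpar X x * oplus x y + zpar X x * s + zpar X y * s
    + beta * (zpar X x * oplus x y * s + zpar X x * zpar X y * s)"
  by (cases "X = TypeC") (simp_all add: y_def zpar_def oplus_def algebra_simps)

text \<open>Both orders are multiplied by the same unit A_1(bar y) A_2(bar x). For one of them the
  unit is first reordered, at the cost of an h_1 with parameter x \<ominus> y; the Yang-Baxter
  relation of length four produces the inverse h_1 that cancels it.\<close>

lemma Ffac_commute_BC:
  fixes X defines "X \<equiv> ctype_of TYPE('x::ctag)"
  assumes X: "X = TypeB \<or> X = TypeC" and n: "2 \<le> n" and xy: "good x" "good y"
  shows "Ffac n x * Ffac n y = (Ffac n y * Ffac n x :: 'x idalg)"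
proof -
  let ?A = "Afac n :: nat \<Rightarrow> R \<Rightarrow> 'x idalg" and ?h = "hfac :: gen \<Rightarrow> R \<Rightarrow> 'x idalg"
  let ?hz = "\<lambda>z. ?h (Sgen 0) (zpar X z)"
  let ?s = "ominus y x" and ?t = "ominus x y"
  have sw: "?A 1 (bar y) * ?A 2 (bar x) = ?A 1 (bar x) * ?A 2 (bar y) * ?h (Sgen 1) ?t"
    using Afac_swap[of 1 n "bar x" "bar y", where ?'x = 'x] n xy
    by (simp add: numeral_2_eq_2 oplus_commute)
  have sw': "?A 1 y * ?A 2 x = ?A 1 x * ?A 2 y * ?h (Sgen 1) ?s"
    using Afac_swap[of 1 n x y, where ?'x = 'x] n xy by (simp add: numeral_2_eq_2)
  have yb: "?hz x * ?h (Sgen 1) (oplus x y) * ?hz y * ?h (Sgen 1) ?s =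
      ?h (Sgen 1) ?s * ?hz y * ?h (Sgen 1) (oplus x y) * ?hz x"
  proof (rule hfac_yang_baxter_4)
    show "oplus x y * zpar X y = zpar X x * oplus x y + zpar X x * ?s + zpar X y * ?s
        + beta * (zpar X x * oplus x y * ?s + zpar X x * zpar X y * ?s)"
      using zpar_identity[of x ?s X] xy by simp
    show "braided 4 (Sgen 0) (Sgen 1)" by (rule braided_4)
  qed (use X in \<open>auto simp: X_def\<close>)
  have st: "?h (Sgen 1) ?s * ?h (Sgen 1) ?t = 1"
  proof -
    have "oplus ?s ?t = oplus (oplus y (bar y)) (oplus x (bar x))"
      by (metis oplus_assoc oplus_commute)
    then show ?thesis using xy by (simp add: hfac_mult)
  qed
  have "Ffac n y * Ffac n x * (?A 1 (bar y) * ?A 2 (bar x)) =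
      Ffac n y * Ffac n x * (?A 1 (bar x) * ?A 2 (bar y)) * ?h (Sgen 1) ?t"
    by (simp only: sw mult.assoc)
  also have "\<dots> = (?A 1 y * ?A 2 x) * (?hz y * ?h (Sgen 1) (oplus x y) * ?hz x) * ?h (Sgen 1) ?t"
    using Ffac_pair_BC[of n y x, where ?'x = 'x] X n xy by (simp add: X_def oplus_commute)
  also have "\<dots> = ?A 1 x * ?A 2 y * (?h (Sgen 1) ?s * ?hz y * ?h (Sgen 1) (oplus x y) * ?hz x) * ?h (Sgen 1) ?t"
    by (simp add: sw' mult.assoc del: One_nat_def)
  also have "\<dots> = ?A 1 x * ?A 2 y * (?hz x * ?h (Sgen 1) (oplus x y) * ?hz y) * (?h (Sgen 1) ?s * ?h (Sgen 1) ?t)"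
    unfolding yb[symmetric] by (simp add: mult.assoc del: One_nat_def)
  also have "\<dots> = Ffac n x * Ffac n y * (?A 1 (bar y) * ?A 2 (bar x))"
    using Ffac_pair_BC[of n x y, where ?'x = 'x] X n xy st by (simp add: X_def)
  finally have "Ffac n y * Ffac n x * (?A 1 (bar y) * ?A 2 (bar x)) =
      Ffac n x * Ffac n y * (?A 1 (bar y) * ?A 2 (bar x))" .
  moreover have "iunit (?A 1 (bar y) * ?A 2 (bar x))"
    using xy by (intro iunit_mult iunit_Afac) auto
  ultimately show ?thesis by (simp add: iunit_cancel)
qed

text \<open>Serves both the commutation of the F and the action of s_hat1. Only one h_hat1 is left
  over because h_1 and h_hat1 commute.\<close>

lemma Ffac_pair_D:
  assumes X: "ctype_of TYPE('x::ctag) = TypeD" and n: "2 \<le> n" and xy: "good x" "good y"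
  shows "Ffac n x * Ffac n y * (Afac n 1 (bar y) * Afac n 2 (bar x)) =
    (Afac n 1 x * Afac n 2 y * hfac Hat1 (oplus x y) :: 'x idalg)"
proof -
  let ?A = "Afac n :: nat \<Rightarrow> R \<Rightarrow> 'x idalg" and ?h = "hfac :: gen \<Rightarrow> R \<Rightarrow> 'x idalg"
  have F: "Ffac n z * ?A 2 (bar z) = ?A 1 z * ?h Hat1 z" if "good z" for z
    using Ffac_Afac_D[OF X that n] .
  have A1: "?A 1 z = ?A 2 z * ?h (Sgen 1) z" for z
    using Afac_rec[of 1 n z, where ?'a = 'x] n by (simp add: numeral_2_eq_2)
  have c: "?h Hat1 z * ?h (Sgen 1) z' = ?h (Sgen 1) z' * ?h Hat1 z" for z z'
    using X braided_Hat1[of 1] by (intro hfac_commute) auto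
  \<comment> \<open>The swap of A_1 factors with \<open>Hat1\<close> in the place of s_1; its
    neighbour is again s_2.\<close>
  have sw: "(?A 2 y * ?h Hat1 y) * ?A 2 (bar x) =
      (?A 2 (bar x) * ?h Hat1 (bar x)) * ?A 2 y * ?h Hat1 (ominus y (bar x))"
  proof (rule Afac_swap_step)
    show "braided 3 (Sgen 2) Hat1" using braided_Hat1[of 2] braided_commute by auto
    show "Hat1 \<noteq> Sgen k \<and> braided 2 Hat1 (Sgen k)" if "2 < k" for k
      using that braided_Hat1[of k] by simp
    show "?A 2 y * ?A (Suc 2) (bar x) = ?A 2 (bar x) * ?A (Suc 2) y * ?h (Sgen 2) (ominus y (bar x))"
      if "2 < n"
      using that xy by (intro Afac_swap) auto
  qed (use X xy in auto)
  have "Ffac n y * ?A 1 (bar y) = ?A 2 y * ?h Hat1 y"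
  proof -
    have "Ffac n y * ?A 1 (bar y) = Ffac n y * ?A 2 (bar y) * ?h (Sgen 1) (bar y)"
      by (simp add: A1 mult.assoc del: One_nat_def)
    also have "\<dots> = ?A 2 y * (?h (Sgen 1) y * ?h Hat1 y) * ?h (Sgen 1) (bar y)"
      by (simp add: F xy A1[of y] mult.assoc del: One_nat_def)
    also have "\<dots> = ?A 2 y * ?h Hat1 y * (?h (Sgen 1) y * ?h (Sgen 1) (bar y))"
      by (simp add: c[symmetric] mult.assoc del: One_nat_def)
    finally show ?thesis using xy by (simp add: hfac_bar)
  qed
  then have "Ffac n x * Ffac n y * (?A 1 (bar y) * ?A 2 (bar x)) =
      Ffac n x * ((?A 2 y * ?h Hat1 y) * ?A 2 (bar x))"
    by (metis mult.assoc)
  also have "\<dots> = (Ffac n x * ?A 2 (bar x)) * ?h Hat1 (bar x) * ?A 2 y * ?h Hat1 (ominus y (bar x))"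
    unfolding sw by (simp add: mult.assoc del: One_nat_def)
  also have "\<dots> = ?A 1 x * (?h Hat1 x * ?h Hat1 (bar x)) * ?A 2 y * ?h Hat1 (ominus y (bar x))"
    by (simp add: F xy mult.assoc del: One_nat_def)
  finally show ?thesis
    using X xy by (simp add: hfac_bar oplus_commute)
qed

lemma Ffac_commute_D:
  assumes X: "ctype_of TYPE('x::ctag) = TypeD" and n: "2 \<le> n" and xy: "good x" "good y"
  shows "Ffac n x * Ffac n y = (Ffac n y * Ffac n x :: 'x idalg)"
proof -
  let ?A = "Afac n :: nat \<Rightarrow> R \<Rightarrow> 'x idalg" and ?h = "hfac :: gen \<Rightarrow> R \<Rightarrow> 'x idalg"
  let ?t = "ominus x y"
  have sw: "?A 1 (bar y) * ?A 2 (bar x) = ?A 1 (bar x) * ?A 2 (bar y) * ?h (Sgen 1) ?t"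
    using Afac_swap[of 1 n "bar x" "bar y", where ?'x = 'x] n xy
    by (simp add: numeral_2_eq_2 oplus_commute)
  have sw': "?A 1 x * ?A 2 y = ?A 1 y * ?A 2 x * ?h (Sgen 1) ?t"
    using Afac_swap[of 1 n y x, where ?'x = 'x] n xy by (simp add: numeral_2_eq_2)
  have c: "?h Hat1 z * ?h (Sgen 1) z' = ?h (Sgen 1) z' * ?h Hat1 z" for z z'
    using X braided_Hat1[of 1] by (intro hfac_commute) auto
  have "Ffac n y * Ffac n x * (?A 1 (bar y) * ?A 2 (bar x)) =
      Ffac n y * Ffac n x * (?A 1 (bar x) * ?A 2 (bar y)) * ?h (Sgen 1) ?t"
    by (simp only: sw mult.assoc)
  also have "\<dots> = ?A 1 y * ?A 2 x * (?h Hat1 (oplus x y) * ?h (Sgen 1) ?t)"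
    using Ffac_pair_D[OF X n xy(2,1)] by (simp add: oplus_commute mult.assoc del: One_nat_def)
  also have "\<dots> = ?A 1 x * ?A 2 y * ?h Hat1 (oplus x y)"
    by (simp add: c sw' mult.assoc del: One_nat_def)
  also have "\<dots> = Ffac n x * Ffac n y * (?A 1 (bar y) * ?A 2 (bar x))"
    using Ffac_pair_D[OF X n xy] by simp
  finally have "Ffac n y * Ffac n x * (?A 1 (bar y) * ?A 2 (bar x)) =
      Ffac n x * Ffac n y * (?A 1 (bar y) * ?A 2 (bar x))" .
  moreover have "iunit (?A 1 (bar y) * ?A 2 (bar x))"
    using xy by (intro iunit_mult iunit_Afac) auto
  ultimately show ?thesis by (simp add: iunit_cancel)
qed

lemma Ffac_commute:
  assumes "2 \<le> n" "good x" "good y"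
  shows "Ffac n x * Ffac n y = (Ffac n y * Ffac n x :: 'x::ctag idalg)"
proof (cases "ctype_of TYPE('x)")
  case TypeA
  then show ?thesis by (simp add: Ffac_def)
qed (use assms Ffac_commute_BC Ffac_commute_D in blast)+

lemma Ffac_Fprod_commute:
  assumes "2 \<le> n" "good z" "\<And>i. good (x i)"
  shows "Ffac n z * Fprod n k x = (Fprod n k x * Ffac n z :: 'x::ctag idalg)"
  unfolding Fprod_def by (rule prod_list_commute) (use assms Ffac_commute in auto)

lemma Fprod_Suc_shift: "Fprod n (Suc k) x = Ffac n (x 1) * Fprod n k (\<lambda>i. x (Suc i))"
proof -
  have "map (\<lambda>i. Ffac n (x i)) [1..<Suc (Suc k)] = Ffac n (x 1) # map (\<lambda>i. Ffac n (x (Suc i))) [1..<Suc k]"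
    by (simp add: upt_conv_Cons map_Suc_upt[symmetric] del: upt_Suc)
  from this show ?thesis unfolding Fprod_def by (metis prod_list.Cons)
qed

section \<open>Action of the divided difference operators\<close>

lemma beta_hom_s_act: "beta_hom (s_act i)"
  unfolding s_act_def by (rule beta_hom_msubst[OF adm_s_var])

lemma s_act_mvar: "s_act i (mvar v) = s_var i v"
  unfolding s_act_def by (rule msubst_mvar[OF adm_s_var])

lemma hfac_cancel:
  assumes "i \<in> gens (ctype_of TYPE('x::ctag))" "oplus x y = 0"
  shows "f * hfac i x * hfac i y = (f :: 'x idalg)"
  using assms by (simp add: hfac_mult mult.assoc)

lemma Gprod_Suc_split:
  assumes "1 < n"
  shows "Gprod n a = Afac n 1 (a 1) * prod_list (map (\<lambda>i. Afac n i (a i)) [2..<n])"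
  using assms by (simp add: Gprod_def upt_conv_Cons numeral_2_eq_2)

lemma Gprod_Suc_Suc_split:
  assumes "2 < n"
  shows "Gprod n a = Afac n 1 (a 1) * Afac n 2 (a 2) * prod_list (map (\<lambda>i. Afac n i (a i)) [3..<n])"
  using assms by (simp add: Gprod_def upt_conv_Cons numeral_2_eq_2 numeral_3_eq_3 mult.assoc)

lemma Fprod_cong: "(\<And>i. 0 < i \<Longrightarrow> x i = y i) \<Longrightarrow> Fprod n k x = Fprod n k y"
  unfolding Fprod_def by (intro arg_cong[of _ _ prod_list] map_cong) auto

text \<open>A permutation of the a_j leaves F alone, so this is \<open>Gprod_swap\<close>.\<close>

lemma s_act_FG_pos:
  fixes X defines "X \<equiv> ctype_of TYPE('x::ctag)"
  assumes "0 < k" "Suc k < n"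
  shows "beta_hom.imap (s_act (Sgen k)) (Fprod n n xvar * Gprod n avar) * hfac (Sgen k) (alpha X (Sgen k)) =
    (Fprod n n xvar * Gprod n avar :: 'x idalg)"
proof -
  interpret beta_hom "s_act (Sgen k)" by (rule beta_hom_s_act)
  have "imap (Fprod n n xvar) = (Fprod n n xvar :: 'x idalg)"
    using assms by (simp add: imap_Fprod s_act_mvar)
  moreover have "imap (Gprod n avar) * hfac (Sgen k) (alpha X (Sgen k)) = (Gprod n avar :: 'x idalg)"
  proof -
    have G: "imap (Gprod n avar) = (Gprod n (\<lambda>j. avar (Transposition.transpose k (Suc k) j)) :: 'x idalg)"
      using assms by (simp add: imap_Gprod s_act_mvar)
    show ?thesis
      unfolding G using assms Gprod_swap[of k n avar, where ?'x = 'x] by simp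
  qed
  ultimately show ?thesis by (simp add: imap_mult mult.assoc)
qed

text \<open>The shift puts F(a_1) in front. Moved past the other F factors, it turns A_1(bar a_1)
  into A_1(a_1) h_0(z); this h_0 commutes with A_2, A_3, ... and is cancelled at the right end by
  h_0(alpha_0).\<close>

lemma s_act_FG_0:
  fixes X defines "X \<equiv> ctype_of TYPE('x::ctag)"
  assumes "X = TypeB \<or> X = TypeC" "2 \<le> n"
  shows "beta_hom.imap (s_act (Sgen 0)) (Fprod n n xvar * Gprod n avar) * hfac (Sgen 0) (alpha X (Sgen 0)) =
    (Fprod n (n - 1) xvar * Gprod n avar :: 'x idalg)"
proof -
  interpret beta_hom "s_act (Sgen 0)" by (rule beta_hom_s_act)
  have g: "Sgen 0 \<in> gens (ctype_of TYPE('x))" using assms by auto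
  obtain k where k: "n = Suc k" using assms by (cases n) auto
  let ?R = "prod_list (map (\<lambda>i. Afac n i (avar i)) [2..<n]) :: 'x idalg"
  let ?z = "zpar X (avar 1)"
  have "Fprod n k (\<lambda>i. s_act (Sgen 0) (xvar (Suc i))) = (Fprod n k xvar :: 'x idalg)"
    by (rule Fprod_cong) (simp add: s_act_mvar)
  then have "(imap (Fprod n n xvar) :: 'x idalg) = Ffac n (avar 1) * Fprod n (n - 1) xvar"
    unfolding imap_Fprod by (simp add: k Fprod_Suc_shift s_act_mvar[of _ "VX (Suc 0)"])
  also have "\<dots> = Fprod n (n - 1) xvar * Ffac n (avar 1)"
    using assms by (intro Ffac_Fprod_commute) auto
  finally have F: "(imap (Fprod n n xvar) :: 'x idalg) = Fprod n (n - 1) xvar * Ffac n (avar 1)" .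
  have "map (\<lambda>i. Afac n i (s_act (Sgen 0) (avar i))) [2..<n] = (map (\<lambda>i. Afac n i (avar i)) [2..<n] :: 'x idalg list)"
    by (rule map_cong) (auto simp: s_act_mvar)
  then have "Gprod n (\<lambda>i. s_act (Sgen 0) (avar i)) = Afac n 1 (s_act (Sgen 0) (avar 1)) * ?R"
    using Gprod_Suc_split[of n "\<lambda>i. s_act (Sgen 0) (avar i)", where ?'a = 'x] assms(3) by (simp only:)
  then have G: "(imap (Gprod n avar) :: 'x idalg) = Afac n 1 (bar (avar 1)) * ?R"
    unfolding imap_Gprod by (simp add: s_act_mvar[of _ "VA (Suc 0)"])
  have c: "hfac (Sgen 0) ?z * ?R = ?R * hfac (Sgen 0) ?z"
    using g by (intro hfac_prod_Afac_commute) (auto simp: braided_0_far)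
  have "imap (Fprod n n xvar * Gprod n avar) =
      (Fprod n (n - 1) xvar * (Ffac n (avar 1) * Afac n 1 (bar (avar 1))) * ?R :: 'x idalg)"
    by (simp only: imap_mult F G mult.assoc)
  also have "\<dots> = Fprod n (n - 1) xvar * (Afac n 1 (avar 1) * hfac (Sgen 0) ?z) * ?R"
    using Ffac_Afac_BC[of "avar 1" n, where ?'x = 'x] assms by (simp add: X_def)
  also have "\<dots> = Fprod n (n - 1) xvar * (Afac n 1 (avar 1) * ?R) * hfac (Sgen 0) ?z"
    by (simp only: c mult.assoc)
  also have "Afac n 1 (avar 1) * ?R = Gprod n avar"
    using assms by (simp add: Gprod_Suc_split)
  finally have eq: "imap (Fprod n n xvar * Gprod n avar) =
      (Fprod n (n - 1) xvar * Gprod n avar * hfac (Sgen 0) ?z :: 'x idalg)" .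
  have "oplus ?z (alpha X (Sgen 0)) = 0"
  proof (cases "X = TypeC")
    case True
    have "oplus (oplus (avar 1) (avar 1)) (oplus (bar (avar 1)) (bar (avar 1))) =
        oplus (oplus (avar 1) (bar (avar 1))) (oplus (avar 1) (bar (avar 1)))"
      by (rule oplus_exchange)
    then show ?thesis using True by (simp add: zpar_def)
  qed (simp add: zpar_def)
  then show ?thesis
    unfolding eq using g by (intro hfac_cancel)
qed

text \<open>As for s_0 with two factors: s_hat1 produces A_1(bar a_2) A_2(bar a_1), in the order
  that \<open>Ffac_pair_D\<close> needs behind F(a_1) F(a_2). Here h_hat1 has to pass A_3, A_4, ...,
  so G is split after its second factor.\<close>

lemma s_act_FG_Hat1:
  fixes X defines "X \<equiv> ctype_of TYPE('x::ctag)"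
  assumes "X = TypeD" "3 \<le> n"
  shows "beta_hom.imap (s_act Hat1) (Fprod n n xvar * Gprod n avar) * hfac Hat1 (alpha X Hat1) =
    (Fprod n (n - 2) xvar * Gprod n avar :: 'x idalg)"
proof -
  interpret beta_hom "s_act Hat1" by (rule beta_hom_s_act)
  have g: "Hat1 \<in> gens (ctype_of TYPE('x))" using assms by auto
  obtain k where k: "n = Suc (Suc k)" using assms(3) by (intro that[of "n - 2"]) simp
  let ?R = "prod_list (map (\<lambda>i. Afac n i (avar i)) [3..<n]) :: 'x idalg"
  let ?z = "oplus (avar 1) (avar 2)"
  let ?F = "Fprod n (n - 2) xvar :: 'x idalg"
  have c1: "Ffac n (avar i) * ?F = ?F * Ffac n (avar i)" for i
    using assms by (intro Ffac_Fprod_commute) auto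
  have "Fprod n k (\<lambda>i. s_act Hat1 (xvar (Suc (Suc i)))) = (Fprod n k xvar :: 'x idalg)"
    by (rule Fprod_cong) (simp add: s_act_mvar)
  then have "(imap (Fprod n n xvar) :: 'x idalg) = Ffac n (avar 1) * (Ffac n (avar 2) * ?F)"
    unfolding imap_Fprod
    by (simp add: k Fprod_Suc_shift s_act_mvar[of _ "VX (Suc 0)"] s_act_mvar[of _ "VX (Suc (Suc 0))"]
        numeral_2_eq_2)
  also have "\<dots> = Ffac n (avar 1) * ?F * Ffac n (avar 2)"
    by (simp only: c1[of 2] mult.assoc)
  also have "\<dots> = ?F * (Ffac n (avar 1) * Ffac n (avar 2))"
    by (simp only: c1[of 1] mult.assoc)
  finally have F: "(imap (Fprod n n xvar) :: 'x idalg) = ?F * (Ffac n (avar 1) * Ffac n (avar 2))" .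
  have "map (\<lambda>i. Afac n i (s_act Hat1 (avar i))) [3..<n] = (map (\<lambda>i. Afac n i (avar i)) [3..<n] :: 'x idalg list)"
    by (rule map_cong) (auto simp: s_act_mvar)
  then have "Gprod n (\<lambda>i. s_act Hat1 (avar i)) =
      Afac n 1 (s_act Hat1 (avar 1)) * Afac n 2 (s_act Hat1 (avar 2)) * ?R"
    using Gprod_Suc_Suc_split[of n "\<lambda>i. s_act Hat1 (avar i)", where ?'a = 'x] assms(3) by (simp only:)
  then have G: "(imap (Gprod n avar) :: 'x idalg) = Afac n 1 (bar (avar 2)) * Afac n 2 (bar (avar 1)) * ?R"
    unfolding imap_Gprod by (simp add: s_act_mvar[of _ "VA (Suc 0)"] s_act_mvar[of _ "VA 2"])
  have c: "hfac Hat1 ?z * ?R = ?R * hfac Hat1 ?z"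
  proof (rule hfac_prod_Afac_commute[OF g])
    show "Hat1 \<noteq> Sgen k \<and> braided 2 Hat1 (Sgen k)" if "3 \<le> k" for k
      using that braided_Hat1[of k] by simp
  qed simp
  have "imap (Fprod n n xvar * Gprod n avar) =
      (?F * (Ffac n (avar 1) * Ffac n (avar 2) * (Afac n 1 (bar (avar 2)) * Afac n 2 (bar (avar 1)))) * ?R :: 'x idalg)"
    by (simp only: imap_mult F G mult.assoc)
  also have "\<dots> = ?F * (Afac n 1 (avar 1) * Afac n 2 (avar 2) * hfac Hat1 ?z) * ?R"
    using Ffac_pair_D[of n "avar 1" "avar 2", where ?'x = 'x] assms by (simp add: X_def)
  also have "\<dots> = ?F * (Afac n 1 (avar 1) * Afac n 2 (avar 2) * ?R) * hfac Hat1 ?z"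
    by (simp only: c mult.assoc)
  also have "Afac n 1 (avar 1) * Afac n 2 (avar 2) * ?R = Gprod n avar"
    using assms by (simp add: Gprod_Suc_Suc_split)
  finally have eq: "imap (Fprod n n xvar * Gprod n avar) =
      (?F * Gprod n avar * hfac Hat1 ?z :: 'x idalg)" .
  have "oplus ?z (alpha X Hat1) = oplus (oplus (avar 1) (bar (avar 1))) (oplus (avar 2) (bar (avar 2)))"
    by (simp only: alpha.simps oplus_exchange)
  then show ?thesis
    unfolding eq using g by (intro hfac_cancel) simp_all
qed

text \<open>The relations of finite rank have n, n-1 or n-2 variables on the right. All these
  sequences have the limit \<open>Flim\<close>, and s_i is continuous.\<close>

lemma s_act_FG_lim:
  fixes X defines "X \<equiv> ctype_of TYPE('x::ctag)"
  assumes i: "i \<in> gens X"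
  shows "beta_hom.imap (s_act i) (Flim * Glim avar) * hfac i (alpha X i) = (Flim * Glim avar :: 'x idalg)"
proof -
  interpret beta_hom "s_act i" by (rule beta_hom_s_act)
  obtain K N where K: "filterlim K at_top sequentially"
    and eq: "\<And>n. N \<le> n \<Longrightarrow> imap (Fprod n n xvar * Gprod n avar) * hfac i (alpha X i) =
      (Fprod n (K n) xvar * Gprod n avar :: 'x idalg)"
  proof (cases i)
    case Hat1
    have "filterlim (\<lambda>n. n - 2) at_top (sequentially :: nat filter)"
      by (rule filterlim_minus_const_nat_at_top)
    then show ?thesis
      using that[of "\<lambda>n. n - 2" 3] s_act_FG_Hat1[where ?'x = 'x] Hat1 i by (simp add: X_def)
  next
    case (Sgen k)
    show ?thesis
    proof (cases "k = 0")
      case True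
      have "filterlim (\<lambda>n. n - 1) at_top (sequentially :: nat filter)"
        by (rule filterlim_minus_const_nat_at_top)
      then show ?thesis
        using that[of "\<lambda>n. n - 1" 2] s_act_FG_0[where ?'x = 'x] True Sgen i by (simp add: X_def del: alpha.simps)
    next
      case False
      show ?thesis
        using that[of "\<lambda>n. n" "k + 2"] s_act_FG_pos[of k, where ?'x = 'x] False Sgen
        by (simp add: X_def filterlim_ident del: alpha.simps)
    qed
  qed
  have cont: "mtends (\<lambda>n. s_act i (f n)) (s_act i g)" if "mtends f g" for f g
    using that unfolding s_act_def by (rule msubst_mtends[OF adm_s_var])
  have "itends (\<lambda>n. Fprod n n xvar * Gprod n avar) (Flim * Glim avar :: 'x idalg)"
    by (intro itends_mult itends_Flim itends_Glim filterlim_ident)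
  from itends_mult[OF itends_imap[OF cont this] itends_const]
  have lim: "itends (\<lambda>n. imap (Fprod n n xvar * Gprod n avar) * hfac i (alpha X i))
      (imap (Flim * Glim avar) * hfac i (alpha X i) :: 'x idalg)" .
  have ev: "\<forall>\<^sub>F n in sequentially. Fprod n (K n) xvar * Gprod n avar =
      (imap (Fprod n n xvar * Gprod n avar) * hfac i (alpha X i) :: 'x idalg)"
    using eq by (intro eventually_sequentiallyI[of N]) simp
  have "itends (\<lambda>n. Fprod n (K n) xvar * Gprod n avar) (Flim * Glim avar :: 'x idalg)"
    by (intro itends_mult itends_Flim itends_Glim K)
  from itends_unique[OF lim itends_cong[OF ev this]] show ?thesis .
qed

lemma imap_Glim_lim:
  assumes "beta_hom \<phi>" "\<And>f g. mtends f g \<Longrightarrow> mtends (\<lambda>n. \<phi> (f n)) (\<phi> g)"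
  shows "beta_hom.imap \<phi> (Glim a) = Glim (\<lambda>i. \<phi> (a i))"
proof -
  interpret beta_hom \<phi> by (rule assms(1))
  have "itends (\<lambda>n. imap (Gprod n a)) (imap (Glim a))"
    by (intro itends_imap assms(2) itends_Glim)
  then show ?thesis
    unfolding imap_Gprod using itends_unique itends_Glim by blast
qed

text \<open>The generating function \<open>G\<^sub>A(\<bar>b)\<^sup>-\<^sup>1 F\<^sup>X(x) G\<^sub>A(a)\<close> of the \<open>\<G>\<^sup>X\<^sub>w(a,b;x)\<close>.\<close>

definition Gfun :: "'x::ctag idalg" where
  "Gfun = iinv (Glim (\<lambda>i. bar (bvar i))) * (Flim * Glim avar)"

lemma s_act_Gfun:
  fixes X defines "X \<equiv> ctype_of TYPE('x::ctag)"
  assumes i: "i \<in> gens X"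
  shows "beta_hom.imap (s_act i) Gfun * hfac i (alpha X i) = (Gfun :: 'x idalg)"
proof -
  interpret beta_hom "s_act i" by (rule beta_hom_s_act)
  have "(\<lambda>k. s_act i (bar (bvar k))) = (\<lambda>k. bar (bvar k))"
    by (simp add: hom_bar s_act_mvar)
  moreover have "mtends (\<lambda>n. s_act i (f n)) (s_act i g)" if "mtends f g" for f g
    using that unfolding s_act_def by (rule msubst_mtends[OF adm_s_var])
  ultimately have "imap (Glim (\<lambda>k. bar (bvar k))) = (Glim (\<lambda>k. bar (bvar k)) :: 'x idalg)"
    by (simp add: imap_Glim_lim[OF beta_hom_s_act])
  moreover have "iunit (Glim (\<lambda>k. bar (bvar k)) :: 'x idalg)"
    by (intro iunit_Glim) simp
  ultimately show ?thesis
    unfolding Gfun_def using s_act_FG_lim[of i, where ?'x = 'x] i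
    by (simp add: imap_mult imap_iinv mult.assoc X_def)
qed

text \<open>Every \<open>s\<^sub>i\<close> fixes \<open>T\<close>, a product of generators, and multiplies \<open>Gfun\<close> by the inverse of
  \<open>h\<^sub>i(\<alpha>\<^sub>i)\<close>; so \<open>\<psi>\<^sub>i\<close> turns \<open>Gfun * T\<close> into \<open>Gfun * u\<^sub>i * T\<close>.\<close>

lemma psi_op_Gfun:
  fixes X defines "X \<equiv> ctype_of TYPE('x::ctag)"
  assumes i: "i \<in> gens X" and T: "beta_hom.imap (s_act i) T = (T :: 'x idalg)"
  shows "psi_op X i (icoeff (Gfun * T) w) = icoeff (Gfun * (ugen i * T)) w"
proof -
  interpret beta_hom "s_act i" by (rule beta_hom_s_act)
  define \<alpha> where "\<alpha> = alpha X i"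
  define M where "M = (Gfun :: 'x idalg)"
  define u where "u = (ugen i :: 'x idalg)"
  define f where "f = icoeff (M * T) w"
  have uu: "u * u = beta \<bullet> u"
    using i ugen_square[of i, where ?'x = 'x] by (simp add: u_def X_def)
  \<comment> \<open>The second factor is 1 + beta \<alpha> times the inverse of h_i(\<alpha>),
    written without division.\<close>
  have "(1 + \<alpha> \<bullet> u) * ((1 + beta * \<alpha>) \<bullet> 1 - \<alpha> \<bullet> u) = (1 + beta * \<alpha>) \<bullet> (1 :: 'x idalg)"
    by (simp add: algebra_simps uu smul_left_distrib smul_right_distrib smul_right_diff)
  then have "imap M * (1 + \<alpha> \<bullet> u) * ((1 + beta * \<alpha>) \<bullet> 1 - \<alpha> \<bullet> u) = (1 + beta * \<alpha>) \<bullet> imap M"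
    by (simp add: mult.assoc)
  moreover have "imap M * (1 + \<alpha> \<bullet> u) = M"
    using s_act_Gfun[of i, where ?'x = 'x] i by (simp add: M_def \<alpha>_def u_def hfac_def X_def)
  ultimately have "(1 + beta * \<alpha>) \<bullet> imap M = M * ((1 + beta * \<alpha>) \<bullet> 1 - \<alpha> \<bullet> u)"
    by simp
  then have "(1 + beta * \<alpha>) \<bullet> imap (M * T) = M * ((1 + beta * \<alpha>) \<bullet> 1 - \<alpha> \<bullet> u) * T"
    using T by (simp add: imap_mult smul_mult_left[symmetric] del: smul_mult_left)
  also have "\<dots> = (1 + beta * \<alpha>) \<bullet> (M * T) - \<alpha> \<bullet> (M * (u * T))"
    by (simp add: algebra_simps smul_right_diff)
  finally have "(1 + beta * \<alpha>) * s_act i f = (1 + beta * \<alpha>) * f - \<alpha> * icoeff (M * (u * T)) w"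
    by (metis (no_types) f_def icoeff_imap icoeff_smul icoeff_simps(3))
  then have "\<alpha> * (icoeff (M * (u * T)) w - beta * f) = f - (1 + beta * \<alpha>) * s_act i f"
    by (simp add: algebra_simps)
  then have "pi_op X i f = icoeff (M * (u * T)) w - beta * f"
    unfolding pi_op_def \<alpha>_def by (intro mquot_eqI cancellable_alpha i)
  then show ?thesis
    by (simp add: psi_op_def f_def M_def u_def)
qed

text \<open>The innermost operator acts first and each further u_i enters directly behind
  \<open>Gfun\<close>, so the generators end up in the order of the word. Their product has constant
  coefficients, hence is fixed by every s_i.\<close>

lemma psi_Gfun:
  fixes X defines "X \<equiv> ctype_of TYPE('x::ctag)"
  assumes v: "v \<in> weyl X"
  shows "psi X v (icoeff (Gfun :: 'x idalg) w) = icoeff (Gfun * ibasis v :: 'x idalg) w"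
proof -
  have foldr: "foldr (psi_op X) p (icoeff (Gfun :: 'x idalg) w) =
      icoeff (Gfun * prod_list (map ugen p) :: 'x idalg) w" if "set p \<subseteq> gens X" for p
    using that
  proof (induction p)
    case (Cons i p)
    interpret beta_hom "s_act i" by (rule beta_hom_s_act)
    have "prod_list (map (\<lambda>g. imap (ugen g :: 'x idalg)) p) = prod_list (map ugen p)"
      using Cons.prems by (intro arg_cong[of _ _ prod_list] map_cong) (auto simp: X_def)
    then have "imap (prod_list (map ugen p)) = (prod_list (map ugen p) :: 'x idalg)"
      by (simp add: imap_prod_list o_def)
    then show ?case
      using Cons psi_op_Gfun[of i "prod_list (map ugen p) :: 'x idalg"] by (simp add: X_def)
  qed simp
  have "reduced X (SOME p. reduced X p v) v"
    using reduced_exists[OF v] by (rule someI_ex)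
  then show ?thesis
    unfolding psi_def using foldr prod_list_ugen_reduced[where ?'x = 'x]
    by (simp add: reduced_def X_def)
qed

section \<open>The product formula\<close>

lemma grothendieck_product:
  fixes X defines "X \<equiv> ctype_of TYPE('x::ctag)"
  assumes w: "w \<in> weyl X"
  shows "grothendieck X avar bvar xvar w =
    (\<Sum>u | u \<in> weyl X \<and> bruhat X u w.
       H_cbar X u w * grothendieck X avar cvar xvar (inv u \<circ> w))"
proof -
  interpret beta_hom "msubst cbar_var" by (rule beta_hom_msubst[OF adm_cbar_var])
  let ?B = "Glim (\<lambda>i. bar (bvar i)) :: 'x idalg" and ?C = "Glim (\<lambda>i. bar (cvar i)) :: 'x idalg"
  define P where "P = iinv ?B * ?C"
  define Q where "Q = iinv ?C * (Flim * Glim avar)"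
  have unit: "iunit ?B" "iunit ?C" by (intro iunit_Glim; simp)+
  have cont: "mtends (\<lambda>n. msubst cbar_var (f n)) (msubst cbar_var g)" if "mtends f g" for f g
    using that by (rule msubst_mtends[OF adm_cbar_var])
  have v [simp]: "msubst cbar_var (mvar v) = cbar_var v" for v
    by (rule msubst_mvar[OF adm_cbar_var])
  have "itends (\<lambda>N. imap (Fprod N N xvar)) (imap Flim :: 'x idalg)"
    by (intro itends_imap cont itends_Flim filterlim_ident)
  then have "itends (\<lambda>N. 1) (imap Flim :: 'x idalg)"
    by (simp add: imap_Fprod Fprod_0)
  then have F: "imap Flim = (1 :: 'x idalg)"
    by (rule itends_unique) simp
  have "imap (Glim a) = (Glim (\<lambda>i. msubst cbar_var (a i)) :: 'x idalg)" for a
    by (rule imap_Glim_lim[OF beta_hom_axioms cont])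
  then have "imap Gfun = P"
    unfolding Gfun_def P_def imap_mult imap_iinv[OF unit(1)] F by (simp add: hom_bar)
  then have H: "H_cbar X u w = icoeff (P * ibasis (inv u \<circ> w)) w" if "u \<in> weyl X" for u
  proof -
    have uw: "inv u \<circ> w \<in> weyl X" using that w by simp
    have "H_poly X u w = icoeff (Gfun * ibasis (inv u \<circ> w) :: 'x idalg) w"
      unfolding H_poly_def using grothendieck_eq[of bvar w avar, where ?'x = 'x] w
        psi_Gfun[of "inv u \<circ> w" w, where ?'x = 'x] uw by (simp add: X_def Gfun_def[symmetric])
    then show ?thesis
      unfolding H_cbar_def using uw \<open>imap Gfun = P\<close>
      by (simp add: icoeff_imap[symmetric] imap_mult X_def del: icoeff_imap)
  qed
  \<comment> \<open>The set of all u^-1 w with u \<le> w, described through v. By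
    \<open>bruhat_dem\<close> it contains every v for which w is a Demazure product of some element
    with v.\<close>
  define V where "V = {v \<in> weyl X. bruhat X (w \<circ> inv v) w}"
  let ?U = "{u. u \<in> weyl X \<and> bruhat X u w}"
  have bij: "bij_betw (\<lambda>u. inv u \<circ> w) ?U V"
  proof (rule bij_betw_byWitness[where f' = "\<lambda>v. w \<circ> inv v"])
    have inv: "inv (inv u \<circ> w) = inv w \<circ> u" "inv (w \<circ> inv u) = u \<circ> inv w" if "u \<in> weyl X" for u
      using weyl_bij[OF that] weyl_bij[OF w]
      by (simp_all add: o_inv_distrib bij_imp_bij_inv inv_inv_eq)
    show "\<forall>u\<in>?U. w \<circ> inv (inv u \<circ> w) = u" "\<forall>v\<in>V. inv (w \<circ> inv v) \<circ> w = v"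
      using w by (auto simp: V_def inv simp del: o_apply) 
    show "(\<lambda>u. inv u \<circ> w) ` ?U \<subseteq> V"
      using w by (auto simp: V_def inv)
    show "(\<lambda>v. w \<circ> inv v) ` V \<subseteq> ?U"
      using w by (auto simp: V_def)
  qed
  have "finite V"
    using bij_betw_finite[OF bij] finite_subset[OF _ finite_bruhat[OF w], of ?U] by blast
  have "grothendieck X avar bvar xvar w = icoeff (P * Q) w"
    using grothendieck_eq[of bvar w avar, where ?'x = 'x] w unit
    by (simp add: X_def P_def Q_def mult.assoc)
  also have "\<dots> = (\<Sum>v\<in>V. icoeff (P * ibasis v) w * icoeff Q v)"
    by (rule icoeff_mult_expand) (use \<open>finite V\<close> bruhat_dem in \<open>auto simp: V_def X_def\<close>)
  also have "\<dots> = (\<Sum>u\<in>?U. icoeff (P * ibasis (inv u \<circ> w)) w * icoeff Q (inv u \<circ> w))"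
    by (rule sum.reindex_bij_betw[OF bij, symmetric])
  also have "\<dots> = (\<Sum>u\<in>?U. H_cbar X u w * grothendieck X avar cvar xvar (inv u \<circ> w))"
  proof (intro sum.cong refl)
    fix u assume "u \<in> ?U"
    then have u: "u \<in> weyl X" "inv u \<circ> w \<in> weyl X" using w by auto
    then show "icoeff (P * ibasis (inv u \<circ> w)) w * icoeff Q (inv u \<circ> w) =
        H_cbar X u w * grothendieck X avar cvar xvar (inv u \<circ> w)"
      using H grothendieck_eq[of cvar "inv u \<circ> w" avar, where ?'x = 'x] by (simp add: X_def Q_def)
  qed
  finally show ?thesis .
qed

section \<open>The four types as instances\<close>

datatype tagA = TagA
datatype tagB = TagB
datatype tagC = TagC
datatype tagD = TagD

instantiation tagA :: ctag
begin
definition ctype_of_tagA :: "tagA itself \<Rightarrow> ctype" where "ctype_of_tagA _ = TypeA"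
instance ..
end

instantiation tagB :: ctag
begin
definition ctype_of_tagB :: "tagB itself \<Rightarrow> ctype" where "ctype_of_tagB _ = TypeB"
instance ..
end

instantiation tagC :: ctag
begin
definition ctype_of_tagC :: "tagC itself \<Rightarrow> ctype" where "ctype_of_tagC _ = TypeC"
instance ..
end

instantiation tagD :: ctag
begin
definition ctype_of_tagD :: "tagD itself \<Rightarrow> ctype" where "ctype_of_tagD _ = TypeD"
instance ..
end

theorem theorem3:
  fixes X :: ctype and w :: sperm
  assumes "w \<in> weyl X"
  shows "grothendieck X avar bvar xvar w =
    (\<Sum>u | u \<in> weyl X \<and> bruhat X u w.
       H_cbar X u w * grothendieck X avar cvar xvar (inv u \<circ> w))"
proof (cases X)
  case TypeA
  then show ?thesis
    using grothendieck_product[where ?'x = tagA] assms by (simp add: ctype_of_tagA_def)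
next
  case TypeB
  then show ?thesis
    using grothendieck_product[where ?'x = tagB] assms by (simp add: ctype_of_tagB_def)
next
  case TypeC
  then show ?thesis
    using grothendieck_product[where ?'x = tagC] assms by (simp add: ctype_of_tagC_def)
next
  case TypeD
  then show ?thesis
    using grothendieck_product[where ?'x = tagD] assms by (simp add: ctype_of_tagD_def)
qed

end
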